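(* Let $(\Omega,\mathcal F,(\mathcal F_t)_{t\ge0},\mathbb P)$ satisfy the usual conditions, $H$ be a real separable Hilbert space, and $\mathbf A_t=(X_t,A_t,Q_t)$, $\mathbf A_0=(0,0,0)$, be an adapted càdlàg process with values in $\mathscr G_{\mathrm{crit}}(H)$. For bounded stopping times $0\le\sigma\le\tau\le T$ define $$\mathbf\Phi_{\sigma,\tau}=\mathbf A_\sigma^{-1}\circ\mathbf A_\tau=\bigl(X_\tau-X_\sigma,\ A_\tau-A_\sigma-\tfrac12X_\sigma\wedge_{\mathrm{op}}X_\tau,\ Q_\tau-Q_\sigma\bigr).$$ Then $\mathbf\Phi_{\sigma,\tau}$ is $\mathcal F_\tau$-measurable and, on one event of probability one, simultaneously for all bounded stopping triples $\sigma\le\rho\le\tau$, $$\mathbf\Phi_{\sigma,\tau}=\mathbf\Phi_{\sigma,\rho}\circ\mathbf\Phi_{\rho,\tau}.$$ It is the unique (up to almost sure equality) extension of the perfected deterministic-time character $(\mathbf\Phi_{s,t})_{0\le s\le t\le T}$ which is obtained by pointwise pasting on finite-valued stopping intervals and is continuous in probability under nested right-dyadic approximation. Suppose in addition that $X$ is an $H$-valued càdlàg semimartingale whose split anchor satisfies $A_t=\operatorname{Alt}_2\int_{(0,t]}X_{r-}\otimes\mathrm dX_r$ and $Q_t=[X]_t$. Then, writing $\mathbf\Phi_{\sigma,\tau}=(X_{\sigma,\tau},A_{\sigma,\tau},Q_{\sigma,\tau})$, $$X_{\sigma,\tau}=X_\tau-X_\sigma,\qquad Q_{\sigma,\tau}=[X]_\tau-[X]_\sigma,$$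 $$A_{\sigma,\tau}=\operatorname{Alt}_2\int_{(0,T]}\mathbf 1_{\{\sigma<r\le\tau\}}(X_{r-}-X_\sigma)\otimes\mathrm dX_r.$$
   Context: $\mathscr G_{\mathrm{crit}}(H)=H\times\mathcal S^0_{1,\infty}(H)_{\mathrm{skew}}\times\mathcal S_1(H)_{\mathrm{sa}}$, where $\mathcal S^0_{1,\infty}$ is the set of compact $A$ with $ns_n(A)\to0$ (quasi-norm $\|A\|_{1,\infty}=\sup_nns_n(A)$), $\mathcal S_1$ the trace class; it is a Polish group with the product topology and $(x,A,Q)\circ(y,B,R)=(x+y,A+B+\frac12x\wedge_{\mathrm{op}}y,Q+R)$, $(x,A,Q)^{-1}=(-x,-A,-Q)$, $x\wedge_{\mathrm{op}}y=x\otimes y-y\otimes x$, $x\otimes y:w\mapsto\langle w,y\rangle x$. $\operatorname{Alt}_2(u\otimes v)=\frac12(u\otimes v-v\otimes u)$; $[X]$ is the operator-valued optional quadratic variation. The deterministic-time character is $\mathbf\Phi_{s,t}=\mathbf A_s^{-1}\circ\mathbf A_t$. "Pointwise pasting" means that for a finite-valued stopping pair $(\sigma,\tau)$ the value at $\omega$ is $\mathbf\Phi_{\sigma(\omega),\tau(\omega)}(\omega)$. "Continuity under nested right-dyadic approximation" of an assignment $Y$ means: with $d_n(r)=T2^{-n}\lceil2^nr/T\rceil$ and $\sigma^{(n)}=d_n(\sigma)$, $\tau^{(n)}=d_n(\tau)$, one has $Y_{\sigma^{(n)},\tau^{(n)}}\to Y_{\sigma,\tau}$ in probability. *)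

theory Defs
  imports "HOL-Probability.Probability"
begin

section \<open>Operators on a Hilbert space\<close>

text \<open>A real separable Hilbert space is a type of sort
  \<open>{real_inner, banach, second_countable_topology}\<close>.\<close>

lift_definition tensor_op :: "'h::real_inner \<Rightarrow> 'h \<Rightarrow> ('h \<Rightarrow>\<^sub>L 'h)" (infixr "\<otimes>\<^sub>o" 75)
  is "\<lambda>x y w. (w \<bullet> y) *\<^sub>R x"
  by (rule bounded_linear_intros)+

definition wedge_op :: "'h::real_inner \<Rightarrow> 'h \<Rightarrow> ('h \<Rightarrow>\<^sub>L 'h)" (infixr "\<and>\<^sub>o" 75)
  where "x \<and>\<^sub>o y = x \<otimes>\<^sub>o y - y \<otimes>\<^sub>o x"

definition adj_op :: "('h::{real_inner, complete_space} \<Rightarrow>\<^sub>L 'h) \<Rightarrow> ('h \<Rightarrow>\<^sub>L 'h)"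
  where "adj_op A = Blinfun (adjoint (blinfun_apply A))"

text \<open>The flip \<open>u \<otimes> v \<mapsto> v \<otimes> u\<close> is the passage to the adjoint, so \<open>Alt2\<close> is the continuous
  linear extension of \<open>u \<otimes> v \<mapsto> (u \<otimes> v - v \<otimes> u) / 2\<close>; see \<open>Alt2_tensor\<close> below.\<close>

definition Alt2 :: "('h::{real_inner, complete_space} \<Rightarrow>\<^sub>L 'h) \<Rightarrow> ('h \<Rightarrow>\<^sub>L 'h)"
  where "Alt2 A = (1/2) *\<^sub>R (A - adj_op A)"

lemma adj_op_tensor: "adj_op (u \<otimes>\<^sub>o v) = v \<otimes>\<^sub>o u"
proof -
  have "adjoint (blinfun_apply (u \<otimes>\<^sub>o v)) = blinfun_apply (v \<otimes>\<^sub>o u)"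
    by (rule adjoint_unique) (simp add: tensor_op.rep_eq inner_commute)
  then show ?thesis
    by (simp add: adj_op_def blinfun_apply_inverse)
qed

lemma Alt2_tensor: "Alt2 (u \<otimes>\<^sub>o v) = (1/2) *\<^sub>R (u \<otimes>\<^sub>o v - v \<otimes>\<^sub>o u)"
  by (simp add: Alt2_def adj_op_tensor)

definition selfadj_op :: "('h::real_inner \<Rightarrow>\<^sub>L 'h) \<Rightarrow> bool"
  where "selfadj_op A \<longleftrightarrow> (\<forall>x y. A x \<bullet> y = x \<bullet> A y)"

definition skew_op :: "('h::real_inner \<Rightarrow>\<^sub>L 'h) \<Rightarrow> bool"
  where "skew_op A \<longleftrightarrow> (\<forall>x y. A x \<bullet> y = - (x \<bullet> A y))"

definition compact_op :: "('h::real_normed_vector \<Rightarrow>\<^sub>L 'h) \<Rightarrow> bool"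
  where "compact_op A \<longleftrightarrow> compact (closure (blinfun_apply A ` cball 0 1))"

definition rank_less :: "nat \<Rightarrow> ('h::real_normed_vector \<Rightarrow>\<^sub>L 'h) \<Rightarrow> bool"
  where "rank_less n G \<longleftrightarrow> (\<exists>B. finite B \<and> card B < n \<and> range (blinfun_apply G) \<subseteq> span B)"

text \<open>The \<open>n\<close>-th singular number (\<open>n \<ge> 1\<close>), as the distance to the operators of rank less than
  \<open>n\<close>; in particular \<open>sing_num A 1 = norm A\<close>.\<close>

definition sing_num :: "('h::real_normed_vector \<Rightarrow>\<^sub>L 'h) \<Rightarrow> nat \<Rightarrow> real"
  where "sing_num A n = Inf {norm (A - G) |G. rank_less n G}"

definition weak_S1_0 :: "('h::real_normed_vector \<Rightarrow>\<^sub>L 'h) set"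
  where "weak_S1_0 = {A. compact_op A \<and> (\<lambda>n. real n * sing_num A n) \<longlonglongrightarrow> 0}"

definition weak_qnorm :: "('h::real_normed_vector \<Rightarrow>\<^sub>L 'h) \<Rightarrow> real"
  where "weak_qnorm A = (SUP n\<in>{1..}. real n * sing_num A n)"

definition trace_class :: "('h::real_normed_vector \<Rightarrow>\<^sub>L 'h) set"
  where "trace_class = {A. compact_op A \<and> summable (\<lambda>n. sing_num A (Suc n))}"

definition trace_norm :: "('h::real_normed_vector \<Rightarrow>\<^sub>L 'h) \<Rightarrow> real"
  where "trace_norm A = (\<Sum>n. sing_num A (Suc n))"


section \<open>The critical group\<close>

type_synonym 'h crit = "'h \<times> ('h \<Rightarrow>\<^sub>L 'h) \<times> ('h \<Rightarrow>\<^sub>L 'h)"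

fun crit_mult :: "'h::real_inner crit \<Rightarrow> 'h crit \<Rightarrow> 'h crit" (infixl "\<circ>\<^sub>G" 70)
  where "(x, A, Q) \<circ>\<^sub>G (y, B, R) = (x + y, A + B + (1/2) *\<^sub>R (x \<and>\<^sub>o y), Q + R)"

fun crit_inv :: "'h::real_inner crit \<Rightarrow> 'h crit"
  where "crit_inv (x, A, Q) = (- x, - A, - Q)"

definition qnorm_topology :: "'v::ab_group_add set \<Rightarrow> ('v \<Rightarrow> real) \<Rightarrow> 'v topology"
  where "qnorm_topology S q =
    topology (\<lambda>U. U \<subseteq> S \<and> (\<forall>a\<in>U. \<exists>\<epsilon>>0. \<forall>b\<in>S. q (b - a) < \<epsilon> \<longrightarrow> b \<in> U))"

lemma openin_qnorm_topology:
  "openin (qnorm_topology S q) U \<longleftrightarrow>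
     U \<subseteq> S \<and> (\<forall>a\<in>U. \<exists>\<epsilon>>0. \<forall>b\<in>S. q (b - a) < \<epsilon> \<longrightarrow> b \<in> U)"
proof -
  have "istopology (\<lambda>U. U \<subseteq> S \<and> (\<forall>a\<in>U. \<exists>\<epsilon>>0. \<forall>b\<in>S. q (b - a) < \<epsilon> \<longrightarrow> b \<in> U))"
    unfolding istopology_def
  proof (intro conjI allI impI ballI)
    fix U V a
    assume U: "U \<subseteq> S \<and> (\<forall>a\<in>U. \<exists>\<epsilon>>0. \<forall>b\<in>S. q (b - a) < \<epsilon> \<longrightarrow> b \<in> U)"
      and V: "V \<subseteq> S \<and> (\<forall>a\<in>V. \<exists>\<epsilon>>0. \<forall>b\<in>S. q (b - a) < \<epsilon> \<longrightarrow> b \<in> V)"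
      and a: "a \<in> U \<inter> V"
    obtain e where "e > 0" "\<forall>b\<in>S. q (b - a) < e \<longrightarrow> b \<in> U"
      using U a by blast
    moreover obtain d where "d > 0" "\<forall>b\<in>S. q (b - a) < d \<longrightarrow> b \<in> V"
      using V a by blast
    ultimately show "\<exists>\<epsilon>>0. \<forall>b\<in>S. q (b - a) < \<epsilon> \<longrightarrow> b \<in> U \<inter> V"
      by (intro exI[of _ "min e d"]) auto
  next
    fix K a
    assume K: "\<forall>U\<in>K. U \<subseteq> S \<and> (\<forall>a\<in>U. \<exists>\<epsilon>>0. \<forall>b\<in>S. q (b - a) < \<epsilon> \<longrightarrow> b \<in> U)"
      and "a \<in> \<Union>K"
    then obtain U where "U \<in> K" "a \<in> U" by blast
    with K obtain e where "e > 0" "\<forall>b\<in>S. q (b - a) < e \<longrightarrow> b \<in> U" by blast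
    then show "\<exists>\<epsilon>>0. \<forall>b\<in>S. q (b - a) < \<epsilon> \<longrightarrow> b \<in> \<Union>K"
      using \<open>U \<in> K\<close> by blast
  qed blast+
  then show ?thesis
    by (simp add: qnorm_topology_def topology_inverse')
qed

lemma topspace_qnorm_topology [simp]: "topspace (qnorm_topology S q) = S"
proof -
  have "openin (qnorm_topology S q) S"
    unfolding openin_qnorm_topology by (auto intro: exI[of _ 1])
  then show ?thesis
    by (meson openin_qnorm_topology openin_subset openin_topspace subset_antisym)
qed

definition crit_topology :: "'h::real_inner crit topology"
  where "crit_topology =
    prod_topology euclidean
      (prod_topology
        (qnorm_topology {A \<in> weak_S1_0. skew_op A} weak_qnorm)
        (qnorm_topology {Q \<in> trace_class. selfadj_op Q} trace_norm))"

lemma topspace_crit_topology: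
  "topspace crit_topology =
     UNIV \<times> {A \<in> weak_S1_0. skew_op A} \<times> {Q \<in> trace_class. selfadj_op Q}"
  by (simp add: crit_topology_def)

definition crit_borel :: "'h::real_inner crit measure"
  where "crit_borel = sigma (topspace crit_topology) {U. openin crit_topology U}"

text \<open>A quasi-metric inducing \<open>crit_topology\<close>.\<close>

fun crit_dist :: "'h::real_inner crit \<Rightarrow> 'h crit \<Rightarrow> real"
  where "crit_dist (x, A, Q) (y, B, R) = norm (x - y) + weak_qnorm (A - B) + trace_norm (Q - R)"


section \<open>Filtrations, processes and convergence in probability\<close>

text \<open>Time is \<open>[0, \<infinity>)\<close> inside type \<^typ>\<open>real\<close>: only \<open>F t\<close> with \<open>t \<ge> 0\<close> matters below
  (a filtration on \<open>[0, \<infinity>)\<close> may be extended by \<open>F t = F 0\<close> for \<open>t < 0\<close>), and all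
  stopping times in use are nonnegative.\<close>

locale usual_conditions = prob_space M + filtration "space M" F
  for M :: "'a measure" and F :: "real \<Rightarrow> 'a measure" +
  assumes sets_F_subset: "\<And>t. sets (F t) \<subseteq> sets M"
    and right_continuous: "\<And>t. t \<ge> 0 \<Longrightarrow> sets (F t) = (\<Inter>s\<in>{t<..}. sets (F s))"
    and complete: "\<And>N B. N \<in> null_sets M \<Longrightarrow> B \<subseteq> N \<Longrightarrow> B \<in> sets (F 0)"

abbreviation stopped_sigma :: "'a measure \<Rightarrow> (real \<Rightarrow> 'a measure) \<Rightarrow> ('a \<Rightarrow> real) \<Rightarrow> 'a measure"
  where "stopped_sigma M F \<tau> \<equiv> filtration.pre_sigma (space M) F \<tau>"

definition adapted :: "(real \<Rightarrow> 'a measure) \<Rightarrow> 'b measure \<Rightarrow> (real \<Rightarrow> 'a \<Rightarrow> 'b) \<Rightarrow> bool"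
  where "adapted F N Z \<longleftrightarrow> (\<forall>t\<ge>0. Z t \<in> F t \<rightarrow>\<^sub>M N)"

definition cadlag_path :: "'b topology \<Rightarrow> (real \<Rightarrow> 'b) \<Rightarrow> bool"
  where "cadlag_path \<T> f \<longleftrightarrow>
    (\<forall>t\<ge>0. limitin \<T> f (f t) (at_right t)) \<and> (\<forall>t>0. \<exists>l. limitin \<T> f l (at_left t))"

text \<open>\<open>left_lim Z r\<close> is \<open>Z\<^sub>r\<^sub>-\<close>; it is only used for \<open>r > 0\<close>.\<close>

definition left_lim :: "(real \<Rightarrow> 'a \<Rightarrow> 'b::t2_space) \<Rightarrow> real \<Rightarrow> 'a \<Rightarrow> 'b"
  where "left_lim Z r \<omega> = Lim (at_left r) (\<lambda>s. Z s \<omega>)"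

text \<open>Convergence in probability to \<open>0\<close>, phrased with covering events so that no measurability
  of \<open>D n\<close> has to be presupposed.\<close>

definition tends_0_in_prob :: "'a measure \<Rightarrow> (nat \<Rightarrow> 'a \<Rightarrow> ennreal) \<Rightarrow> bool"
  where "tends_0_in_prob M D \<longleftrightarrow>
    (\<forall>\<epsilon>>0. \<forall>\<delta>>0. \<forall>\<^sub>F n in sequentially.
       \<exists>B\<in>sets M. measure M B \<le> \<delta> \<and> (\<forall>\<omega>\<in>space M - B. D n \<omega> \<le> ennreal \<epsilon>))"

definition ucp_tendsto ::
  "'a measure \<Rightarrow> (nat \<Rightarrow> real \<Rightarrow> 'a \<Rightarrow> 'b::real_normed_vector) \<Rightarrow> (real \<Rightarrow> 'a \<Rightarrow> 'b) \<Rightarrow> bool"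
  where "ucp_tendsto M Zn Z \<longleftrightarrow>
    (\<forall>t>0. tends_0_in_prob M (\<lambda>n \<omega>. SUP s\<in>{0<..t}. ennreal (norm (Zn n s \<omega> - Z s \<omega>))))"


section \<open>Semimartingales\<close>

text \<open>The martingale identity is the defining property of conditional expectation, since
  the library has conditional expectations of real random variables only.\<close>

definition martingale ::
  "'a measure \<Rightarrow> (real \<Rightarrow> 'a measure) \<Rightarrow>
   (real \<Rightarrow> 'a \<Rightarrow> 'h::{banach, second_countable_topology}) \<Rightarrow> bool"
  where "martingale M F Z \<longleftrightarrow> adapted F borel Z \<and> (\<forall>t\<ge>0. integrable M (Z t)) \<and>
    (\<forall>s t. 0 \<le> s \<longrightarrow> s \<le> t \<longrightarrow>
      (\<forall>B\<in>sets (F s). set_lebesgue_integral M B (Z t) = set_lebesgue_integral M B (Z s)))"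

definition local_martingale ::
  "'a measure \<Rightarrow> (real \<Rightarrow> 'a measure) \<Rightarrow>
   (real \<Rightarrow> 'a \<Rightarrow> 'h::{banach, second_countable_topology}) \<Rightarrow> bool"
  where "local_martingale M F N \<longleftrightarrow> adapted F borel N \<and>
    (AE \<omega> in M. cadlag_path euclidean (\<lambda>t. N t \<omega>)) \<and>
    (\<exists>\<tau> :: nat \<Rightarrow> 'a \<Rightarrow> real.
      (\<forall>n. stopping_time F (\<tau> n) \<and> (\<forall>\<omega>\<in>space M. 0 \<le> \<tau> n \<omega>)) \<and>
      (AE \<omega> in M. incseq (\<lambda>n. \<tau> n \<omega>) \<and> filterlim (\<lambda>n. \<tau> n \<omega>) at_top sequentially) \<and>
      (\<forall>n. martingale M F (\<lambda>t \<omega>. N (min t (\<tau> n \<omega>)) \<omega> - N 0 \<omega>)))"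

definition bounded_variation_path :: "real \<Rightarrow> (real \<Rightarrow> 'b::real_normed_vector) \<Rightarrow> bool"
  where "bounded_variation_path t f \<longleftrightarrow>
    (\<exists>C. \<forall>(m::nat) p. incseq p \<longrightarrow> range p \<subseteq> {0..t} \<longrightarrow> (\<Sum>i<m. norm (f (p (Suc i)) - f (p i))) \<le> C)"

definition finite_variation_process ::
  "'a measure \<Rightarrow> (real \<Rightarrow> 'a measure) \<Rightarrow> (real \<Rightarrow> 'a \<Rightarrow> 'h::real_normed_vector) \<Rightarrow> bool"
  where "finite_variation_process M F V \<longleftrightarrow> adapted F borel V \<and>
    (AE \<omega> in M. cadlag_path euclidean (\<lambda>t. V t \<omega>) \<and> (\<forall>t\<ge>0. bounded_variation_path t (\<lambda>t. V t \<omega>)))"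

definition semimartingale ::
  "'a measure \<Rightarrow> (real \<Rightarrow> 'a measure) \<Rightarrow>
   (real \<Rightarrow> 'a \<Rightarrow> 'h::{banach, second_countable_topology}) \<Rightarrow> bool"
  where "semimartingale M F X \<longleftrightarrow> adapted F borel X \<and>
    (AE \<omega> in M. cadlag_path euclidean (\<lambda>t. X t \<omega>)) \<and>
    (\<exists>N V. local_martingale M F N \<and> finite_variation_process M F V \<and>
      (AE \<omega> in M. N 0 \<omega> = 0 \<and> V 0 \<omega> = 0 \<and> (\<forall>t\<ge>0. X t \<omega> = X 0 \<omega> + N t \<omega> + V t \<omega>)))"


section \<open>The stochastic integral and the quadratic variation\<close>

text \<open>A list of triples \<open>(h, S, T)\<close> represents the simple predictable process
  \<open>\<Sum> h 1\<^bsub>(S, T]\<^esub>\<close>, where \<open>h\<close> is \<open>F\<^sub>S\<close>-measurable.\<close>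

type_synonym ('a, 'h) simple_proc = "(('a \<Rightarrow> 'h) \<times> ('a \<Rightarrow> real) \<times> ('a \<Rightarrow> real)) list"

definition simple_predictable ::
  "'a measure \<Rightarrow> (real \<Rightarrow> 'a measure) \<Rightarrow> ('a, 'h::topological_space) simple_proc \<Rightarrow> bool"
  where "simple_predictable M F L \<longleftrightarrow>
    (\<forall>(h, S, T)\<in>set L. stopping_time F S \<and> stopping_time F T \<and>
       (\<forall>\<omega>\<in>space M. 0 \<le> S \<omega> \<and> S \<omega> \<le> T \<omega>) \<and> h \<in> stopped_sigma M F S \<rightarrow>\<^sub>M borel)"

definition simple_val :: "('a, 'h::real_vector) simple_proc \<Rightarrow> real \<Rightarrow> 'a \<Rightarrow> 'h"
  where "simple_val L r \<omega> = (\<Sum>(h, S, T)\<leftarrow>L. if S \<omega> < r \<and> r \<le> T \<omega> then h \<omega> else 0)"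

definition simple_integral ::
  "(real \<Rightarrow> 'a \<Rightarrow> 'h::real_inner) \<Rightarrow> ('a, 'h) simple_proc \<Rightarrow> real \<Rightarrow> 'a \<Rightarrow> ('h \<Rightarrow>\<^sub>L 'h)"
  where "simple_integral X L t \<omega> =
    (\<Sum>(h, S, T)\<leftarrow>L. h \<omega> \<otimes>\<^sub>o (X (min t (T \<omega>)) \<omega> - X (min t (S \<omega>)) \<omega>))"

text \<open>\<open>is_stoch_integral M F X Y I\<close>: the process \<open>I\<close> is (a version of)
  \<open>\<integral>\<^bsub>(0,t]\<^esub> Y\<^sub>r \<otimes> dX\<^sub>r\<close>, \<open>t \<ge> 0\<close>, for an adapted left-continuous integrand \<open>Y\<close> with right limits.
  The integral is the continuous extension of the elementary integral from simple predictable
  integrands, for uniform convergence on compacts in probability. For a semimartingale \<open>X\<close>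
  such an \<open>I\<close> exists and is unique up to indistinguishability. The simple processes are dense
  in these integrands, so the first conjunct is automatic; it makes the predicate
  non-vacuous by itself. The elementary integrals of a semimartingale converge even in
  Hilbert-Schmidt norm, i.e. in the Hilbert tensor product, and the limit is the same as the
  operator-norm limit used here.\<close>

definition is_stoch_integral ::
  "'a measure \<Rightarrow> (real \<Rightarrow> 'a measure) \<Rightarrow> (real \<Rightarrow> 'a \<Rightarrow> 'h::real_inner) \<Rightarrow>
   (real \<Rightarrow> 'a \<Rightarrow> 'h) \<Rightarrow> (real \<Rightarrow> 'a \<Rightarrow> ('h \<Rightarrow>\<^sub>L 'h)) \<Rightarrow> bool"
  where "is_stoch_integral M F X Y I \<longleftrightarrow>
    (\<exists>L. (\<forall>n. simple_predictable M F (L n)) \<and> ucp_tendsto M (\<lambda>n. simple_val (L n)) Y) \<and>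
    (\<forall>L. (\<forall>n. simple_predictable M F (L n)) \<longrightarrow> ucp_tendsto M (\<lambda>n. simple_val (L n)) Y \<longrightarrow>
       ucp_tendsto M (\<lambda>n. simple_integral X (L n)) I) \<and>
    (AE \<omega> in M. I 0 \<omega> = 0)"

text \<open>\<open>[X]\<^sub>t = X\<^sub>t \<otimes> X\<^sub>t - X\<^sub>0 \<otimes> X\<^sub>0 - \<integral> X\<^sub>r\<^sub>- \<otimes> dX\<^sub>r - \<integral> dX\<^sub>r \<otimes> X\<^sub>r\<^sub>-\<close>, with \<open>[X]\<^sub>0 = 0\<close>; the last
  integral is the adjoint of the first one.\<close>

definition is_quad_variation ::
  "'a measure \<Rightarrow> (real \<Rightarrow> 'a measure) \<Rightarrow> (real \<Rightarrow> 'a \<Rightarrow> 'h::{real_inner, complete_space}) \<Rightarrow>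
   (real \<Rightarrow> 'a \<Rightarrow> ('h \<Rightarrow>\<^sub>L 'h)) \<Rightarrow> bool"
  where "is_quad_variation M F X V \<longleftrightarrow>
    (\<exists>I. is_stoch_integral M F X (left_lim X) I \<and>
      (AE \<omega> in M. \<forall>t\<ge>0.
         V t \<omega> = X t \<omega> \<otimes>\<^sub>o X t \<omega> - X 0 \<omega> \<otimes>\<^sub>o X 0 \<omega> - I t \<omega> - adj_op (I t \<omega>)))"


section \<open>Stopping intervals and the stopped character\<close>

definition stopping_pair ::
  "'a measure \<Rightarrow> (real \<Rightarrow> 'a measure) \<Rightarrow> real \<Rightarrow> ('a \<Rightarrow> real) \<Rightarrow> ('a \<Rightarrow> real) \<Rightarrow> bool"
  where "stopping_pair M F T \<sigma> \<tau> \<longleftrightarrow> stopping_time F \<sigma> \<and> stopping_time F \<tau> \<and>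
    (\<forall>\<omega>\<in>space M. 0 \<le> \<sigma> \<omega> \<and> \<sigma> \<omega> \<le> \<tau> \<omega> \<and> \<tau> \<omega> \<le> T)"

definition det_character ::
  "(real \<Rightarrow> 'a \<Rightarrow> 'h::real_inner crit) \<Rightarrow> real \<Rightarrow> real \<Rightarrow> 'a \<Rightarrow> 'h crit"
  where "det_character Z s t \<omega> = crit_inv (Z s \<omega>) \<circ>\<^sub>G Z t \<omega>"

definition stopped_character ::
  "(real \<Rightarrow> 'a \<Rightarrow> 'h::real_inner crit) \<Rightarrow> ('a \<Rightarrow> real) \<Rightarrow> ('a \<Rightarrow> real) \<Rightarrow> 'a \<Rightarrow> 'h crit"
  where "stopped_character Z \<sigma> \<tau> \<omega> = crit_inv (Z (\<sigma> \<omega>) \<omega>) \<circ>\<^sub>G Z (\<tau> \<omega>) \<omega>"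

definition right_dyadic :: "real \<Rightarrow> nat \<Rightarrow> real \<Rightarrow> real"
  where "right_dyadic T n r = T * (1/2) ^ n * of_int \<lceil>2 ^ n * r / T\<rceil>"

text \<open>The assignments \<open>Y\<close> of group-valued random variables to stopping pairs bounded by \<open>T\<close>
  which extend the deterministic-time character, are given by pointwise pasting on
  finite-valued pairs and are continuous under nested right-dyadic approximation. An assignment
  is understood modulo null sets.\<close>

definition dyadic_extension ::
  "'a measure \<Rightarrow> (real \<Rightarrow> 'a measure) \<Rightarrow> real \<Rightarrow> (real \<Rightarrow> 'a \<Rightarrow> 'h::real_inner crit) \<Rightarrow>
   (('a \<Rightarrow> real) \<Rightarrow> ('a \<Rightarrow> real) \<Rightarrow> 'a \<Rightarrow> 'h crit) \<Rightarrow> bool"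
  where "dyadic_extension M F T Z Y \<longleftrightarrow>
    (\<forall>\<sigma> \<tau>. stopping_pair M F T \<sigma> \<tau> \<longrightarrow> Y \<sigma> \<tau> \<in> M \<rightarrow>\<^sub>M crit_borel) \<and>
    (\<forall>s t. 0 \<le> s \<longrightarrow> s \<le> t \<longrightarrow> t \<le> T \<longrightarrow>
       (AE \<omega> in M. Y (\<lambda>_. s) (\<lambda>_. t) \<omega> = det_character Z s t \<omega>)) \<and>
    (\<forall>\<sigma> \<tau>. stopping_pair M F T \<sigma> \<tau> \<longrightarrow> finite (\<sigma> ` space M) \<longrightarrow> finite (\<tau> ` space M) \<longrightarrow>
       (AE \<omega> in M. Y \<sigma> \<tau> \<omega> = det_character Z (\<sigma> \<omega>) (\<tau> \<omega>) \<omega>)) \<and>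
    (\<forall>\<sigma> \<tau>. stopping_pair M F T \<sigma> \<tau> \<longrightarrow>
       tends_0_in_prob M (\<lambda>n \<omega>. ennreal (crit_dist
         (Y (\<lambda>\<omega>. right_dyadic T n (\<sigma> \<omega>)) (\<lambda>\<omega>. right_dyadic T n (\<tau> \<omega>)) \<omega>) (Y \<sigma> \<tau> \<omega>))))"

end

theory Submission
  imports Defs
begin

text \<open>
  The algebraic part of the theorem holds pointwise: \<open>\<Phi>\<^sub>\<sigma>\<^sub>\<tau> = A\<^sub>\<sigma>\<^sup>-\<^sup>1 \<circ> A\<^sub>\<tau>\<close> telescopes in every group, and
  the displayed formula is the group law. What has to be proved is analytic.

  \<^emph>\<open>Measurability.\<close> The Borel \<open>\<sigma>\<close>-algebra of the critical group is generated by the vector component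
  and the matrix coefficients \<open>\<langle>A u, v\<rangle>\<close>, \<open>\<langle>Q u, v\<rangle>\<close> (\<open>open_crit_trace\<close>, \<open>measurable_crit_borelI\<close>).
  The reasons are that finite-rank operators with vectors in a countable dense set are dense for both
  quasi-norms, so that the topology has a countable base of quasi-norm balls
  (\<open>fin_rank_approximants\<close>, \<open>qnorm_topology_base\<close>), and that each singular number, hence each such
  ball, is measurable with respect to matrix coefficients (\<open>measurable_sing_num\<close>). The coefficients
  of the process are right-continuous adapted processes with values in a separable normed space, and
  such a process evaluated at a stopping time \<open>\<tau>\<close> is \<open>F\<^sub>\<tau>\<close>-measurable (\<open>measurable_stopped_value\<close>).

  \<^emph>\<open>Extension and uniqueness.\<close> The dyadic times decrease to the stopping times, so right continuity of
  the paths and continuity of \<open>(p, p') \<mapsto> p\<^sup>-\<^sup>1 \<circ> p'\<close> (\<open>crit_dist_increment_tendsto\<close>) give almost sure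
  convergence, hence convergence in probability. Two extensions agree on the dyadic pairs, which are
  finite-valued, and limits in probability are unique (\<open>dyadic_extension_unique\<close>).

  \<^emph>\<open>The semimartingale formula.\<close> The integral over \<open>(\<sigma>, \<tau>]\<close> of \<open>X\<^sub>r\<^sub>- - X\<^sub>\<sigma>\<close> is
  \<open>I\<^sub>\<tau> - I\<^sub>\<sigma> - X\<^sub>\<sigma> \<otimes> (X\<^sub>\<tau> - X\<^sub>\<sigma>)\<close>, where \<open>I\<close> is the integral of \<open>X\<^sub>-\<close>. For a general approximating sequence
  this follows by adding and subtracting approximations of \<open>X\<^sub>-\<close> (\<open>stoch_integral_restrict\<close>). Applying
  \<open>Alt\<^sub>2\<close>, which is additive because adjoints exist (\<open>adjoint_exists\<close>), yields the area component.
\<close>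


section \<open>The Riesz representation theorem and adjoints\<close>

text \<open>Complete the square: a representing vector of \<open>f\<close> is a minimiser of \<open>J x = |x|\<^sup>2/2 - f x\<close>, because
the first variation of \<open>J\<close> at \<open>y\<close> in the direction \<open>x\<close> is \<open>x \<bullet> y - f x\<close>. The parallelogram
identity bounds the distance of two almost minimisers, so minimising sequences are Cauchy.\<close>

lemma riesz_representation:
  fixes f :: "'h::{real_inner, complete_space} \<Rightarrow> real"
  assumes "bounded_linear f"
  shows "\<exists>y. \<forall>x. f x = x \<bullet> y"
proof -
  interpret f: bounded_linear f by fact
  obtain K where K: "\<And>x. norm (f x) \<le> norm x * K"
    using f.bounded by blast
  define J where "J x = (norm x)\<^sup>2 / 2 - f x" for x
  have J_lower: "J x \<ge> - (K\<^sup>2 / 2)" for x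
  proof -
    have "0 \<le> (norm x - K)\<^sup>2 / 2" by simp
    also have "\<dots> = (norm x)\<^sup>2 / 2 - norm x * K + K\<^sup>2 / 2"
      by (simp add: power2_eq_square algebra_simps add_divide_distrib diff_divide_distrib)
    finally show ?thesis using K[of x] by (simp add: J_def abs_le_iff)
  qed
  define m where "m = Inf (range J)"
  have bdd: "bdd_below (range J)"
    using J_lower by (auto intro!: bdd_belowI)
  have m_le: "m \<le> J x" for x
    unfolding m_def using bdd by (auto intro: cInf_lower)
  have "\<exists>x. J x < m + 1 / (real n + 1)" for n :: nat
  proof -
    have "Inf (range J) < m + 1 / (real n + 1)" by (simp add: m_def)
    from cInf_lessD[OF _ this] show ?thesis by auto
  qed
  then obtain u where u: "\<And>n::nat. J (u n) < m + 1 / (real n + 1)" by metis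
  have parallelogram: "(norm (x - y))\<^sup>2 = 4 * (J x + J y - 2 * J ((1/2) *\<^sub>R (x + y)))" for x y
    unfolding J_def power2_norm_eq_inner
    by (simp add: f.scaleR f.add inner_simps inner_commute algebra_simps)
  have dist_bound: "(norm (u i - u j))\<^sup>2 \<le> 8 / (real N + 1)" if "N \<le> i" "N \<le> j" for i j N :: nat
  proof -
    have "1 / (real i + 1) \<le> 1 / (real N + 1)" "1 / (real j + 1) \<le> 1 / (real N + 1)"
      using that by (auto simp: frac_le)
    then show ?thesis
      using u[of i] u[of j] m_le[of "(1/2) *\<^sub>R (u i + u j)"] unfolding parallelogram by simp
  qed
  have "Cauchy u"
  proof (rule metric_CauchyI)
    fix e :: real assume "e > 0"
    obtain N :: nat where N: "8 / e\<^sup>2 < real N" using reals_Archimedean2 by blast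
    have "dist (u i) (u j) < e" if "N \<le> i" "N \<le> j" for i j
    proof -
      have "8 < real N * e\<^sup>2" using N \<open>e > 0\<close> by (simp add: field_simps)
      also have "\<dots> \<le> (real N + 1) * e\<^sup>2" by (simp add: algebra_simps)
      finally have "8 / (real N + 1) < e\<^sup>2" by (simp add: field_simps)
      then have "(norm (u i - u j))\<^sup>2 < e\<^sup>2" using dist_bound[OF that] by simp
      then show ?thesis using \<open>e > 0\<close> by (simp add: dist_norm power_less_imp_less_base)
    qed
    then show "\<exists>M. \<forall>m\<ge>M. \<forall>n\<ge>M. dist (u m) (u n) < e" by blast
  qed
  then obtain y where y: "u \<longlonglongrightarrow> y"
    using Cauchy_convergent convergent_def by blast
  have J_lim: "(\<lambda>n. J (u n)) \<longlonglongrightarrow> J y"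
    unfolding J_def by (intro tendsto_intros y f.tendsto) simp
  have "(\<lambda>n. m + 1 / (real n + 1)) \<longlonglongrightarrow> m + 0"
    by (intro tendsto_intros) real_asymp
  then have "J y \<le> m"
    using J_lim u by (intro LIMSEQ_le[of "\<lambda>n. J (u n)"]) (auto intro: less_imp_le)
  have "f x = x \<bullet> y" for x
  proof -
    define d where "d = x \<bullet> y - f x"
    define s where "s = (norm x)\<^sup>2"
    \<comment> \<open>The first-order term of \<open>J (y + t x)\<close> is \<open>t d\<close>; this \<open>t\<close> makes it dominate the quadratic term
        unless \<open>d = 0\<close>, and the \<open>+ 1\<close> covers \<open>x = 0\<close>.\<close>
    define t where "t = - d / (s + 1)"
    have s: "s \<ge> 0" by (simp add: s_def)
    have "J y \<le> J (y + t *\<^sub>R x)" using \<open>J y \<le> m\<close> m_le order_trans by blast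
    also have "J (y + t *\<^sub>R x) = J y + t * d + t\<^sup>2 * s / 2"
      unfolding J_def d_def s_def power2_norm_eq_inner
      by (simp add: f.scaleR f.add inner_simps inner_commute algebra_simps power2_eq_square)
    finally have "0 \<le> t * d + t\<^sup>2 * s / 2" by simp
    then have "0 \<le> (s + 1)\<^sup>2 * (t * d + t\<^sup>2 * s / 2)" using s by simp
    also have "\<dots> = (s + 1) * d * (t * (s + 1)) + (t * (s + 1))\<^sup>2 * s / 2"
      by (simp add: power2_eq_square algebra_simps)
    also have "t * (s + 1) = - d" using s by (simp add: t_def)
    finally have "d\<^sup>2 * (s + 2) \<le> 0" by (simp add: power2_eq_square algebra_simps)
    then have "d = 0" using s by (simp add: mult_le_0_iff)
    then show ?thesis by (simp add: d_def)
  qed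
  then show ?thesis by blast
qed

text \<open>\<^const>\<open>adjoint\<close> is a choice operator, hence meaningful only once some adjoint is known to exist;
the Riesz theorem provides it in every Hilbert space. This is what makes \<^const>\<open>adj_op\<close>, and with
it \<^const>\<open>Alt2\<close>, additive.\<close>

lemma adjoint_exists:
  fixes A :: "'h::{real_inner, complete_space} \<Rightarrow>\<^sub>L 'h"
  shows "\<exists>B :: 'h \<Rightarrow>\<^sub>L 'h. \<forall>x y. A x \<bullet> y = x \<bullet> B y"
proof -
  have "\<exists>z. \<forall>x. A x \<bullet> y = x \<bullet> z" for y
    by (rule riesz_representation) (intro bounded_linear_intros)
  then obtain B where B: "\<And>x y. A x \<bullet> y = x \<bullet> B y" by metis
  have "bounded_linear B"
  proof (rule bounded_linear_intro)
    show "B (x + y) = B x + B y" for x y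
      by (rule vector_eq_rdot[THEN iffD1]) (simp add: B[symmetric] inner_simps inner_commute[of "_::'h"])
  next
    show "B (r *\<^sub>R x) = r *\<^sub>R B x" for r x
      by (rule vector_eq_ldot[THEN iffD1]) (simp add: B[symmetric] inner_simps)
  next
    show "norm (B x) \<le> norm x * norm A" for x
    proof (cases "B x = 0")
      case False
      have "norm (B x) * norm (B x) = A (B x) \<bullet> x"
        by (simp add: B power2_norm_eq_inner[symmetric] power2_eq_square)
      also have "\<dots> \<le> norm (A (B x)) * norm x" by (rule norm_cauchy_schwarz)
      also have "\<dots> \<le> norm A * norm (B x) * norm x"
        by (intro mult_right_mono norm_blinfun) simp
      finally show ?thesis using False by (simp add: mult_ac)
    qed simp
  qed
  then show ?thesis using B by (metis bounded_linear_Blinfun_apply)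
qed

lemma adj_op_eqI:
  fixes A B :: "'h::{real_inner, complete_space} \<Rightarrow>\<^sub>L 'h"
  assumes "\<And>x y. A x \<bullet> y = x \<bullet> B y"
  shows "adj_op A = B"
proof -
  have "adjoint (blinfun_apply A) = blinfun_apply B"
    by (rule adjoint_unique) (simp add: assms)
  then show ?thesis by (simp add: adj_op_def blinfun_apply_inverse)
qed

lemma inner_adj_op:
  fixes A :: "'h::{real_inner, complete_space} \<Rightarrow>\<^sub>L 'h"
  shows "A x \<bullet> y = x \<bullet> adj_op A y"
  using adjoint_exists[of A] adj_op_eqI by metis

lemma Alt2_add: "Alt2 (A + B) = Alt2 A + Alt2 B"
proof -
  have "adj_op (A + B) = adj_op A + adj_op B"
    by (rule adj_op_eqI) (simp add: plus_blinfun.rep_eq inner_simps inner_adj_op)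
  then show ?thesis by (simp add: Alt2_def algebra_simps)
qed

lemma Alt2_diff: "Alt2 (A - B) = Alt2 A - Alt2 B"
  using Alt2_add[of "A - B" B] by simp


section \<open>Singular numbers\<close>

lemma tensor_op_add_left: "(x + x') \<otimes>\<^sub>o y = x \<otimes>\<^sub>o y + x' \<otimes>\<^sub>o y"
  by (rule blinfun_eqI) (simp add: tensor_op.rep_eq plus_blinfun.rep_eq algebra_simps)

lemma tensor_op_add_right: "x \<otimes>\<^sub>o (y + y') = x \<otimes>\<^sub>o y + x \<otimes>\<^sub>o y'"
  by (rule blinfun_eqI) (simp add: tensor_op.rep_eq plus_blinfun.rep_eq algebra_simps inner_simps)

lemma tensor_op_diff_left: "(x - x') \<otimes>\<^sub>o y = x \<otimes>\<^sub>o y - x' \<otimes>\<^sub>o y"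
  using tensor_op_add_left[of "x - x'" x' y] by simp

lemma tensor_op_diff_right: "x \<otimes>\<^sub>o (y - y') = x \<otimes>\<^sub>o y - x \<otimes>\<^sub>o y'"
  using tensor_op_add_right[of x "y - y'" y'] by simp

lemma tensor_op_zero [simp]: "0 \<otimes>\<^sub>o y = 0" "x \<otimes>\<^sub>o 0 = 0"
  using tensor_op_diff_left[of y y y] tensor_op_diff_right[of x x x] by simp_all

lemma tensor_op_minus_left: "(- x) \<otimes>\<^sub>o y = - (x \<otimes>\<^sub>o y)"
  using tensor_op_diff_left[of 0 x y] by simp

lemma tensor_op_minus_right: "x \<otimes>\<^sub>o (- y) = - (x \<otimes>\<^sub>o y)"
  using tensor_op_diff_right[of x 0 y] by simp

lemma tensor_op_scaleR_left: "(c *\<^sub>R x) \<otimes>\<^sub>o y = c *\<^sub>R (x \<otimes>\<^sub>o y)"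
  by (rule blinfun_eqI) (simp add: tensor_op.rep_eq scaleR_blinfun.rep_eq)

lemma tensor_op_scaleR_right: "x \<otimes>\<^sub>o (c *\<^sub>R y) = c *\<^sub>R (x \<otimes>\<^sub>o y)"
  by (rule blinfun_eqI) (simp add: tensor_op.rep_eq scaleR_blinfun.rep_eq)

lemma norm_tensor_op_le: "norm (x \<otimes>\<^sub>o y) \<le> norm x * norm y"
proof (rule norm_blinfun_bound)
  fix w
  have "\<bar>w \<bullet> y\<bar> * norm x \<le> (norm w * norm y) * norm x"
    by (intro mult_right_mono Cauchy_Schwarz_ineq2) auto
  then show "norm ((x \<otimes>\<^sub>o y) w) \<le> norm x * norm y * norm w"
    by (simp add: tensor_op.rep_eq mult_ac)
qed simp

lemma rank_less_0: "0 < n \<Longrightarrow> rank_less n 0"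
  unfolding rank_less_def by (intro exI[of _ "{}"]) auto

lemma rank_less_uminus: "rank_less n G \<Longrightarrow> rank_less n (- G)"
  unfolding rank_less_def by (force simp: uminus_blinfun.rep_eq intro: span_neg)

lemma rank_less_mono: "rank_less m G \<Longrightarrow> m \<le> n \<Longrightarrow> rank_less n G"
  unfolding rank_less_def by (meson less_le_trans)

lemma rank_less_add:
  assumes "rank_less (Suc m) G" "rank_less (Suc n) H"
  shows "rank_less (Suc (m + n)) (G + H)"
proof -
  obtain B C where B: "finite B" "card B < Suc m" "range (blinfun_apply G) \<subseteq> span B"
    and C: "finite C" "card C < Suc n" "range (blinfun_apply H) \<subseteq> span C"
    using assms unfolding rank_less_def by blast
  have "card (B \<union> C) \<le> card B + card C" by (rule card_Un_le)
  moreover have "G x + H x \<in> span (B \<union> C)" for x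
  proof (rule span_add)
    show "G x \<in> span (B \<union> C)" using B(3) span_mono[of B "B \<union> C"] by auto
    show "H x \<in> span (B \<union> C)" using C(3) span_mono[of C "B \<union> C"] by auto
  qed
  ultimately show ?thesis
    unfolding rank_less_def using B C
    by (intro exI[of _ "B \<union> C"]) (auto simp: plus_blinfun.rep_eq)
qed

lemma rank_less_tensor: "rank_less 2 (x \<otimes>\<^sub>o y)"
  unfolding rank_less_def
  by (intro exI[of _ "{x}"]) (auto simp: tensor_op.rep_eq intro: span_scale span_base)

lemma rank_less_1D: "rank_less (Suc 0) G \<Longrightarrow> G = 0"
  unfolding rank_less_def by (auto simp: image_subset_iff intro!: blinfun_eqI)

lemma sing_num_le: "rank_less n G \<Longrightarrow> sing_num A n \<le> norm (A - G)"
  unfolding sing_num_def by (rule cInf_lower) (auto intro!: bdd_belowI[of _ 0])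

lemma sing_num_approx:
  assumes "0 < n" "0 < e"
  shows "\<exists>G. rank_less n G \<and> norm (A - G) < sing_num A n + e"
proof -
  have "Inf {norm (A - G) |G. rank_less n G} < sing_num A n + e"
    using assms by (simp add: sing_num_def)
  from cInf_lessD[OF _ this] show ?thesis
    using rank_less_0[OF assms(1)] by auto
qed

lemma sing_num_nonneg: "0 < n \<Longrightarrow> 0 \<le> sing_num A n"
  unfolding sing_num_def using rank_less_0[of n] by (intro cInf_greatest) auto

lemma sing_num_le_norm: "0 < n \<Longrightarrow> sing_num A n \<le> norm A"
  using sing_num_le[OF rank_less_0, of n A] by simp

lemma sing_num_1: "sing_num A (Suc 0) = norm A"
proof (rule antisym)
  show "norm A \<le> sing_num A (Suc 0)"
    unfolding sing_num_def using rank_less_0[of "Suc 0"]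
    by (intro cInf_greatest) (auto dest: rank_less_1D)
qed (simp add: sing_num_le_norm)

lemma sing_num_eq_0: "rank_less n A \<Longrightarrow> 0 < n \<Longrightarrow> sing_num A n = 0"
  using sing_num_le[of n A A] sing_num_nonneg[of n A] by simp

lemma sing_num_antimono:
  assumes "0 < m" "m \<le> n"
  shows "sing_num A n \<le> sing_num A m"
proof (rule field_le_epsilon)
  fix e :: real assume "0 < e"
  then obtain G where "rank_less m G" "norm (A - G) < sing_num A m + e"
    using sing_num_approx assms by blast
  then show "sing_num A n \<le> sing_num A m + e"
    using sing_num_le[of n G A] rank_less_mono[of m G n] assms by simp
qed

text \<open>Weyl's inequality: the sum of near-optimal approximants of ranks \<open>m\<close> and \<open>n\<close> has rank at most
\<open>m + n\<close>. The shift by \<^const>\<open>Suc\<close> turns "rank less than" into "rank at most".\<close>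

lemma sing_num_add:
  "sing_num (A + B) (Suc (m + n)) \<le> sing_num A (Suc m) + sing_num B (Suc n)"
proof (rule field_le_epsilon)
  fix e :: real assume e: "0 < e"
  obtain G where G: "rank_less (Suc m) G" "norm (A - G) < sing_num A (Suc m) + e / 2"
    using sing_num_approx[of "Suc m" "e / 2"] e by auto
  obtain H where H: "rank_less (Suc n) H" "norm (B - H) < sing_num B (Suc n) + e / 2"
    using sing_num_approx[of "Suc n" "e / 2"] e by auto
  have "sing_num (A + B) (Suc (m + n)) \<le> norm (A + B - (G + H))"
    by (rule sing_num_le[OF rank_less_add[OF G(1) H(1)]])
  also have "\<dots> = norm ((A - G) + (B - H))" by (simp add: algebra_simps)
  also have "\<dots> \<le> norm (A - G) + norm (B - H)" by (rule norm_triangle_ineq)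
  finally show "sing_num (A + B) (Suc (m + n)) \<le> sing_num A (Suc m) + sing_num B (Suc n) + e"
    using G(2) H(2) by simp
qed

text \<open>The form in which Weyl's inequality yields quasi-triangle inequalities: splitting the rank \<open>n\<close>
evenly costs only a factor \<open>2\<close>, both for \<open>sup n s\<^sub>n\<close> and for \<open>\<Sum> s\<^sub>n\<close>.\<close>

lemma sing_num_add_half:
  "sing_num (A + B) (Suc n) \<le> sing_num A (Suc (n div 2)) + sing_num B (Suc (n div 2))"
proof -
  have "sing_num (A + B) (Suc n) \<le> sing_num (A + B) (Suc (n div 2 + n div 2))"
    by (rule sing_num_antimono) auto
  then show ?thesis using sing_num_add[of A B "n div 2" "n div 2"] by simp
qed

lemma sing_num_uminus: "sing_num (- A) n = sing_num A n"
proof -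
  have "{norm (- A - G) |G. rank_less n G} = {norm (A - G) |G. rank_less n G}"
  proof -
    have "norm (- A - G) = norm (A - (- G))" "norm (A - G) = norm (- A - (- G))" for G
      by (metis norm_minus_cancel minus_diff_eq minus_minus diff_minus_eq_add add.commute
          uminus_add_conv_diff)+
    then show ?thesis using rank_less_uminus by blast
  qed
  then show ?thesis by (simp add: sing_num_def)
qed

text \<open>Finite-rank operators are coded by lists of pairs of vectors, so that lists over a countable set
of vectors form a countable family of operators.\<close>

definition fin_rank :: "('h::real_inner \<times> 'h) list \<Rightarrow> ('h \<Rightarrow>\<^sub>L 'h)"
  where "fin_rank ps = (\<Sum>(x, y)\<leftarrow>ps. x \<otimes>\<^sub>o y)"

lemma fin_rank_simps [simp]:
  "fin_rank [] = 0"
  "fin_rank (p # ps) = fst p \<otimes>\<^sub>o snd p + fin_rank ps"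
  by (auto simp: fin_rank_def split: prod.splits)

lemma rank_less_fin_rank: "rank_less (Suc (length ps)) (fin_rank ps)"
proof (induction ps)
  case (Cons p ps)
  show ?case
    using rank_less_add[of 1 _ "length ps", OF _ Cons.IH] rank_less_tensor[of "fst p" "snd p"]
    by (simp add: numeral_2_eq_2)
qed (simp add: rank_less_0)

text \<open>If \<open>C\<close> is an orthogonal basis of the range, then \<open>G w = \<Sum>\<^sub>c (G w \<bullet> c) / (c \<bullet> c) c\<close>, and
\<open>G w \<bullet> c = w \<bullet> G\<^sup>* c\<close> makes every summand a tensor.\<close>

lemma rank_less_imp_fin_rank:
  fixes G :: "'h::{real_inner, complete_space} \<Rightarrow>\<^sub>L 'h"
  assumes "rank_less n G"
  shows "\<exists>ps. length ps < n \<and> G = fin_rank ps"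
proof -
  obtain B where B: "finite B" "card B < n" "range (blinfun_apply G) \<subseteq> span B"
    using assms unfolding rank_less_def by blast
  obtain C where C: "finite C" "card C \<le> card B" "span C = span B" "pairwise orthogonal C"
    using basis_orthogonal[OF B(1)] by blast
  obtain cs where cs: "set cs = C" "distinct cs"
    using finite_distinct_list[OF C(1)] by blast
  \<comment> \<open>A zero vector in \<open>C\<close> is harmless: division by \<open>c \<bullet> c = 0\<close> gives the zero summand.\<close>
  define ps where "ps = map (\<lambda>c. (c, (1 / (c \<bullet> c)) *\<^sub>R adj_op G c)) cs"
  have G_eq: "G w = (\<Sum>c\<in>C. ((G w \<bullet> c) / (c \<bullet> c)) *\<^sub>R c)" for w
  proof -
    define r where "r = G w - (\<Sum>c\<in>C. ((G w \<bullet> c) / (c \<bullet> c)) *\<^sub>R c)"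
    have r_orth: "orthogonal r d" if "d \<in> span C" for d
    proof -
      have "orthogonal d r"
      proof (rule orthogonal_to_span[OF that, of r, THEN orthogonal_commute[THEN iffD1]])
        fix b assume b: "b \<in> C"
        have "(\<Sum>c\<in>C. ((G w \<bullet> c) / (c \<bullet> c)) * (c \<bullet> b)) = (\<Sum>c\<in>C. if c = b then G w \<bullet> b else 0)"
          using C(4) b by (intro sum.cong) (auto simp: pairwise_def orthogonal_def)
        also have "\<dots> = G w \<bullet> b" using b C(1) by simp
        finally show "orthogonal r b"
          by (simp add: r_def orthogonal_def inner_diff_left inner_sum_left)
      qed
      then show ?thesis by (simp add: orthogonal_commute)
    qed
    have "r \<in> span C" unfolding r_def
      using B(3) C(3) by (intro span_diff span_sum span_scale) (auto intro: span_base)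
    then have "r = 0" using r_orth[of r] by (simp add: orthogonal_def)
    then show ?thesis by (simp add: r_def)
  qed
  have "fin_rank ps w = G w" for w
  proof -
    have "fin_rank ps w = (\<Sum>c\<leftarrow>cs. ((G w \<bullet> c) / (c \<bullet> c)) *\<^sub>R c)"
      unfolding ps_def by (induction cs)
        (simp_all add: plus_blinfun.rep_eq tensor_op.rep_eq inner_adj_op)
    also have "\<dots> = (\<Sum>c\<in>C. ((G w \<bullet> c) / (c \<bullet> c)) *\<^sub>R c)"
      by (simp only: sum_list_distinct_conv_sum_set[OF cs(2)] cs(1))
    finally show ?thesis using G_eq[of w] by (rule trans[OF _ sym])
  qed
  then have "fin_rank ps = G" by (intro blinfun_eqI)
  moreover have "length ps = card C" using cs distinct_card[OF cs(2)] by (simp add: ps_def)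
  ultimately show ?thesis using B(2) C(2) by (intro exI[of _ ps]) auto
qed

lemma tensor_dense:
  assumes D: "closure D = UNIV" and "0 < e"
  shows "\<exists>x'\<in>D. \<exists>y'\<in>D. norm (x \<otimes>\<^sub>o y - x' \<otimes>\<^sub>o y') < e"
proof -
  have dense: "\<exists>d\<in>D. norm (z - d) < e'" if "0 < e'" for z e'
    using D that closure_approachable[of z D] by (auto simp: dist_norm norm_minus_commute)
  obtain x' where x': "x' \<in> D" "norm (x - x') < e / 2 / (norm y + 1)"
    using dense[of "e / 2 / (norm y + 1)" x] \<open>0 < e\<close> by (auto simp: add_nonneg_pos)
  obtain y' where y': "y' \<in> D" "norm (y - y') < e / 2 / (norm x' + 1)"
    using dense[of "e / 2 / (norm x' + 1)" y] \<open>0 < e\<close> by (auto simp: add_nonneg_pos)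
  have bound: "a * b < e / 2" if "a < e / 2 / (b + 1)" "0 \<le> a" "0 \<le> b" for a b :: real
  proof -
    have "a * b \<le> a * (b + 1)" using that by (simp add: algebra_simps)
    also have "\<dots> < e / 2" using that by (simp add: field_simps)
    finally show ?thesis .
  qed
  have "x \<otimes>\<^sub>o y - x' \<otimes>\<^sub>o y' = (x - x') \<otimes>\<^sub>o y + x' \<otimes>\<^sub>o (y - y')"
    by (simp add: tensor_op_diff_left tensor_op_diff_right)
  then have "norm (x \<otimes>\<^sub>o y - x' \<otimes>\<^sub>o y') \<le> norm (x - x') * norm y + norm (y - y') * norm x'"
    using norm_triangle_ineq[of "(x - x') \<otimes>\<^sub>o y" "x' \<otimes>\<^sub>o (y - y')"]
      norm_tensor_op_le[of "x - x'" y] norm_tensor_op_le[of x' "y - y'"] by (simp add: mult.commute)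
  also have "\<dots> < e"
    using bound[OF x'(2)] bound[OF y'(2)] by simp
  finally show ?thesis using x' y' by blast
qed

lemma fin_rank_dense:
  assumes D: "closure D = UNIV" and "0 < e"
  shows "\<exists>qs\<in>lists (D \<times> D). length qs = length ps \<and> norm (fin_rank ps - fin_rank qs) < e"
  using \<open>0 < e\<close>
proof (induction ps arbitrary: e)
  case (Cons p ps)
  obtain qs where qs: "qs \<in> lists (D \<times> D)" "length qs = length ps"
    "norm (fin_rank ps - fin_rank qs) < e / 2"
    using Cons.IH[of "e / 2"] Cons.prems by auto
  obtain x y where xy: "x \<in> D" "y \<in> D" "norm (fst p \<otimes>\<^sub>o snd p - x \<otimes>\<^sub>o y) < e / 2"
    using tensor_dense[OF D, of "e / 2"] Cons.prems by (meson half_gt_zero)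
  have "norm (fin_rank (p # ps) - fin_rank ((x, y) # qs))
      = norm ((fst p \<otimes>\<^sub>o snd p - x \<otimes>\<^sub>o y) + (fin_rank ps - fin_rank qs))"
    by (simp add: algebra_simps)
  also have "\<dots> < e"
    using norm_triangle_ineq[of "fst p \<otimes>\<^sub>o snd p - x \<otimes>\<^sub>o y" "fin_rank ps - fin_rank qs"] xy(3) qs(3)
    by simp
  finally show ?case using qs xy by (intro bexI[of _ "(x, y) # qs"]) auto
qed simp

text \<open>Countably many operators suffice to compute all singular numbers, and to approximate in the
quasi-norms below.\<close>

lemma rank_less_dense:
  fixes G :: "'h::{real_inner, complete_space} \<Rightarrow>\<^sub>L 'h"
  assumes D: "closure D = UNIV" and "0 < e" "rank_less n G"
  shows "\<exists>qs\<in>lists (D \<times> D). length qs < n \<and> norm (G - fin_rank qs) < e"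
  using rank_less_imp_fin_rank[OF assms(3)] fin_rank_dense[OF D \<open>0 < e\<close>] by metis


section \<open>The quasi-normed operator ideals\<close>

lemma compact_opI:
  assumes "compact K" "blinfun_apply A ` cball 0 1 \<subseteq> K"
  shows "compact_op A"
proof -
  have "closure (blinfun_apply A ` cball 0 1) \<subseteq> K"
    using assms by (intro closure_minimal compact_imp_closed)
  then have "closure (blinfun_apply A ` cball 0 1) = K \<inter> closure (blinfun_apply A ` cball 0 1)"
    by blast
  then show ?thesis
    using compact_Int_closed[OF assms(1) closed_closure, of "blinfun_apply A ` cball 0 1"]
    by (simp add: compact_op_def)
qed

lemma compact_op_add:
  fixes A B :: "'h::real_normed_vector \<Rightarrow>\<^sub>L 'h"
  assumes "compact_op A" "compact_op B"
  shows "compact_op (A + B)"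
proof -
  let ?S = "{x + y |x y. x \<in> closure (blinfun_apply A ` cball 0 1) \<and> y \<in> closure (blinfun_apply B ` cball 0 1)}"
  have "compact ?S" using assms unfolding compact_op_def by (rule compact_sums)
  moreover have "blinfun_apply (A + B) ` cball 0 1 \<subseteq> ?S"
  proof (clarsimp simp: plus_blinfun.rep_eq)
    fix x :: 'h assume "norm x \<le> 1"
    then have "A x \<in> closure (blinfun_apply A ` cball 0 1)" "B x \<in> closure (blinfun_apply B ` cball 0 1)"
      by (auto intro!: closure_subset[THEN subsetD])
    then show "\<exists>x' y. A x + B x = x' + y \<and> x' \<in> closure (blinfun_apply A ` cball 0 1)
        \<and> y \<in> closure (blinfun_apply B ` cball 0 1)" by blast
  qed
  ultimately show ?thesis by (rule compact_opI)
qed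

lemma compact_op_uminus:
  fixes A :: "'h::real_normed_vector \<Rightarrow>\<^sub>L 'h"
  assumes "compact_op A"
  shows "compact_op (- A)"
proof -
  have "compact (uminus ` closure (blinfun_apply A ` cball 0 1))"
    using assms unfolding compact_op_def by (rule compact_negations)
  moreover have "blinfun_apply (- A) ` cball 0 1 \<subseteq> uminus ` closure (blinfun_apply A ` cball 0 1)"
    using closure_subset[of "blinfun_apply A ` cball 0 1"] by (auto simp: uminus_blinfun.rep_eq)
  ultimately show ?thesis by (rule compact_opI)
qed

lemma compact_op_tensor: "compact_op (x \<otimes>\<^sub>o y)"
proof -
  have "compact ((\<lambda>t. t *\<^sub>R x) ` {- norm y .. norm y})"
    by (intro compact_continuous_image continuous_intros) auto
  moreover have "blinfun_apply (x \<otimes>\<^sub>o y) ` cball 0 1 \<subseteq> (\<lambda>t. t *\<^sub>R x) ` {- norm y .. norm y}"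
  proof (clarsimp simp: tensor_op.rep_eq)
    fix w :: 'a assume w: "norm w \<le> 1"
    have "\<bar>w \<bullet> y\<bar> \<le> norm w * norm y" by (rule Cauchy_Schwarz_ineq2)
    also have "\<dots> \<le> 1 * norm y" using w by (intro mult_right_mono) auto
    finally show "(w \<bullet> y) *\<^sub>R x \<in> (\<lambda>t. t *\<^sub>R x) ` {- norm y .. norm y}"
      by (intro image_eqI[where x = "w \<bullet> y"]) auto
  qed
  ultimately show ?thesis by (rule compact_opI)
qed

lemma compact_op_0: "compact_op (0 :: 'h::real_inner \<Rightarrow>\<^sub>L 'h)"
  using compact_op_tensor[of "0::'h" 0] by simp

lemma compact_op_fin_rank: "compact_op (fin_rank ps)"
  by (induction ps) (auto intro: compact_op_0 compact_op_add compact_op_tensor)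

lemma Suc_le_double_half: "real (Suc n) \<le> 2 * real (Suc (n div 2))"
proof -
  have "Suc n \<le> 2 * Suc (n div 2)" by presburger
  then have "real (Suc n) \<le> real (2 * Suc (n div 2))" by (rule of_nat_mono)
  then show ?thesis by simp
qed

text \<open>Halving the index makes every term occur twice.\<close>

lemma sums_div_2:
  fixes f :: "nat \<Rightarrow> real"
  assumes "summable f"
  shows "(\<lambda>n. f (n div 2)) sums (2 * suminf f)"
proof -
  have "(\<lambda>n. if even n then f (n div 2) else f ((n - 1) div 2)) sums (suminf f + suminf f)"
    using assms by (intro sums_if) auto
  moreover have "(\<lambda>n. if even n then f (n div 2) else f ((n - 1) div 2)) = (\<lambda>n. f (n div 2))"
  proof
    fix n show "(if even n then f (n div 2) else f ((n - 1) div 2)) = f (n div 2)"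
      by (cases "even n") (auto elim!: oddE)
  qed
  ultimately show ?thesis by simp
qed

lemma tendsto_div_2:
  fixes f :: "nat \<Rightarrow> real"
  assumes "(\<lambda>n. real (Suc n) * f n) \<longlonglongrightarrow> 0"
  shows "(\<lambda>n. real (Suc n) * f (n div 2)) \<longlonglongrightarrow> 0"
proof (rule tendsto_rabs_zero_cancel, rule tendsto_sandwich[of "\<lambda>_. 0"])
  have "filterlim (\<lambda>n::nat. n div 2) sequentially sequentially"
    by (rule filterlim_at_top_div_const_nat) simp
  from tendsto_rabs_zero[OF filterlim_compose[OF assms this]]
  show "(\<lambda>n. 2 * \<bar>real (Suc (n div 2)) * f (n div 2)\<bar>) \<longlonglongrightarrow> 0"
    by (auto intro: tendsto_mult_right_zero)
  show "\<forall>\<^sub>F n in sequentially. \<bar>real (Suc n) * f (n div 2)\<bar> \<le> 2 * \<bar>real (Suc (n div 2)) * f (n div 2)\<bar>"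
  proof (intro always_eventually allI)
    fix n
    have "real (Suc n) * \<bar>f (n div 2)\<bar> \<le> 2 * real (Suc (n div 2)) * \<bar>f (n div 2)\<bar>"
      by (intro mult_right_mono Suc_le_double_half) auto
    then show "\<bar>real (Suc n) * f (n div 2)\<bar> \<le> 2 * \<bar>real (Suc (n div 2)) * f (n div 2)\<bar>"
      by (simp add: abs_mult mult.assoc del: of_nat_Suc)
  qed
qed auto

lemma weak_S1_0_iff:
  "A \<in> weak_S1_0 \<longleftrightarrow> compact_op A \<and> (\<lambda>n. real (Suc n) * sing_num A (Suc n)) \<longlonglongrightarrow> 0"
  unfolding weak_S1_0_def mem_Collect_eq
  using filterlim_sequentially_Suc[of "\<lambda>n. real n * sing_num A n" "nhds 0"] by (simp del: of_nat_Suc)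

lemma trace_class_iff:
  "A \<in> trace_class \<longleftrightarrow> compact_op A \<and> summable (\<lambda>n. sing_num A (Suc n))"
  by (simp add: trace_class_def)

lemma weak_qnorm_eq: "weak_qnorm A = (SUP n. real (Suc n) * sing_num A (Suc n))"
proof -
  have "{1::nat..} = range Suc" by (auto simp: image_iff) (metis Suc_le_D)
  then show ?thesis unfolding weak_qnorm_def by (simp add: image_image)
qed

lemma bdd_above_weak_S1_0:
  assumes "A \<in> weak_S1_0"
  shows "bdd_above (range (\<lambda>n. real (Suc n) * sing_num A (Suc n)))"
proof (rule Bseq_bdd_above, rule convergent_imp_Bseq, rule convergentI)
  show "(\<lambda>n. real (Suc n) * sing_num A (Suc n)) \<longlonglongrightarrow> 0"
    using assms by (simp only: weak_S1_0_iff)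
qed

lemma weak_qnorm_upper:
  "A \<in> weak_S1_0 \<Longrightarrow> real (Suc n) * sing_num A (Suc n) \<le> weak_qnorm A"
  unfolding weak_qnorm_eq using bdd_above_weak_S1_0 by (intro cSUP_upper) auto

lemma weak_qnorm_least:
  "(\<And>n. real (Suc n) * sing_num A (Suc n) \<le> c) \<Longrightarrow> weak_qnorm A \<le> c"
  unfolding weak_qnorm_eq by (intro cSUP_least) auto

lemma weak_S1_0_add:
  assumes "A \<in> weak_S1_0" "B \<in> weak_S1_0"
  shows "A + B \<in> weak_S1_0"
proof -
  let ?f = "\<lambda>n. sing_num A (Suc n) + sing_num B (Suc n)"
  have "(\<lambda>n. real (Suc n) * sing_num A (Suc n) + real (Suc n) * sing_num B (Suc n)) \<longlonglongrightarrow> 0 + 0"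
    using assms unfolding weak_S1_0_iff by (intro tendsto_add) auto
  then have "(\<lambda>n. real (Suc n) * ?f (n div 2)) \<longlonglongrightarrow> 0"
    by (intro tendsto_div_2) (simp add: distrib_left)
  then have "(\<lambda>n. real (Suc n) * sing_num (A + B) (Suc n)) \<longlonglongrightarrow> 0"
    by (rule tendsto_sandwich[of "\<lambda>_. 0", rotated 3])
      (auto intro!: always_eventually mult_left_mono sing_num_add_half mult_nonneg_nonneg
         sing_num_nonneg simp del: of_nat_Suc)
  then show ?thesis using assms by (simp add: weak_S1_0_iff compact_op_add)
qed

lemma trace_class_add:
  assumes "A \<in> trace_class" "B \<in> trace_class"
  shows "A + B \<in> trace_class"
proof -
  let ?f = "\<lambda>n. sing_num A (Suc n) + sing_num B (Suc n)"
  have "summable ?f" using assms unfolding trace_class_iff by (intro summable_add) auto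
  then have "summable (\<lambda>n. ?f (n div 2))" using sums_div_2 sums_summable by blast
  then have "summable (\<lambda>n. sing_num (A + B) (Suc n))"
    by (rule summable_comparison_test'[of _ 0]) (auto intro: sing_num_add_half simp: sing_num_nonneg)
  then show ?thesis using assms by (simp add: trace_class_iff compact_op_add)
qed

lemma weak_S1_0_uminus: "A \<in> weak_S1_0 \<Longrightarrow> - A \<in> weak_S1_0"
  by (simp add: weak_S1_0_iff sing_num_uminus compact_op_uminus)

lemma trace_class_uminus: "A \<in> trace_class \<Longrightarrow> - A \<in> trace_class"
  by (simp add: trace_class_iff sing_num_uminus compact_op_uminus)

lemma fin_rank_trace_class: "fin_rank ps \<in> trace_class"
proof -
  have "sing_num (fin_rank ps) (Suc n) = 0" if "n \<ge> length ps" for n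
    using that by (intro sing_num_eq_0 rank_less_mono[OF rank_less_fin_rank]) auto
  then show ?thesis
    unfolding trace_class_iff
    by (intro conjI compact_op_fin_rank summable_finite[of "{..<length ps}"]) auto
qed

lemma fin_rank_weak_S1_0: "fin_rank ps \<in> weak_S1_0"
proof -
  have "sing_num (fin_rank ps) (Suc n) = 0" if "n \<ge> length ps" for n
    using that by (intro sing_num_eq_0 rank_less_mono[OF rank_less_fin_rank]) auto
  then show ?thesis
    unfolding weak_S1_0_iff
    by (auto intro!: compact_op_fin_rank tendsto_eventually eventually_sequentiallyI[of "length ps"]) 
qed

lemma weak_qnorm_add_le:
  assumes "A \<in> weak_S1_0" "B \<in> weak_S1_0"
  shows "weak_qnorm (A + B) \<le> 2 * (weak_qnorm A + weak_qnorm B)"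
proof (rule weak_qnorm_least)
  fix n
  let ?s = "sing_num A (Suc (n div 2)) + sing_num B (Suc (n div 2))"
  have "real (Suc n) * sing_num (A + B) (Suc n) \<le> (2 * real (Suc (n div 2))) * ?s"
    by (intro mult_mono sing_num_add_half Suc_le_double_half add_nonneg_nonneg sing_num_nonneg)
      auto
  also have "\<dots> \<le> 2 * (weak_qnorm A + weak_qnorm B)"
    using weak_qnorm_upper[OF assms(1), of "n div 2"] weak_qnorm_upper[OF assms(2), of "n div 2"]
    by (simp add: algebra_simps)
  finally show "real (Suc n) * sing_num (A + B) (Suc n) \<le> 2 * (weak_qnorm A + weak_qnorm B)" .
qed

lemma trace_norm_add_le:
  assumes "A \<in> trace_class" "B \<in> trace_class"
  shows "trace_norm (A + B) \<le> 2 * (trace_norm A + trace_norm B)"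
proof -
  let ?f = "\<lambda>n. sing_num A (Suc n) + sing_num B (Suc n)"
  have sm: "summable (\<lambda>n. sing_num A (Suc n))" "summable (\<lambda>n. sing_num B (Suc n))"
    "summable (\<lambda>n. sing_num (A + B) (Suc n))"
    using assms trace_class_add[OF assms] by (auto simp: trace_class_iff)
  have f: "(\<lambda>n. ?f (n div 2)) sums (2 * suminf ?f)"
    using sm by (intro sums_div_2 summable_add)
  have "trace_norm (A + B) \<le> (\<Sum>n. ?f (n div 2))"
    unfolding trace_norm_def using sm f by (intro suminf_le sing_num_add_half) (auto simp: sums_iff)
  also have "\<dots> = 2 * suminf ?f" using f by (simp add: sums_iff)
  also have "suminf ?f = trace_norm A + trace_norm B"
    unfolding trace_norm_def using sm by (simp add: suminf_add)
  finally show ?thesis .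
qed

lemma norm_le_weak_qnorm: "A \<in> weak_S1_0 \<Longrightarrow> norm A \<le> weak_qnorm A"
  using weak_qnorm_upper[of A 0] by (simp add: sing_num_1)

lemma norm_le_trace_norm:
  assumes "A \<in> trace_class"
  shows "norm A \<le> trace_norm A"
proof -
  have "(\<Sum>n\<in>{0}. sing_num A (Suc n)) \<le> trace_norm A"
    unfolding trace_norm_def using assms
    by (intro sum_le_suminf) (auto simp: trace_class_iff sing_num_nonneg)
  then show ?thesis by (simp add: sing_num_1)
qed

lemma weak_qnorm_tensor_le: "weak_qnorm (x \<otimes>\<^sub>o y) \<le> norm x * norm y"
proof (rule weak_qnorm_least)
  fix n
  show "real (Suc n) * sing_num (x \<otimes>\<^sub>o y) (Suc n) \<le> norm x * norm y"
  proof (cases n)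
    case 0
    then show ?thesis by (simp add: sing_num_1 norm_tensor_op_le)
  next
    case (Suc k)
    then have "sing_num (x \<otimes>\<^sub>o y) (Suc n) = 0"
      by (intro sing_num_eq_0 rank_less_mono[OF rank_less_tensor]) auto
    then show ?thesis by simp
  qed
qed

context
  fixes A :: "'h::{real_inner, complete_space} \<Rightarrow>\<^sub>L 'h" and D :: "'h set" and c :: "nat \<Rightarrow> real"
  assumes D: "closure D = UNIV"
  defines "c \<equiv> \<lambda>n. sing_num A (Suc n) + (1/2) ^ n"
begin

text \<open>Let \<open>G\<^sub>k\<close> have rank at most \<open>k\<close> and distance at most \<open>c k\<close> from \<open>A\<close>. For \<open>m \<ge> K\<close> the operator
\<open>G\<^sub>m - G\<^sub>K\<close> has rank at most \<open>2 m\<close> and approximates \<open>A - G\<^sub>K\<close> within \<open>c m\<close>. Hence the singular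
numbers of \<open>A - G\<^sub>K\<close> are bounded both by the small constant \<open>c K\<close> and by \<open>c (n div 2)\<close>, which
satisfies the same decay condition as the singular numbers of \<open>A\<close>. This replaces the truncation of the singular value
decomposition; the summand \<open>2\<^sup>-\<^sup>n\<close> in \<open>c\<close> pays for infima that need not be attained and for
passing to vectors in \<open>D\<close>.\<close>

lemma fin_rank_approximants:
  obtains ps where "\<And>K. ps K \<in> lists (D \<times> D)"
    "\<And>K n. sing_num (A - fin_rank (ps K)) (Suc n) \<le> c K"
    "\<And>K n. sing_num (A - fin_rank (ps K)) (Suc n) \<le> c (n div 2)"
proof -
  have "\<exists>qs. qs \<in> lists (D \<times> D) \<and> length qs \<le> k \<and> norm (A - fin_rank qs) \<le> c k" for k
  proof -
    have e: "(0::real) < (1/2) ^ k / 2" by simp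
    obtain G where G: "rank_less (Suc k) G" "norm (A - G) < sing_num A (Suc k) + (1/2) ^ k / 2"
      using sing_num_approx[OF _ e, of "Suc k"] by blast
    obtain qs where qs: "qs \<in> lists (D \<times> D)" "length qs < Suc k" "norm (G - fin_rank qs) < (1/2) ^ k / 2"
      using rank_less_dense[OF D e G(1)] by blast
    have "norm (A - fin_rank qs) \<le> norm (A - G) + norm (G - fin_rank qs)"
      using norm_triangle_ineq[of "A - G" "G - fin_rank qs"] by simp
    also have "\<dots> \<le> (sing_num A (Suc k) + (1/2) ^ k / 2) + (1/2) ^ k / 2" using G qs by linarith
    also have "\<dots> = c k" by (simp add: c_def)
    finally show ?thesis using qs by auto
  qed
  then obtain ps where ps: "\<And>k. ps k \<in> lists (D \<times> D)" "\<And>k. length (ps k) \<le> k"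
    "\<And>k. norm (A - fin_rank (ps k)) \<le> c k" by metis
  have c_antimono: "c n \<le> c m" if "m \<le> n" for m n
    unfolding c_def using that by (intro add_mono sing_num_antimono power_decreasing) auto
  have cK: "sing_num (A - fin_rank (ps K)) (Suc n) \<le> c K" for K n
    using sing_num_le_norm[of "Suc n" "A - fin_rank (ps K)"] ps(3)[of K] by simp
  have "sing_num (A - fin_rank (ps K)) (Suc n) \<le> c (n div 2)" for K n
  proof (cases "K \<le> n div 2")
    case True
    define m where "m = n div 2"
    have "rank_less (Suc (m + K)) (fin_rank (ps m) - fin_rank (ps K))"
      using rank_less_add[of m "fin_rank (ps m)" K "- fin_rank (ps K)"]
        rank_less_mono[OF rank_less_fin_rank, of "ps m" "Suc m"]
        rank_less_mono[OF rank_less_fin_rank, of "ps K" "Suc K"] ps(2)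
      by (auto intro: rank_less_uminus)
    then have "rank_less (Suc n) (fin_rank (ps m) - fin_rank (ps K))"
      by (rule rank_less_mono) (use True in \<open>simp add: m_def\<close>)
    then have "sing_num (A - fin_rank (ps K)) (Suc n)
        \<le> norm (A - fin_rank (ps K) - (fin_rank (ps m) - fin_rank (ps K)))"
      by (rule sing_num_le)
    also have "\<dots> \<le> c m" using ps(3)[of m] by simp
    finally show ?thesis by (simp add: m_def)
  next
    case False
    then show ?thesis using cK[of K n] c_antimono[of "n div 2" K] by simp
  qed
  then show thesis using that ps cK by blast
qed

text \<open>The condition \<open>n s\<^sub>n(A) \<longlonglongrightarrow> 0\<close>, rather than mere boundedness, is what makes finite-rank operators
dense, hence the space separable.\<close>

lemma weak_qnorm_dense:
  assumes A: "A \<in> weak_S1_0" and "0 < e"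
  shows "\<exists>ps\<in>lists (D \<times> D). weak_qnorm (A - fin_rank ps) \<le> e"
proof -
  obtain ps where ps: "\<And>K. ps K \<in> lists (D \<times> D)"
    "\<And>K n. sing_num (A - fin_rank (ps K)) (Suc n) \<le> c K"
    "\<And>K n. sing_num (A - fin_rank (ps K)) (Suc n) \<le> c (n div 2)"
    using fin_rank_approximants by blast
  have "(\<lambda>n. real (Suc n) * (1/2) ^ n) \<longlonglongrightarrow> 0" by real_asymp
  then have "(\<lambda>n. real (Suc n) * sing_num A (Suc n) + real (Suc n) * (1/2) ^ n) \<longlonglongrightarrow> 0 + 0"
    using A unfolding weak_S1_0_iff by (intro tendsto_add) auto
  then have "(\<lambda>n. real (Suc n) * c n) \<longlonglongrightarrow> 0" by (simp add: c_def distrib_left)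
  then have "\<forall>\<^sub>F n in sequentially. real (Suc n) * c n < e / 2"
    by (rule order_tendstoD) (use \<open>0 < e\<close> in simp)
  then obtain N where N: "\<And>n. n \<ge> N \<Longrightarrow> real (Suc n) * c n < e / 2"
    by (auto simp: eventually_sequentially)
  have c_nonneg: "0 \<le> c n" for n by (simp add: c_def sing_num_nonneg)
  have "weak_qnorm (A - fin_rank (ps N)) \<le> e"
  proof (rule weak_qnorm_least)
    fix n
    \<comment> \<open>The two bounds on the error are used for \<open>n div 2 < N\<close> and for \<open>n div 2 \<ge> N\<close>; since
        \<open>n + 1 \<le> 2 (k + 1)\<close> holds in both cases, they can be treated together.\<close>
    define k where "k = max N (n div 2)"
    have le: "sing_num (A - fin_rank (ps N)) (Suc n) \<le> c k"
      using ps(2)[of N n] ps(3)[of N n] by (simp add: k_def max_def)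
    have "real (Suc n) * sing_num (A - fin_rank (ps N)) (Suc n) \<le> (2 * real (Suc k)) * c k"
    proof (rule mult_mono[OF _ le])
      show "real (Suc n) \<le> 2 * real (Suc k)"
        using Suc_le_double_half[of n] by (simp add: k_def)
    qed (auto simp: sing_num_nonneg)
    also have "\<dots> \<le> e" using N[of k] by (simp add: k_def mult.assoc del: of_nat_Suc)
    finally show "real (Suc n) * sing_num (A - fin_rank (ps N)) (Suc n) \<le> e" .
  qed
  then show ?thesis using ps(1) by blast
qed

text \<open>Dominated convergence of the series of singular numbers, with the dominating sequence
\<open>c (n div 2)\<close>.\<close>

lemma trace_norm_dense:
  assumes A: "A \<in> trace_class" and "0 < e"
  shows "\<exists>ps\<in>lists (D \<times> D). trace_norm (A - fin_rank ps) \<le> e"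
proof -
  obtain ps where ps: "\<And>K. ps K \<in> lists (D \<times> D)"
    "\<And>K n. sing_num (A - fin_rank (ps K)) (Suc n) \<le> c K"
    "\<And>K n. sing_num (A - fin_rank (ps K)) (Suc n) \<le> c (n div 2)"
    using fin_rank_approximants by blast
  have "summable c"
    unfolding c_def using A by (intro summable_add summable_geometric) (auto simp: trace_class_iff)
  then have c0: "c \<longlonglongrightarrow> 0" by (rule summable_LIMSEQ_zero)
  have "(\<lambda>K. \<Sum>n. sing_num (A - fin_rank (ps K)) (Suc n)) \<longlonglongrightarrow> (\<Sum>n::nat. 0)"
  proof (rule tannerys_theorem[THEN conjunct2, THEN conjunct2])
    show "(\<lambda>K. sing_num (A - fin_rank (ps K)) (Suc n)) \<longlonglongrightarrow> 0" for n
      by (rule tendsto_sandwich[OF _ _ tendsto_const c0])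
        (auto intro!: always_eventually ps sing_num_nonneg)
    show "summable (\<lambda>n. c (n div 2))" using sums_div_2[OF \<open>summable c\<close>] by (rule sums_summable)
    show "\<forall>\<^sub>F (n, K) in sequentially \<times>\<^sub>F sequentially.
        norm (sing_num (A - fin_rank (ps K)) (Suc n)) \<le> c (n div 2)"
      by (intro always_eventually) (auto simp: sing_num_nonneg ps)
  qed simp
  then have "\<forall>\<^sub>F K in sequentially. trace_norm (A - fin_rank (ps K)) < e"
    unfolding trace_norm_def using \<open>0 < e\<close> by (intro order_tendstoD) auto
  then obtain K where "trace_norm (A - fin_rank (ps K)) < e"
    by (auto simp: eventually_sequentially)
  then show ?thesis using ps(1) less_imp_le by blast
qed

end


section \<open>Measurability through matrix coefficients\<close>

text \<open>The \<open>\<sigma>\<close>-algebra generated by the matrix coefficients \<open>A \<mapsto> \<langle>A u, v\<rangle>\<close>. In infinite dimension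
the space of bounded operators is not separable, so its norm-Borel \<open>\<sigma>\<close>-algebra is unsuitable for sums of random
operators; \<open>op_sigma\<close> is compatible with all operations that are needed, because measurability is
tested on real random variables.\<close>

definition op_sigma :: "('h::real_inner \<Rightarrow>\<^sub>L 'h) measure"
  where "op_sigma = vimage_algebra UNIV (\<lambda>A (u, v). blinfun_apply A u \<bullet> v) (\<Pi>\<^sub>M p\<in>UNIV. borel)"

lemma space_op_sigma [simp]: "space op_sigma = UNIV"
  by (simp add: op_sigma_def)

lemma measurable_op_sigma_iff:
  fixes f :: "'a \<Rightarrow> ('h::real_inner \<Rightarrow>\<^sub>L 'h)"
  shows "f \<in> N \<rightarrow>\<^sub>M op_sigma \<longleftrightarrow> (\<forall>u v. (\<lambda>\<omega>. f \<omega> u \<bullet> v) \<in> borel_measurable N)"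
proof
  assume f: "f \<in> N \<rightarrow>\<^sub>M op_sigma"
  have "(\<lambda>A (u, v). blinfun_apply A u \<bullet> v) \<in> op_sigma \<rightarrow>\<^sub>M (\<Pi>\<^sub>M p\<in>UNIV. borel)"
    unfolding op_sigma_def by (rule measurable_vimage_algebra1) (auto simp: space_PiM)
  from measurable_compose[OF f this]
  have *: "(\<lambda>\<omega>. \<lambda>(u, v). f \<omega> u \<bullet> v) \<in> N \<rightarrow>\<^sub>M (\<Pi>\<^sub>M p\<in>UNIV. borel)" .
  show "\<forall>u v. (\<lambda>\<omega>. f \<omega> u \<bullet> v) \<in> borel_measurable N"
    using measurable_component_singleton[THEN measurable_compose[OF *], of "(u, v)" for u v]
    by simp
next
  assume f: "\<forall>u v. (\<lambda>\<omega>. f \<omega> u \<bullet> v) \<in> borel_measurable N"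
  show "f \<in> N \<rightarrow>\<^sub>M op_sigma"
    unfolding op_sigma_def
  proof (rule measurable_vimage_algebra2)
    show "(\<lambda>\<omega>. \<lambda>(u, v). f \<omega> u \<bullet> v) \<in> N \<rightarrow>\<^sub>M (\<Pi>\<^sub>M p\<in>UNIV. borel)"
      by (rule measurable_PiM_single') (use f in \<open>auto simp: space_PiM\<close>)
  qed simp
qed

lemma measurable_coefficient: "(\<lambda>A. blinfun_apply A u \<bullet> v) \<in> borel_measurable op_sigma"
proof -
  have "(\<lambda>A. A) \<in> op_sigma \<rightarrow>\<^sub>M op_sigma" by simp
  then show ?thesis unfolding measurable_op_sigma_iff by blast
qed

lemma measurable_op_sigma_diff:
  fixes f g :: "'a \<Rightarrow> ('h::real_inner \<Rightarrow>\<^sub>L 'h)"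
  assumes "f \<in> N \<rightarrow>\<^sub>M op_sigma" "g \<in> N \<rightarrow>\<^sub>M op_sigma"
  shows "(\<lambda>\<omega>. f \<omega> - g \<omega>) \<in> N \<rightarrow>\<^sub>M op_sigma"
  using assms unfolding measurable_op_sigma_iff minus_blinfun.rep_eq inner_diff_left
  by (intro allI borel_measurable_diff) auto

lemma measurable_op_sigma_const: "(\<lambda>\<omega>. A) \<in> N \<rightarrow>\<^sub>M op_sigma"
  by (simp add: measurable_op_sigma_iff)

lemma measurable_op_sigma_tensor:
  fixes f g :: "'a \<Rightarrow> 'h::{real_inner, second_countable_topology}"
  assumes [measurable]: "f \<in> borel_measurable N" "g \<in> borel_measurable N"
  shows "(\<lambda>\<omega>. f \<omega> \<otimes>\<^sub>o g \<omega>) \<in> N \<rightarrow>\<^sub>M op_sigma"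
  unfolding measurable_op_sigma_iff tensor_op.rep_eq inner_scaleR_left by measurable

lemma norm_blinfun_le_iff_dense:
  fixes A :: "'h::real_inner \<Rightarrow>\<^sub>L 'h"
  assumes D: "closure D = UNIV"
  shows "norm A \<le> c \<longleftrightarrow> 0 \<le> c \<and> (\<forall>p\<in>D \<times> D. A (fst p) \<bullet> snd p \<le> c * norm (fst p) * norm (snd p))"
proof safe
  assume c: "norm A \<le> c"
  show "0 \<le> c" using c norm_ge_zero[of A] by linarith
  fix x y
  have "A x \<bullet> y \<le> norm (A x) * norm y" by (rule norm_cauchy_schwarz)
  also have "\<dots> \<le> (norm A * norm x) * norm y" by (intro mult_right_mono norm_blinfun) simp
  also have "\<dots> \<le> (c * norm x) * norm y" using c by (intro mult_right_mono) auto
  finally show "A (fst (x, y)) \<bullet> snd (x, y) \<le> c * norm (fst (x, y)) * norm (snd (x, y))" by simp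
next
  assume c: "0 \<le> c" and le: "\<forall>p\<in>D \<times> D. A (fst p) \<bullet> snd p \<le> c * norm (fst p) * norm (snd p)"
  have "closed {p. A (fst p) \<bullet> snd p \<le> c * norm (fst p) * norm (snd p)}"
    by (intro closed_Collect_le continuous_intros blinfun.continuous_on)
  then have "closure (D \<times> D) \<subseteq> {p. A (fst p) \<bullet> snd p \<le> c * norm (fst p) * norm (snd p)}"
    using le by (intro closure_minimal) auto
  then have le': "A x \<bullet> y \<le> c * norm x * norm y" for x y
  proof -
    have "(x, y) \<in> closure (D \<times> D)" using D by (simp add: closure_Times)
    then show ?thesis using \<open>closure (D \<times> D) \<subseteq> _\<close> by auto
  qed
  show "norm A \<le> c"
  proof (rule norm_blinfun_bound[OF c])
    fix x
    have "norm (A x) * norm (A x) \<le> (c * norm x) * norm (A x)"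
      using le'[of x "A x"] by (simp add: power2_norm_eq_inner[symmetric] power2_eq_square)
    then show "norm (A x) \<le> c * norm x"
      using c by (cases "A x = 0") auto
  qed
qed

lemma countable_dense:
  obtains D :: "'h::second_countable_topology set" where "countable D" "closure D = UNIV"
proof -
  obtain D :: "'h set" where D: "countable D" "\<And>X. open X \<Longrightarrow> X \<noteq> {} \<Longrightarrow> \<exists>d\<in>D. d \<in> X"
    using countable_dense_setE by blast
  have "x \<in> closure D" for x
  proof (rule ccontr)
    assume "x \<notin> closure D"
    then obtain d where "d \<in> D" "d \<in> - closure D" using D(2)[of "- closure D"] by auto
    then show False using closure_subset by auto
  qed
  then show thesis using that D(1) by blast
qed

lemma measurable_norm_op_sigma:
  "norm \<in> borel_measurable (op_sigma :: ('h::{real_inner, second_countable_topology} \<Rightarrow>\<^sub>L 'h) measure)"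
proof (rule borel_measurableI_le)
  fix c
  obtain D :: "'h set" where D: "countable D" "closure D = UNIV" using countable_dense .
  have "Measurable.pred op_sigma (\<lambda>A::'h \<Rightarrow>\<^sub>L 'h. 0 \<le> c \<and>
      (\<forall>p\<in>D \<times> D. A (fst p) \<bullet> snd p \<le> c * norm (fst p) * norm (snd p)))"
    using D(1) unfolding not_less[symmetric, of "_ \<bullet> _"]
    by (intro pred_intros_logic measurable_pred_countable countable_SIGMA
        borel_measurable_pred_less measurable_coefficient borel_measurable_const) auto
  then show "{A \<in> space op_sigma. norm (A :: 'h \<Rightarrow>\<^sub>L 'h) \<le> c} \<in> sets op_sigma"
    unfolding norm_blinfun_le_iff_dense[OF D(2)] pred_def .
qed

text \<open>Since the inequality is strict, a competitor of the right rank may be moved into the countable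
family of operators with vectors in \<open>D\<close>; this expresses a singular number through countably many
operator norms.\<close>

lemma sing_num_less_iff_dense:
  fixes A :: "'h::{real_inner, complete_space} \<Rightarrow>\<^sub>L 'h"
  assumes D: "closure D = UNIV"
  shows "sing_num A (Suc n) < c \<longleftrightarrow>
    (\<exists>ps\<in>{ps \<in> lists (D \<times> D). length ps \<le> n}. norm (A - fin_rank ps) < c)"
proof
  assume less: "sing_num A (Suc n) < c"
  define e where "e = (c - sing_num A (Suc n)) / 2"
  have e: "0 < e" using less by (simp add: e_def)
  obtain G where G: "rank_less (Suc n) G" "norm (A - G) < sing_num A (Suc n) + e"
    using sing_num_approx[OF _ e] by blast
  obtain ps where ps: "ps \<in> lists (D \<times> D)" "length ps < Suc n" "norm (G - fin_rank ps) < e"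
    using rank_less_dense[OF D e G(1)] by blast
  have "norm (A - fin_rank ps) < c"
    using norm_triangle_ineq[of "A - G" "G - fin_rank ps"] G(2) ps(3) by (simp add: e_def field_simps)
  then show "\<exists>ps\<in>{ps \<in> lists (D \<times> D). length ps \<le> n}. norm (A - fin_rank ps) < c"
    using ps by auto
next
  assume "\<exists>ps\<in>{ps \<in> lists (D \<times> D). length ps \<le> n}. norm (A - fin_rank ps) < c"
  then obtain ps where "length ps \<le> n" "norm (A - fin_rank ps) < c" by auto
  then show "sing_num A (Suc n) < c"
    using sing_num_le[OF rank_less_mono[OF rank_less_fin_rank], of ps "Suc n" A] by simp
qed

lemma measurable_sing_num:
  "(\<lambda>A. sing_num A (Suc n))
    \<in> borel_measurable (op_sigma :: ('h::{real_inner, complete_space, second_countable_topology} \<Rightarrow>\<^sub>L 'h) measure)"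
proof (rule borel_measurableI_less)
  fix c
  obtain D :: "'h set" where D: "countable D" "closure D = UNIV" using countable_dense .
  have "countable {ps \<in> lists (D \<times> D). length ps \<le> n}"
    using D(1) by (intro countable_Collect countable_lists countable_SIGMA)
  then have "Measurable.pred op_sigma (\<lambda>A::'h \<Rightarrow>\<^sub>L 'h.
      \<exists>ps\<in>{ps \<in> lists (D \<times> D). length ps \<le> n}. norm (A - fin_rank ps) < c)"
    by (intro measurable_pred_countable borel_measurable_pred_less
        measurable_compose[OF _ measurable_norm_op_sigma] measurable_op_sigma_diff
        measurable_op_sigma_const measurable_ident_sets borel_measurable_const) auto
  then show "{A \<in> space op_sigma. sing_num (A :: 'h \<Rightarrow>\<^sub>L 'h) (Suc n) < c} \<in> sets op_sigma"
    unfolding sing_num_less_iff_dense[OF D(2)] pred_def .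
qed

lemma measurable_trace_norm:
  "trace_norm \<in> borel_measurable
     (op_sigma :: ('h::{real_inner, complete_space, second_countable_topology} \<Rightarrow>\<^sub>L 'h) measure)"
  unfolding trace_norm_def by (intro borel_measurable_suminf measurable_sing_num)

lemma measurable_weak_qnorm:
  "weak_qnorm \<in> borel_measurable (restrict_space
     (op_sigma :: ('h::{real_inner, complete_space, second_countable_topology} \<Rightarrow>\<^sub>L 'h) measure) weak_S1_0)"
  unfolding weak_qnorm_eq
  by (intro borel_measurable_cSUP borel_measurable_times measurable_const measurable_restrict_space1
      measurable_sing_num bdd_above_weak_S1_0) (auto simp: space_restrict_space)


section \<open>Quasi-normed operator spaces\<close>

text \<open>What the weak quasi-norm on \<^const>\<open>weak_S1_0\<close> and the trace norm on \<^const>\<open>trace_class\<close> have in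
common. The constant \<open>2\<close> in \<open>q_add\<close> is what halving the rank in Weyl's inequality gives in both
cases.\<close>

locale op_quasi_norm =
  fixes W :: "('h::{real_inner, banach, second_countable_topology} \<Rightarrow>\<^sub>L 'h) set"
    and q :: "('h \<Rightarrow>\<^sub>L 'h) \<Rightarrow> real"
  assumes fin_rank_mem: "fin_rank ps \<in> W"
    and add_mem: "A \<in> W \<Longrightarrow> B \<in> W \<Longrightarrow> A + B \<in> W"
    and uminus_mem: "A \<in> W \<Longrightarrow> - A \<in> W"
    and zero: "q 0 = 0"
    and q_uminus: "q (- A) = q A"
    and q_add: "A \<in> W \<Longrightarrow> B \<in> W \<Longrightarrow> q (A + B) \<le> 2 * (q A + q B)"
    and norm_le: "A \<in> W \<Longrightarrow> norm A \<le> q A"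
    and dense: "closure D = UNIV \<Longrightarrow> A \<in> W \<Longrightarrow> 0 < e \<Longrightarrow> \<exists>ps\<in>lists (D \<times> D). q (A - fin_rank ps) \<le> e"
    and measurable_q: "q \<in> borel_measurable (restrict_space op_sigma W)"
begin

lemma diff_mem: "A \<in> W \<Longrightarrow> B \<in> W \<Longrightarrow> A - B \<in> W"
  using add_mem[of A "- B"] uminus_mem by simp

lemma q_diff: "A \<in> W \<Longrightarrow> B \<in> W \<Longrightarrow> q (A - B) \<le> 2 * (q A + q B)"
  using q_add[of A "- B"] uminus_mem q_uminus by simp

lemma q_commute: "q (A - B) = q (B - A)"
  using q_uminus[of "A - B"] by simp

lemma q_triangle: "A \<in> W \<Longrightarrow> B \<in> W \<Longrightarrow> C \<in> W \<Longrightarrow> q (A - C) \<le> 2 * (q (A - B) + q (B - C))"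
  using q_add[of "A - B" "B - C"] diff_mem by simp

lemma q_nonneg: "A \<in> W \<Longrightarrow> 0 \<le> q A"
  using norm_le norm_ge_zero order_trans by blast

lemma measurable_q_compose:
  assumes "f \<in> N \<rightarrow>\<^sub>M op_sigma" "\<And>\<omega>. \<omega> \<in> space N \<Longrightarrow> f \<omega> \<in> W"
  shows "(\<lambda>\<omega>. q (f \<omega>)) \<in> borel_measurable N"
  using measurable_compose[OF measurable_restrict_space2[OF _ assms(1)] measurable_q] assms(2)
  by blast

text \<open>With a quasi-norm the balls \<open>q (b - l) < e\<close> need not be open. Their interiors \<open>U\<close> still contain the
centre: if a \<open>d\<close>-ball around \<open>b\<close> lies in the given ball, then so does a \<open>d/4\<close>-ball around
each point at distance less than \<open>d/4\<close> from \<open>b\<close>.\<close>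

lemma limitin_qnorm_topologyD:
  assumes lim: "limitin (qnorm_topology S q) f l G" and S: "S \<subseteq> W"
  shows "((\<lambda>x. q (f x - l)) \<longlongrightarrow> 0) G"
proof (rule tendstoI)
  fix e :: real assume e: "0 < e"
  define U where "U = {b \<in> S. \<exists>d>0. \<forall>c\<in>S. q (c - b) < d \<longrightarrow> q (c - l) < e}"
  have l: "l \<in> S" using lim limitin_topspace by fastforce
  have "openin (qnorm_topology S q) U"
    unfolding openin_qnorm_topology
  proof (intro conjI ballI)
    fix b assume "b \<in> U"
    then obtain d where b: "b \<in> S" "d > 0" "\<And>c. c \<in> S \<Longrightarrow> q (c - b) < d \<Longrightarrow> q (c - l) < e"
      by (auto simp: U_def)
    have "c \<in> U" if c: "c \<in> S" "q (c - b) < d / 4" for c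
    proof -
      have "q (c' - l) < e" if c': "c' \<in> S" "q (c' - c) < d / 4" for c'
      proof (rule b(3))
          have "c' \<in> W" "c \<in> W" "b \<in> W" using c c' b S by auto
          from q_triangle[OF this] show "q (c' - b) < d" using c c' by simp
        qed (rule c')
      then show ?thesis using c \<open>d > 0\<close> unfolding U_def by (auto intro!: exI[of _ "d / 4"])
    qed
    then show "\<exists>\<epsilon>>0. \<forall>c\<in>S. q (c - b) < \<epsilon> \<longrightarrow> c \<in> U"
      using \<open>d > 0\<close> by (intro exI[of _ "d / 4"]) auto
  qed (auto simp: U_def)
  moreover have "l \<in> U" using l e by (auto simp: U_def)
  ultimately have "eventually (\<lambda>x. f x \<in> U) G" using lim by (auto simp: limitin_def)
  then show "eventually (\<lambda>x. dist (q (f x - l)) 0 < e) G"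
  proof eventually_elim
    case (elim x)
    then have "f x \<in> S" "q (f x - l) < e" using zero by (auto simp: U_def)
    then show ?case using q_nonneg[of "f x - l"] diff_mem l S by (auto simp: subset_iff)
  qed
qed

lemma continuous_map_coefficient:
  assumes S: "S \<subseteq> W"
  shows "continuous_map (qnorm_topology S q) euclideanreal (\<lambda>A. A u \<bullet> v)"
  unfolding continuous_map_def
proof (intro conjI allI impI)
  fix V :: "real set" assume V: "openin euclideanreal V"
  show "openin (qnorm_topology S q) {A \<in> topspace (qnorm_topology S q). A u \<bullet> v \<in> V}"
    unfolding openin_qnorm_topology
  proof (intro conjI ballI)
    fix a assume a: "a \<in> {A \<in> topspace (qnorm_topology S q). A u \<bullet> v \<in> V}"
    then obtain e where e: "0 < e" "\<And>t. dist t (a u \<bullet> v) < e \<Longrightarrow> t \<in> V"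
      using V open_dist[of V] by auto
    have c: "0 < norm u * norm v + 1" by (simp add: add_nonneg_pos)
    show "\<exists>\<epsilon>>0. \<forall>b\<in>S. q (b - a) < \<epsilon> \<longrightarrow> b \<in> {A \<in> topspace (qnorm_topology S q). A u \<bullet> v \<in> V}"
    proof (intro exI[of _ "e / (norm u * norm v + 1)"] conjI ballI impI)
      fix b assume b: "b \<in> S" "q (b - a) < e / (norm u * norm v + 1)"
      have "dist (b u \<bullet> v) (a u \<bullet> v) = \<bar>(b - a) u \<bullet> v\<bar>"
        by (simp add: dist_real_def minus_blinfun.rep_eq inner_diff_left)
      also have "\<dots> \<le> norm ((b - a) u) * norm v" by (rule Cauchy_Schwarz_ineq2)
      also have "\<dots> \<le> norm (b - a) * norm u * norm v" by (intro mult_right_mono norm_blinfun) simp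
      also have "\<dots> = norm (b - a) * (norm u * norm v)" by simp
      also have "\<dots> \<le> norm (b - a) * (norm u * norm v + 1)" by (intro mult_left_mono) auto
      also have "\<dots> \<le> q (b - a) * (norm u * norm v + 1)"
        using a b S diff_mem c by (intro mult_right_mono norm_le) auto
      also have "\<dots> < e" using b c by (simp add: field_simps)
      finally show "b \<in> {A \<in> topspace (qnorm_topology S q). A u \<bullet> v \<in> V}"
        using b e by auto
    qed (use e c in auto)
  qed auto
qed simp

text \<open>Second countability. Closed balls are used because they are given by an inequality between
measurable functions; their centres range over countably many finite-rank operators, which may lie
outside \<open>S\<close>, and so the balls are intersected with \<open>S\<close>.\<close>

lemma qnorm_topology_base:
  assumes S: "S \<subseteq> W" and D: "closure D = UNIV" and U: "openin (qnorm_topology S q) U" and a: "a \<in> U"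
  shows "\<exists>ps\<in>lists (D \<times> D). \<exists>r\<in>\<rat>. a \<in> {b \<in> S. q (b - fin_rank ps) \<le> r} \<and>
    {b \<in> S. q (b - fin_rank ps) \<le> r} \<subseteq> U"
proof -
  obtain e where e: "0 < e" "\<And>b. b \<in> S \<Longrightarrow> q (b - a) < e \<Longrightarrow> b \<in> U"
    using U a unfolding openin_qnorm_topology by blast
  have aS: "a \<in> S" using U a openin_qnorm_topology by blast
  obtain r where r: "r \<in> \<rat>" "e / 8 < r" "r < e / 4"
    using Rats_dense_in_real[of "e / 8" "e / 4"] e(1) by auto
  obtain ps where ps: "ps \<in> lists (D \<times> D)" "q (a - fin_rank ps) \<le> e / 8"
    using dense[OF D, of a "e / 8"] aS S e(1) by auto
  have "b \<in> U" if b: "b \<in> S" "q (b - fin_rank ps) \<le> r" for b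
  proof (rule e(2))
    have "b \<in> W" "a \<in> W" using b aS S by auto
    from q_triangle[OF this(1) fin_rank_mem[of ps] this(2)]
    show "q (b - a) < e" using q_commute[of a "fin_rank ps"] b ps r by simp
  qed (rule b)
  then show ?thesis using ps r aS by (intro bexI[of _ ps] bexI[of _ r]) auto
qed

lemma qball_measurable:
  "\<exists>E\<in>sets op_sigma. {b \<in> W. q (b - fin_rank ps) \<le> r} = W \<inter> E"
proof -
  have "(\<lambda>A. q (A - fin_rank ps)) \<in> borel_measurable (restrict_space op_sigma W)"
    by (intro measurable_q_compose measurable_op_sigma_diff measurable_op_sigma_const
        measurable_restrict_space1 measurable_ident_sets)
      (auto simp: space_restrict_space diff_mem fin_rank_mem)
  then have "{b \<in> space (restrict_space op_sigma W). q (b - fin_rank ps) \<le> r} \<in> sets (restrict_space op_sigma W)"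
    by measurable
  then show ?thesis by (auto simp: sets_restrict_space space_restrict_space)
qed

end

interpretation weak: op_quasi_norm weak_S1_0 weak_qnorm
proof
  show "weak_qnorm 0 = 0"
    by (simp add: weak_qnorm_eq sing_num_eq_0[OF rank_less_0])
  show "weak_qnorm (- A) = weak_qnorm A" for A :: "'a \<Rightarrow>\<^sub>L 'a"
    by (simp add: weak_qnorm_eq sing_num_uminus)
qed (fact fin_rank_weak_S1_0 weak_S1_0_add weak_S1_0_uminus weak_qnorm_add_le norm_le_weak_qnorm
  weak_qnorm_dense measurable_weak_qnorm)+

interpretation trace: op_quasi_norm trace_class trace_norm
proof
  show "trace_norm 0 = 0"
    by (simp add: trace_norm_def sing_num_eq_0[OF rank_less_0])
  show "trace_norm (- A) = trace_norm A" for A :: "'a \<Rightarrow>\<^sub>L 'a"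
    by (simp add: trace_norm_def sing_num_uminus)
  show "trace_norm \<in> borel_measurable (restrict_space (op_sigma :: ('a \<Rightarrow>\<^sub>L 'a) measure) trace_class)"
    by (intro measurable_restrict_space1 measurable_trace_norm)
qed (fact fin_rank_trace_class trace_class_add trace_class_uminus trace_norm_add_le
  norm_le_trace_norm trace_norm_dense)+


section \<open>Measurability and continuity in the critical group\<close>

abbreviation (input) weak_skew :: "('h::real_inner \<Rightarrow>\<^sub>L 'h) set"
  where "weak_skew \<equiv> {A \<in> weak_S1_0. skew_op A}"

abbreviation (input) trace_sa :: "('h::real_inner \<Rightarrow>\<^sub>L 'h) set"
  where "trace_sa \<equiv> {A \<in> trace_class. selfadj_op A}"

lemma mem_crit_iff:
  "p \<in> topspace crit_topology \<longleftrightarrow> fst (snd p) \<in> weak_S1_0 \<and> skew_op (fst (snd p)) \<and>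
    snd (snd p) \<in> trace_class \<and> selfadj_op (snd (snd p))"
  by (cases p) (simp add: topspace_crit_topology)

text \<open>The Borel structure of the critical group is that of matrix coefficients: an open set is a
countable union of boxes of a countable base, and each box is cut out by conditions that are
measurable for \<^const>\<open>op_sigma\<close>.\<close>

lemma open_crit_trace:
  fixes U :: "'h::{real_inner, banach, second_countable_topology} crit set"
  assumes U: "openin crit_topology U"
  shows "\<exists>E\<in>sets (borel \<Otimes>\<^sub>M op_sigma \<Otimes>\<^sub>M op_sigma). U = topspace crit_topology \<inter> E"
proof -
  obtain D :: "'h set" where D: "countable D" "closure D = UNIV" using countable_dense .
  obtain B :: "'h set set" where B: "countable B" "topological_basis B"
    using ex_countable_basis by blast
  define wball :: "('h \<times> 'h) list \<Rightarrow> real \<Rightarrow> ('h \<Rightarrow>\<^sub>L 'h) set"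
    where "wball ps r = {b \<in> weak_skew. weak_qnorm (b - fin_rank ps) \<le> r}" for ps r
  define tball :: "('h \<times> 'h) list \<Rightarrow> real \<Rightarrow> ('h \<Rightarrow>\<^sub>L 'h) set"
    where "tball ps r = {b \<in> trace_sa. trace_norm (b - fin_rank ps) \<le> r}" for ps r
  define K where "K = B \<times> lists (D \<times> D) \<times> (\<rat> :: real set) \<times> lists (D \<times> D) \<times> (\<rat> :: real set)"
  define box :: "'h set \<times> ('h \<times> 'h) list \<times> real \<times> ('h \<times> 'h) list \<times> real \<Rightarrow> 'h crit set"
    where "box = (\<lambda>(V, ps, r, qs, r'). V \<times> wball ps r \<times> tball qs r')"
  have K: "countable K"
    unfolding K_def using B(1) D(1) by (intro countable_SIGMA countable_lists countable_rat)
  have "\<exists>E\<in>sets (borel \<Otimes>\<^sub>M op_sigma \<Otimes>\<^sub>M op_sigma). box k = topspace crit_topology \<inter> E" if "k \<in> K" for k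
  proof -
    obtain V ps r qs r' where k: "k = (V, ps, r, qs, r')" by (rule prod_cases5)
    have V: "V \<in> sets borel"
      using that topological_basis_open[OF B(2)] by (auto simp: k K_def)
    obtain E1 where E1: "E1 \<in> sets op_sigma" "{b \<in> weak_S1_0. weak_qnorm (b - fin_rank ps) \<le> r} = weak_S1_0 \<inter> E1"
      using weak.qball_measurable by blast
    obtain E2 where E2: "E2 \<in> sets op_sigma" "{b \<in> trace_class. trace_norm (b - fin_rank qs) \<le> r'} = trace_class \<inter> E2"
      using trace.qball_measurable by blast
    have "box k = topspace crit_topology \<inter> (V \<times> E1 \<times> E2)"
      using E1(2) E2(2) by (auto simp: box_def k wball_def tball_def topspace_crit_topology)
    then show ?thesis using V E1(1) E2(1) by (intro bexI[of _ "V \<times> E1 \<times> E2"]) auto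
  qed
  then obtain E where E: "\<And>k. k \<in> K \<Longrightarrow> E k \<in> sets (borel \<Otimes>\<^sub>M op_sigma \<Otimes>\<^sub>M op_sigma)"
    "\<And>k. k \<in> K \<Longrightarrow> box k = topspace crit_topology \<inter> E k" by metis
  have "\<exists>k\<in>K. p \<in> box k \<and> box k \<subseteq> U" if "p \<in> U" for p
  proof -
    obtain x a b where p: "p = (x, a, b)" by (rule prod_cases3)
    have "\<forall>x y. (x, y) \<in> U \<longrightarrow> (\<exists>U1 U2. openin euclidean U1 \<and>
        openin (prod_topology (qnorm_topology weak_skew weak_qnorm) (qnorm_topology trace_sa trace_norm)) U2
        \<and> x \<in> U1 \<and> y \<in> U2 \<and> U1 \<times> U2 \<subseteq> U)"
      using U unfolding crit_topology_def by (rule openin_prod_topology_alt[THEN iffD1])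
    from this[rule_format, OF \<open>p \<in> U\<close>[unfolded p]] obtain U1 U2 where U12: "openin euclidean U1"
      "openin (prod_topology (qnorm_topology weak_skew weak_qnorm) (qnorm_topology trace_sa trace_norm)) U2"
      "x \<in> U1" "(a, b) \<in> U2" "U1 \<times> U2 \<subseteq> U" by (elim exE conjE)
    from openin_prod_topology_alt[THEN iffD1, OF U12(2), rule_format, OF U12(4)]
    obtain U3 U4 where U34: "openin (qnorm_topology weak_skew weak_qnorm) U3"
      "openin (qnorm_topology trace_sa trace_norm) U4" "a \<in> U3" "b \<in> U4" "U3 \<times> U4 \<subseteq> U2"
      by (elim exE conjE)
    have "open U1" using U12(1) by simp
    obtain V where V: "V \<in> B" "x \<in> V" "V \<subseteq> U1"
      using topological_basisE[OF B(2) \<open>open U1\<close> U12(3)] by blast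
    obtain ps r where ps: "ps \<in> lists (D \<times> D)" "r \<in> \<rat>" "a \<in> wball ps r" "wball ps r \<subseteq> U3"
      using weak.qnorm_topology_base[OF _ D(2) U34(1,3)] unfolding wball_def by auto
    obtain qs r' where qs: "qs \<in> lists (D \<times> D)" "r' \<in> \<rat>" "b \<in> tball qs r'" "tball qs r' \<subseteq> U4"
      using trace.qnorm_topology_base[OF _ D(2) U34(2,4)] unfolding tball_def by auto
    have "(V, ps, r, qs, r') \<in> K" using V ps qs by (simp add: K_def)
    moreover have "p \<in> box (V, ps, r, qs, r')" using V ps qs by (simp add: box_def p)
    moreover have "box (V, ps, r, qs, r') \<subseteq> U"
    proof -
      have "V \<times> wball ps r \<times> tball qs r' \<subseteq> U1 \<times> U3 \<times> U4"
        using V(3) ps(4) qs(4) by (intro Sigma_mono)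
      also have "\<dots> \<subseteq> U1 \<times> U2" using U34(5) by (intro Sigma_mono order_refl)
      finally show ?thesis using U12(5) by (simp add: box_def)
    qed
    ultimately show ?thesis by blast
  qed
  then have "U = (\<Union>k\<in>{k \<in> K. box k \<subseteq> U}. box k)" by blast
  also have "\<dots> = topspace crit_topology \<inter> (\<Union>k\<in>{k \<in> K. box k \<subseteq> U}. E k)"
    using E(2) by auto
  finally show ?thesis
    using E(1) K by (intro bexI[of _ "\<Union>k\<in>{k \<in> K. box k \<subseteq> U}. E k"] sets.countable_UN'')
      (auto intro: countable_Collect)
qed

lemma space_crit_borel: "space crit_borel = topspace crit_topology"
  unfolding crit_borel_def by (rule space_measure_of) (auto dest: openin_subset)

text \<open>The criterion through which all measurability statements about group-valued random variables are
reduced to real-valued ones.\<close>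

lemma measurable_crit_borelI:
  fixes f :: "'a \<Rightarrow> 'h::{real_inner, banach, second_countable_topology} crit"
  assumes "\<And>\<omega>. \<omega> \<in> space N \<Longrightarrow> f \<omega> \<in> topspace crit_topology"
    and "(\<lambda>\<omega>. fst (f \<omega>)) \<in> N \<rightarrow>\<^sub>M borel"
    and "(\<lambda>\<omega>. fst (snd (f \<omega>))) \<in> N \<rightarrow>\<^sub>M op_sigma"
    and "(\<lambda>\<omega>. snd (snd (f \<omega>))) \<in> N \<rightarrow>\<^sub>M op_sigma"
  shows "f \<in> N \<rightarrow>\<^sub>M crit_borel"
  unfolding crit_borel_def
proof (rule measurable_measure_of)
  fix U :: "'h crit set" assume "U \<in> {U. openin crit_topology U}"
  then obtain E where E: "E \<in> sets (borel \<Otimes>\<^sub>M op_sigma \<Otimes>\<^sub>M op_sigma)" "U = topspace crit_topology \<inter> E"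
    using open_crit_trace by blast
  have "(\<lambda>\<omega>. (fst (f \<omega>), fst (snd (f \<omega>)), snd (snd (f \<omega>)))) \<in> N \<rightarrow>\<^sub>M borel \<Otimes>\<^sub>M op_sigma \<Otimes>\<^sub>M op_sigma"
    using assms(2-4) by (intro measurable_Pair)
  then have "f \<in> N \<rightarrow>\<^sub>M borel \<Otimes>\<^sub>M op_sigma \<Otimes>\<^sub>M op_sigma" by simp
  from measurable_sets[OF this E(1)] have "f -` E \<inter> space N \<in> sets N" .
  moreover have "f -` U \<inter> space N = f -` E \<inter> space N" using assms(1) E(2) by auto
  ultimately show "f -` U \<inter> space N \<in> sets N" by simp
qed (use assms(1) in \<open>auto dest: openin_subset\<close>)

lemma measurable_crit_borel_continuous:
  assumes "continuous_map crit_topology euclidean f"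
  shows "f \<in> crit_borel \<rightarrow>\<^sub>M borel"
proof (rule borel_measurableI)
  fix S :: "'b set" assume "open S"
  then have "openin crit_topology {p \<in> topspace crit_topology. f p \<in> S}"
    using assms by (intro openin_continuous_map_preimage) auto
  then have "{p \<in> topspace crit_topology. f p \<in> S} \<in> sets crit_borel"
    unfolding crit_borel_def by (subst sets_measure_of) (auto dest: openin_subset)
  moreover have "f -` S \<inter> space crit_borel = {p \<in> topspace crit_topology. f p \<in> S}"
    by (auto simp: space_crit_borel)
  ultimately show "f -` S \<inter> space crit_borel \<in> sets crit_borel" by simp
qed

lemma measurable_crit_fst: "fst \<in> crit_borel \<rightarrow>\<^sub>M borel"
  by (intro measurable_crit_borel_continuous) (auto simp: crit_topology_def continuous_map_fst)

lemma continuous_map_crit_coefficients: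
  fixes u v :: "'h::{real_inner, banach, second_countable_topology}"
  shows "continuous_map crit_topology euclideanreal (\<lambda>p::'h crit. blinfun_apply (fst (snd p)) u \<bullet> v)"
    and "continuous_map crit_topology euclideanreal (\<lambda>p::'h crit. blinfun_apply (snd (snd p)) u \<bullet> v)"
proof -
  have A: "continuous_map crit_topology (qnorm_topology weak_skew weak_qnorm) (\<lambda>p::'h crit. fst (snd p))"
    unfolding crit_topology_def
    using continuous_map_compose[OF continuous_map_snd continuous_map_fst] by (simp add: o_def)
  from continuous_map_compose[OF this weak.continuous_map_coefficient[of _ u v]]
  show "continuous_map crit_topology euclideanreal (\<lambda>p::'h crit. blinfun_apply (fst (snd p)) u \<bullet> v)"
    by (auto simp: o_def)
  have Q: "continuous_map crit_topology (qnorm_topology trace_sa trace_norm) (\<lambda>p::'h crit. snd (snd p))"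
    unfolding crit_topology_def
    using continuous_map_compose[OF continuous_map_snd continuous_map_snd] by (simp add: o_def)
  from continuous_map_compose[OF this trace.continuous_map_coefficient[of _ u v]]
  show "continuous_map crit_topology euclideanreal (\<lambda>p::'h crit. blinfun_apply (snd (snd p)) u \<bullet> v)"
    by (auto simp: o_def)
qed

lemma measurable_crit_area:
  "(\<lambda>p. fst (snd p)) \<in> (crit_borel :: 'h::{real_inner, banach, second_countable_topology} crit measure) \<rightarrow>\<^sub>M op_sigma"
  unfolding measurable_op_sigma_iff
  by (intro allI measurable_crit_borel_continuous continuous_map_crit_coefficients)

lemma measurable_crit_bracket:
  "(\<lambda>p. snd (snd p)) \<in> (crit_borel :: 'h::{real_inner, banach, second_countable_topology} crit measure) \<rightarrow>\<^sub>M op_sigma"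
  unfolding measurable_op_sigma_iff
  by (intro allI measurable_crit_borel_continuous continuous_map_crit_coefficients)

lemma crit_dist_eq:
  "crit_dist p p' = norm (fst p - fst p') + weak_qnorm (fst (snd p) - fst (snd p'))
     + trace_norm (snd (snd p) - snd (snd p'))"
  by (cases p; cases p') simp

lemma measurable_crit_dist:
  fixes f g :: "'a \<Rightarrow> 'h::{real_inner, banach, second_countable_topology} crit"
  assumes f: "f \<in> N \<rightarrow>\<^sub>M crit_borel" and g: "g \<in> N \<rightarrow>\<^sub>M crit_borel"
  shows "(\<lambda>\<omega>. crit_dist (f \<omega>) (g \<omega>)) \<in> borel_measurable N"
  unfolding crit_dist_eq
proof (intro borel_measurable_add)
  have mem: "f \<omega> \<in> topspace crit_topology" "g \<omega> \<in> topspace crit_topology" if "\<omega> \<in> space N" for \<omega>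
    using measurable_space[OF f that] measurable_space[OF g that] by (simp_all add: space_crit_borel)
  show "(\<lambda>\<omega>. norm (fst (f \<omega>) - fst (g \<omega>))) \<in> borel_measurable N"
    by (intro measurable_compose[OF _ borel_measurable_norm] borel_measurable_diff measurable_compose[OF f measurable_crit_fst]
        measurable_compose[OF g measurable_crit_fst])
  show "(\<lambda>\<omega>. weak_qnorm (fst (snd (f \<omega>)) - fst (snd (g \<omega>)))) \<in> borel_measurable N"
    by (intro weak.measurable_q_compose measurable_op_sigma_diff
        measurable_compose[OF f measurable_crit_area] measurable_compose[OF g measurable_crit_area])
      (use mem in \<open>auto simp: mem_crit_iff intro: weak.diff_mem\<close>)
  show "(\<lambda>\<omega>. trace_norm (snd (snd (f \<omega>)) - snd (snd (g \<omega>)))) \<in> borel_measurable N"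
    by (intro trace.measurable_q_compose measurable_op_sigma_diff
        measurable_compose[OF f measurable_crit_bracket] measurable_compose[OF g measurable_crit_bracket])
      (use mem in \<open>auto simp: mem_crit_iff intro: trace.diff_mem\<close>)
qed

lemma norms_le_crit_dist:
  fixes p p' :: "'h::{real_inner, banach, second_countable_topology} crit"
  assumes "p \<in> topspace crit_topology" "p' \<in> topspace crit_topology"
  shows "norm (fst p - fst p') + norm (fst (snd p) - fst (snd p'))
     + norm (snd (snd p) - snd (snd p')) \<le> crit_dist p p'"
  unfolding crit_dist_eq using assms
  by (intro add_mono weak.norm_le trace.norm_le weak.diff_mem trace.diff_mem)
    (auto simp: mem_crit_iff)

lemma limitin_crit_topologyD:
  fixes f :: "'a \<Rightarrow> 'h::{real_inner, banach, second_countable_topology} crit"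
  assumes "limitin crit_topology f l G"
  shows "((\<lambda>x. fst (f x)) \<longlongrightarrow> fst l) G"
    and "((\<lambda>x. weak_qnorm (fst (snd (f x)) - fst (snd l))) \<longlongrightarrow> 0) G"
    and "((\<lambda>x. trace_norm (snd (snd (f x)) - snd (snd l))) \<longlongrightarrow> 0) G"
proof -
  have "limitin euclidean (fst \<circ> f) (fst l) G"
    and A: "limitin (qnorm_topology weak_skew weak_qnorm) (fst \<circ> (snd \<circ> f)) (fst (snd l)) G"
    and Q: "limitin (qnorm_topology trace_sa trace_norm) (snd \<circ> (snd \<circ> f)) (snd (snd l)) G"
    using assms unfolding crit_topology_def limitin_pairwise by auto
  then show "((\<lambda>x. fst (f x)) \<longlongrightarrow> fst l) G" by (simp add: o_def)
  show "((\<lambda>x. weak_qnorm (fst (snd (f x)) - fst (snd l))) \<longlongrightarrow> 0) G"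
    using weak.limitin_qnorm_topologyD[OF A] by (auto simp: o_def)
  show "((\<lambda>x. trace_norm (snd (snd (f x)) - snd (snd l))) \<longlongrightarrow> 0) G"
    using trace.limitin_qnorm_topologyD[OF Q] by (auto simp: o_def)
qed

lemma wedge_op_simps:
  "(x + x') \<and>\<^sub>o y = x \<and>\<^sub>o y + x' \<and>\<^sub>o y" "(x - x') \<and>\<^sub>o y = x \<and>\<^sub>o y - x' \<and>\<^sub>o y" "(- x) \<and>\<^sub>o y = - (x \<and>\<^sub>o y)"
  "(c *\<^sub>R x) \<and>\<^sub>o y = c *\<^sub>R (x \<and>\<^sub>o y)" "x \<and>\<^sub>o (y + y') = x \<and>\<^sub>o y + x \<and>\<^sub>o y'" "x \<and>\<^sub>o (y - y') = x \<and>\<^sub>o y - x \<and>\<^sub>o y'"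
  "x \<and>\<^sub>o x = 0"
  by (simp_all add: wedge_op_def tensor_op_add_left tensor_op_add_right tensor_op_diff_left
      tensor_op_diff_right tensor_op_minus_left tensor_op_minus_right tensor_op_scaleR_left
      tensor_op_scaleR_right scaleR_diff_right)

lemma wedge_mem_weak_S1_0: "x \<and>\<^sub>o y \<in> weak_S1_0"
  using weak_S1_0_add[OF fin_rank_weak_S1_0[of "[(x, y)]"] weak_S1_0_uminus[OF fin_rank_weak_S1_0[of "[(y, x)]"]]]
  by (simp add: wedge_op_def)

lemma weak_qnorm_wedge_le:
  fixes x y :: "'h::{real_inner, banach, second_countable_topology}"
  shows "weak_qnorm (x \<and>\<^sub>o y) \<le> 4 * norm x * norm y"
proof -
  have "weak_qnorm (x \<otimes>\<^sub>o y - y \<otimes>\<^sub>o x) \<le> 2 * (weak_qnorm (x \<otimes>\<^sub>o y) + weak_qnorm (y \<otimes>\<^sub>o x))"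
    using fin_rank_weak_S1_0[of "[(x, y)]"] fin_rank_weak_S1_0[of "[(y, x)]"]
    by (intro weak.q_diff) simp_all
  also have "\<dots> \<le> 2 * (norm x * norm y + norm y * norm x)"
    by (intro mult_left_mono add_mono weak_qnorm_tensor_le) simp
  finally show ?thesis by (simp add: wedge_op_def algebra_simps)
qed

lemma skew_op_diff: "skew_op A \<Longrightarrow> skew_op B \<Longrightarrow> skew_op (A - B)"
  by (simp add: skew_op_def minus_blinfun.rep_eq inner_diff_left inner_diff_right)

lemma selfadj_op_diff: "selfadj_op A \<Longrightarrow> selfadj_op B \<Longrightarrow> selfadj_op (A - B)"
  by (simp add: selfadj_op_def minus_blinfun.rep_eq inner_diff_left inner_diff_right)

lemma skew_op_wedge: "skew_op (x \<and>\<^sub>o y)"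
  by (simp add: skew_op_def wedge_op_def minus_blinfun.rep_eq tensor_op.rep_eq inner_diff_left
      inner_diff_right inner_commute)

text \<open>The factor \<open>1/2\<close> is kept inside the wedge, so that norm estimates for wedges apply directly.\<close>

lemma crit_increment_eq:
  "crit_inv p \<circ>\<^sub>G p' = (fst p' - fst p,
     fst (snd p') - fst (snd p) - ((1/2) *\<^sub>R fst p) \<and>\<^sub>o fst p', snd (snd p') - snd (snd p))"
  by (cases p; cases p') (simp add: wedge_op_simps)

lemma crit_increment_mem:
  fixes p p' :: "'h::{real_inner, banach, second_countable_topology} crit"
  assumes "p \<in> topspace crit_topology" "p' \<in> topspace crit_topology"
  shows "crit_inv p \<circ>\<^sub>G p' \<in> topspace crit_topology"
proof -
  show ?thesis
    using assms unfolding crit_increment_eq mem_crit_iff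
    by (auto intro!: weak.diff_mem trace.diff_mem wedge_mem_weak_S1_0 skew_op_wedge
        skew_op_diff selfadj_op_diff)
qed

text \<open>Applied at each \<open>\<omega>\<close>, this gives the multiplicativity of the stopped character simultaneously for
all stopping times.\<close>

lemma crit_increment_mult:
  "(crit_inv p \<circ>\<^sub>G p') \<circ>\<^sub>G (crit_inv p' \<circ>\<^sub>G p'') = crit_inv p \<circ>\<^sub>G p''"
  unfolding crit_increment_eq
  by (simp add: wedge_op_simps scaleR_diff_right scaleR_add_right)

lemma measurable_crit_increment:
  fixes f g :: "'a \<Rightarrow> 'h::{real_inner, banach, second_countable_topology} crit"
  assumes f: "\<And>\<omega>. \<omega> \<in> space N \<Longrightarrow> f \<omega> \<in> topspace crit_topology"
      "(\<lambda>\<omega>. fst (f \<omega>)) \<in> N \<rightarrow>\<^sub>M borel" "(\<lambda>\<omega>. fst (snd (f \<omega>))) \<in> N \<rightarrow>\<^sub>M op_sigma"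
      "(\<lambda>\<omega>. snd (snd (f \<omega>))) \<in> N \<rightarrow>\<^sub>M op_sigma"
    and g: "\<And>\<omega>. \<omega> \<in> space N \<Longrightarrow> g \<omega> \<in> topspace crit_topology"
      "(\<lambda>\<omega>. fst (g \<omega>)) \<in> N \<rightarrow>\<^sub>M borel" "(\<lambda>\<omega>. fst (snd (g \<omega>))) \<in> N \<rightarrow>\<^sub>M op_sigma"
      "(\<lambda>\<omega>. snd (snd (g \<omega>))) \<in> N \<rightarrow>\<^sub>M op_sigma"
  shows "(\<lambda>\<omega>. crit_inv (f \<omega>) \<circ>\<^sub>G g \<omega>) \<in> N \<rightarrow>\<^sub>M crit_borel"
proof (rule measurable_crit_borelI)
  show "crit_inv (f \<omega>) \<circ>\<^sub>G g \<omega> \<in> topspace crit_topology" if "\<omega> \<in> space N" for \<omega>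
    using that f(1) g(1) by (intro crit_increment_mem)
  show "(\<lambda>\<omega>. fst (crit_inv (f \<omega>) \<circ>\<^sub>G g \<omega>)) \<in> N \<rightarrow>\<^sub>M borel"
    unfolding crit_increment_eq fst_conv using f g by (intro borel_measurable_diff)
  show "(\<lambda>\<omega>. fst (snd (crit_inv (f \<omega>) \<circ>\<^sub>G g \<omega>))) \<in> N \<rightarrow>\<^sub>M op_sigma"
    unfolding crit_increment_eq fst_conv snd_conv wedge_op_def using f g
    by (intro measurable_op_sigma_diff measurable_op_sigma_tensor borel_measurable_scaleR
        borel_measurable_const)
  show "(\<lambda>\<omega>. snd (snd (crit_inv (f \<omega>) \<circ>\<^sub>G g \<omega>))) \<in> N \<rightarrow>\<^sub>M op_sigma"
    unfolding crit_increment_eq snd_conv using f g by (intro measurable_op_sigma_diff)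
qed

lemma quasi_triangle_combine:
  fixes a b c d e f g h i :: real
  assumes "a \<le> 2 * (b + c)" "b \<le> 2 * (d + e)" "c \<le> 2 * (f + g)" "f \<le> h" "g \<le> i"
  shows "a \<le> 4 * (d + e) + 4 * (h + i)"
  using assms by argo

text \<open>Continuity of \<open>(p, p') \<mapsto> p\<^sup>-\<^sup>1 \<circ> p'\<close>. Only the wedge needs care:
\<open>x\<^sub>n \<and> y\<^sub>n - x \<and> y = (x\<^sub>n - x) \<and> y\<^sub>n + x \<and> (y\<^sub>n - y)\<close>, and \<open>x \<and> y\<close> has weak quasi-norm at most
\<open>4 |x| |y|\<close>.\<close>

lemma crit_dist_increment_tendsto:
  fixes f g :: "'a \<Rightarrow> 'h::{real_inner, banach, second_countable_topology} crit"
  assumes f: "limitin crit_topology f p G" and g: "limitin crit_topology g p' G"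
    and mem: "\<And>x. f x \<in> topspace crit_topology" "\<And>x. g x \<in> topspace crit_topology"
  shows "((\<lambda>x. crit_dist (crit_inv (f x) \<circ>\<^sub>G g x) (crit_inv p \<circ>\<^sub>G p')) \<longlongrightarrow> 0) G"
proof -
  note f' = limitin_crit_topologyD[OF f] and g' = limitin_crit_topologyD[OF g]
  have memp: "p \<in> topspace crit_topology" "p' \<in> topspace crit_topology"
    by (rule limitin_topspace[OF f], rule limitin_topspace[OF g])
  have 1: "((\<lambda>x. norm ((fst (g x) - fst (f x)) - (fst p' - fst p))) \<longlongrightarrow> 0) G"
    using LIM_zero[OF tendsto_diff[OF g'(1) f'(1)]] by (rule tendsto_norm_zero)
  let ?x = "\<lambda>x. (1/2) *\<^sub>R (fst (f x) - fst p)"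
  let ?bound = "\<lambda>x. 4 * (weak_qnorm (fst (snd (g x)) - fst (snd p')) + weak_qnorm (fst (snd (f x)) - fst (snd p)))
      + 4 * (4 * norm (?x x) * norm (fst (g x)) + 4 * norm ((1/2) *\<^sub>R fst p) * norm (fst (g x) - fst p'))"
  have 2: "((\<lambda>x. weak_qnorm ((fst (snd (g x)) - fst (snd (f x)) - ((1/2) *\<^sub>R fst (f x)) \<and>\<^sub>o fst (g x))
      - (fst (snd p') - fst (snd p) - ((1/2) *\<^sub>R fst p) \<and>\<^sub>o fst p'))) \<longlongrightarrow> 0) G"
  proof (rule tendsto_sandwich[of "\<lambda>_. 0" _ _ ?bound])
    have "(?bound \<longlongrightarrow> 4 * (0 + 0) + 4 * (4 * norm ((1/2) *\<^sub>R (fst p - fst p)) * norm (fst p')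
        + 4 * norm ((1/2) *\<^sub>R fst p) * norm (fst p' - fst p'))) G"
      by (intro tendsto_intros f' g')
    then show "(?bound \<longlongrightarrow> 0) G" by simp
    show "\<forall>\<^sub>F x in G. weak_qnorm ((fst (snd (g x)) - fst (snd (f x)) - ((1/2) *\<^sub>R fst (f x)) \<and>\<^sub>o fst (g x))
      - (fst (snd p') - fst (snd p) - ((1/2) *\<^sub>R fst p) \<and>\<^sub>o fst p')) \<le> ?bound x"
    proof (rule always_eventually, rule allI)
      fix x
      let ?B = "fst (snd (g x)) - fst (snd p')" and ?A = "fst (snd (f x)) - fst (snd p)"
      let ?w1 = "?x x \<and>\<^sub>o fst (g x)" and ?w2 = "((1/2) *\<^sub>R fst p) \<and>\<^sub>o (fst (g x) - fst p')"
      have AB: "?B \<in> weak_S1_0" "?A \<in> weak_S1_0"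
        using mem[of x] memp by (auto simp: mem_crit_iff intro: weak.diff_mem)
      have w: "?w1 \<in> weak_S1_0" "?w2 \<in> weak_S1_0" by (rule wedge_mem_weak_S1_0)+
      have "(fst (snd (g x)) - fst (snd (f x)) - ((1/2) *\<^sub>R fst (f x)) \<and>\<^sub>o fst (g x))
          - (fst (snd p') - fst (snd p) - ((1/2) *\<^sub>R fst p) \<and>\<^sub>o fst p') = (?B - ?A) - (?w1 + ?w2)"
        by (simp add: wedge_op_simps scaleR_diff_right)
      also have "weak_qnorm \<dots> \<le> 2 * (weak_qnorm (?B - ?A) + weak_qnorm (?w1 + ?w2))"
        by (intro weak.q_diff weak.diff_mem weak.add_mem AB w)
      finally show "weak_qnorm ((fst (snd (g x)) - fst (snd (f x)) - ((1/2) *\<^sub>R fst (f x)) \<and>\<^sub>o fst (g x))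
          - (fst (snd p') - fst (snd p) - ((1/2) *\<^sub>R fst p) \<and>\<^sub>o fst p')) \<le> ?bound x"
        by (rule quasi_triangle_combine[OF _ weak.q_diff[OF AB] weak.q_add[OF w] weak_qnorm_wedge_le weak_qnorm_wedge_le])
    qed
    show "\<forall>\<^sub>F x in G. 0 \<le> weak_qnorm ((fst (snd (g x)) - fst (snd (f x)) - ((1/2) *\<^sub>R fst (f x)) \<and>\<^sub>o fst (g x))
      - (fst (snd p') - fst (snd p) - ((1/2) *\<^sub>R fst p) \<and>\<^sub>o fst p'))"
      by (intro always_eventually allI weak.q_nonneg weak.diff_mem wedge_mem_weak_S1_0)
        (use mem memp in \<open>auto simp: mem_crit_iff\<close>)
  qed simp
  have 3: "((\<lambda>x. trace_norm ((snd (snd (g x)) - snd (snd (f x))) - (snd (snd p') - snd (snd p)))) \<longlongrightarrow> 0) G"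
  proof (rule tendsto_sandwich[of "\<lambda>_. 0" _ _
        "\<lambda>x. 2 * (trace_norm (snd (snd (g x)) - snd (snd p')) + trace_norm (snd (snd (f x)) - snd (snd p)))"])
    have "((\<lambda>x. 2 * (trace_norm (snd (snd (g x)) - snd (snd p')) + trace_norm (snd (snd (f x)) - snd (snd p))))
        \<longlongrightarrow> 2 * (0 + 0)) G" by (intro tendsto_intros f' g')
    then show "((\<lambda>x. 2 * (trace_norm (snd (snd (g x)) - snd (snd p')) + trace_norm (snd (snd (f x)) - snd (snd p))))
        \<longlongrightarrow> 0) G" by simp
    have "trace_norm ((snd (snd (g x)) - snd (snd (f x))) - (snd (snd p') - snd (snd p)))
        \<le> 2 * (trace_norm (snd (snd (g x)) - snd (snd p')) + trace_norm (snd (snd (f x)) - snd (snd p)))" for x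
      using trace.q_diff[of "snd (snd (g x)) - snd (snd p')" "snd (snd (f x)) - snd (snd p)"] mem[of x] memp
      by (auto simp: mem_crit_iff trace.diff_mem algebra_simps)
    then show "\<forall>\<^sub>F x in G. trace_norm ((snd (snd (g x)) - snd (snd (f x))) - (snd (snd p') - snd (snd p)))
        \<le> 2 * (trace_norm (snd (snd (g x)) - snd (snd p')) + trace_norm (snd (snd (f x)) - snd (snd p)))"
      by simp
    show "\<forall>\<^sub>F x in G. 0 \<le> trace_norm ((snd (snd (g x)) - snd (snd (f x))) - (snd (snd p') - snd (snd p)))"
      by (intro always_eventually allI trace.q_nonneg trace.diff_mem)
        (use mem memp in \<open>auto simp: mem_crit_iff\<close>)
  qed simp
  show ?thesis
    unfolding crit_dist_eq crit_increment_eq fst_conv snd_conv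
    using tendsto_add[OF tendsto_add[OF 1 2] 3] by simp
qed


section \<open>Right-dyadic approximation of times\<close>

lemma right_dyadic_ge:
  assumes "T > 0"
  shows "r \<le> right_dyadic T n r"
proof -
  have "2 ^ n * r / T \<le> of_int \<lceil>2 ^ n * r / T\<rceil>" by (rule le_of_int_ceiling)
  then have "T * (1/2) ^ n * (2 ^ n * r / T) \<le> right_dyadic T n r"
    unfolding right_dyadic_def using assms by (intro mult_left_mono) auto
  then show ?thesis using assms by (simp add: power_one_over field_simps)
qed

lemma right_dyadic_le_add:
  assumes "T > 0"
  shows "right_dyadic T n r \<le> r + T * (1/2) ^ n"
proof -
  have "of_int \<lceil>2 ^ n * r / T\<rceil> \<le> 2 ^ n * r / T + 1" by linarith
  then have "right_dyadic T n r \<le> T * (1/2) ^ n * (2 ^ n * r / T + 1)"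
    unfolding right_dyadic_def using assms by (intro mult_left_mono) auto
  also have "\<dots> = r + T * (1/2) ^ n" using assms by (simp add: power_one_over field_simps)
  finally show ?thesis .
qed

lemma right_dyadic_mono:
  assumes "T > 0" "r \<le> s"
  shows "right_dyadic T n r \<le> right_dyadic T n s"
proof -
  have "2 ^ n * r / T \<le> 2 ^ n * s / T" using assms by (intro divide_right_mono mult_left_mono) auto
  then have "\<lceil>2 ^ n * r / T\<rceil> \<le> \<lceil>2 ^ n * s / T\<rceil>" by (rule ceiling_mono)
  then show ?thesis unfolding right_dyadic_def using assms by (intro mult_left_mono) auto
qed

lemma right_dyadic_self:
  assumes "T > 0"
  shows "right_dyadic T n T = T"
proof -
  have "\<lceil>2 ^ n * T / T\<rceil> = (2 ^ n :: int)" using assms by (simp add: ceiling_eq_iff)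
  then show ?thesis by (simp add: right_dyadic_def power_one_over)
qed

lemma right_dyadic_tendsto:
  assumes "T > 0"
  shows "(\<lambda>n. right_dyadic T n r) \<longlonglongrightarrow> r"
proof (rule tendsto_sandwich[of "\<lambda>_. r" _ _ "\<lambda>n. r + T * (1/2) ^ n"])
  have "(\<lambda>n. r + T * (1/2) ^ n) \<longlonglongrightarrow> r + T * 0" by (intro tendsto_intros LIMSEQ_power_zero) simp
  then show "(\<lambda>n. r + T * (1/2) ^ n) \<longlonglongrightarrow> r" by simp
qed (auto intro!: always_eventually right_dyadic_ge right_dyadic_le_add assms)

lemma finite_right_dyadic_image:
  assumes "T > 0" "\<And>x. x \<in> A \<Longrightarrow> 0 \<le> f x \<and> f x \<le> T"
  shows "finite ((\<lambda>x. right_dyadic T n (f x)) ` A)"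
proof (rule finite_subset)
  show "(\<lambda>x. right_dyadic T n (f x)) ` A \<subseteq> (\<lambda>k. T * (1/2) ^ n * of_int k) ` {0..2 ^ n}"
  proof safe
    fix x assume "x \<in> A"
    then have x: "0 \<le> f x" "f x \<le> T" using assms by auto
    then have "2 ^ n * f x / T \<le> 2 ^ n" using assms(1) by (simp add: field_simps)
    then have "\<lceil>2 ^ n * f x / T\<rceil> \<le> 2 ^ n" by (simp add: ceiling_le_iff)
    moreover have "0 \<le> \<lceil>2 ^ n * f x / T\<rceil>" using x assms(1) by (simp add: le_ceiling_iff)
       (smt (verit) divide_nonneg_pos mult_nonneg_nonneg zero_le_power)
    ultimately show "right_dyadic T n (f x) \<in> (\<lambda>k. T * (1/2) ^ n * of_int k) ` {0..2 ^ n}"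
      by (auto simp: right_dyadic_def)
  qed
qed simp

text \<open>A right limit says nothing about the indices with \<open>s n = r\<close>, where \<open>f (s n)\<close> is the limit
itself.\<close>

lemma limitin_at_right_sequence:
  fixes r :: real
  assumes lim: "limitin \<T> f (f r) (at_right r)" and s: "s \<longlonglongrightarrow> r" "\<And>n. r \<le> s n"
  shows "limitin \<T> (\<lambda>n. f (s n)) (f r) sequentially"
  unfolding limitin_def
proof (intro conjI allI impI)
  show "f r \<in> topspace \<T>" using lim by (rule limitin_topspace)
  fix U assume U: "openin \<T> U \<and> f r \<in> U"
  then have "eventually (\<lambda>x. f x \<in> U) (at_right r)" using lim by (simp add: limitin_def)
  then obtain b where b: "r < b" "\<And>y. r < y \<Longrightarrow> y < b \<Longrightarrow> f y \<in> U"
    by (auto simp: eventually_at_right_field)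
  have "eventually (\<lambda>n. s n < b) sequentially" using s(1) b(1) by (rule order_tendstoD)
  then show "eventually (\<lambda>n. f (s n) \<in> U) sequentially"
  proof eventually_elim
    case (elim n)
    then show ?case using b(2)[of "s n"] s(2)[of n] U by (cases "s n = r") auto
  qed
qed


section \<open>Convergence in probability\<close>

lemma tends_0_in_prob_compare:
  assumes D: "tends_0_in_prob M D" and le: "AE \<omega> in M. \<forall>n. D' n \<omega> \<le> D n \<omega>"
  shows "tends_0_in_prob M D'"
  unfolding tends_0_in_prob_def
proof (intro allI impI)
  fix \<epsilon> \<delta> :: real assume "0 < \<epsilon>" "0 < \<delta>"
  obtain N where N: "N \<in> null_sets M" "{\<omega> \<in> space M. \<not> (\<forall>n. D' n \<omega> \<le> D n \<omega>)} \<subseteq> N"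
    using le by (auto elim!: AE_E3)
  have "\<forall>\<^sub>F n in sequentially. \<exists>B\<in>sets M. measure M B \<le> \<delta> \<and> (\<forall>\<omega>\<in>space M - B. D n \<omega> \<le> ennreal \<epsilon>)"
    using D \<open>0 < \<epsilon>\<close> \<open>0 < \<delta>\<close> by (simp add: tends_0_in_prob_def)
  then show "\<forall>\<^sub>F n in sequentially. \<exists>B\<in>sets M. measure M B \<le> \<delta> \<and> (\<forall>\<omega>\<in>space M - B. D' n \<omega> \<le> ennreal \<epsilon>)"
  proof eventually_elim
    case (elim n)
    then obtain B where B: "B \<in> sets M" "measure M B \<le> \<delta>" "\<forall>\<omega>\<in>space M - B. D n \<omega> \<le> ennreal \<epsilon>"
      by blast
    have "measure M (B \<union> N) = measure M B"
      using B(1) N(1) by (rule measure_Un_null_set)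
    moreover have "D' n \<omega> \<le> ennreal \<epsilon>" if "\<omega> \<in> space M - (B \<union> N)" for \<omega>
      using that B(3) N(2) by (blast intro: order_trans)
    ultimately show ?case using B(1,2) N(1) by (intro bexI[of _ "B \<union> N"]) auto
  qed
qed

context prob_space
begin

lemma tends_0_in_prob_add:
  assumes D: "tends_0_in_prob M D" and D': "tends_0_in_prob M D'"
  shows "tends_0_in_prob M (\<lambda>n \<omega>. D n \<omega> + D' n \<omega>)"
  unfolding tends_0_in_prob_def
proof (intro allI impI)
  fix \<epsilon> \<delta> :: real assume *: "0 < \<epsilon>" "0 < \<delta>"
  have "\<forall>\<^sub>F n in sequentially. \<exists>B\<in>sets M. measure M B \<le> \<delta> / 2 \<and> (\<forall>\<omega>\<in>space M - B. D n \<omega> \<le> ennreal (\<epsilon> / 2))"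
    "\<forall>\<^sub>F n in sequentially. \<exists>B\<in>sets M. measure M B \<le> \<delta> / 2 \<and> (\<forall>\<omega>\<in>space M - B. D' n \<omega> \<le> ennreal (\<epsilon> / 2))"
    using D D' half_gt_zero[OF *(1)] half_gt_zero[OF *(2)] unfolding tends_0_in_prob_def by blast+
  then show "\<forall>\<^sub>F n in sequentially. \<exists>B\<in>sets M. measure M B \<le> \<delta> \<and> (\<forall>\<omega>\<in>space M - B. D n \<omega> + D' n \<omega> \<le> ennreal \<epsilon>)"
  proof eventually_elim
    case (elim n)
    then obtain B C where B: "B \<in> sets M" "measure M B \<le> \<delta> / 2" "\<forall>\<omega>\<in>space M - B. D n \<omega> \<le> ennreal (\<epsilon> / 2)"
      and C: "C \<in> sets M" "measure M C \<le> \<delta> / 2" "\<forall>\<omega>\<in>space M - C. D' n \<omega> \<le> ennreal (\<epsilon> / 2)"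
      by blast
    have "measure M (B \<union> C) \<le> measure M B + measure M C"
      using B(1) C(1) by (rule measure_Un_le)
    then have "measure M (B \<union> C) \<le> \<delta>" using B(2) C(2) by simp
    moreover have "D n \<omega> + D' n \<omega> \<le> ennreal \<epsilon>" if "\<omega> \<in> space M - (B \<union> C)" for \<omega>
    proof -
      have "D n \<omega> + D' n \<omega> \<le> ennreal (\<epsilon> / 2) + ennreal (\<epsilon> / 2)"
        using that B(3) C(3) by (intro add_mono) auto
      also have "\<dots> = ennreal \<epsilon>" using * by (simp add: ennreal_plus[symmetric] del: ennreal_plus)
      finally show ?thesis .
    qed
    ultimately show ?case using B(1) C(1) by (intro bexI[of _ "B \<union> C"]) auto
  qed
qed

text \<open>A constant sequence that is small outside events of arbitrarily small probability is small outside
the intersection of these events, a null set.\<close>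

lemma tends_0_in_prob_const:
  assumes "tends_0_in_prob M (\<lambda>n. D)"
  shows "AE \<omega> in M. D \<omega> = 0"
proof -
  have "AE \<omega> in M. D \<omega> \<le> ennreal (1 / real (Suc k))" for k
  proof -
    have "\<exists>B\<in>sets M. measure M B \<le> 1 / real (Suc j) \<and> (\<forall>\<omega>\<in>space M - B. D \<omega> \<le> ennreal (1 / real (Suc k)))" for j
    proof -
      have "(0::real) < 1 / real (Suc k)" "(0::real) < 1 / real (Suc j)" by simp_all
      with assms have "\<forall>\<^sub>F n::nat in sequentially.
          \<exists>B\<in>sets M. measure M B \<le> 1 / real (Suc j) \<and> (\<forall>\<omega>\<in>space M - B. D \<omega> \<le> ennreal (1 / real (Suc k)))"
        unfolding tends_0_in_prob_def by blast
      then show ?thesis by (simp add: eventually_const_iff del: of_nat_Suc)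
    qed
    then obtain B where B: "\<And>j. B j \<in> sets M" "\<And>j. measure M (B j) \<le> 1 / real (Suc j)"
      "\<And>j \<omega>. \<omega> \<in> space M - B j \<Longrightarrow> D \<omega> \<le> ennreal (1 / real (Suc k))" by metis
    have "measure M (\<Inter>j. B j) \<le> 1 / real (Suc j)" for j
      by (rule order_trans[OF finite_measure_mono B(2)]) (use B(1) in auto)
    then have "measure M (\<Inter>j. B j) \<le> 0"
      by (intro LIMSEQ_le_const[OF lim_1_over_n[THEN LIMSEQ_Suc]]) auto
    then have "(\<Inter>j. B j) \<in> null_sets M"
      using B(1) by (intro null_setsI) (auto simp: emeasure_eq_measure measure_le_0_iff)
    then show ?thesis
      by (rule AE_I') (use B(3) in blast)
  qed
  then have "AE \<omega> in M. \<forall>k. D \<omega> \<le> ennreal (1 / real (Suc k))" by (simp add: AE_all_countable)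
  then show ?thesis
  proof eventually_elim
    case (elim \<omega>)
    have "(\<lambda>k. ennreal (1 / real (Suc k))) \<longlonglongrightarrow> ennreal 0"
      by (intro tendsto_ennrealI lim_1_over_n[THEN LIMSEQ_Suc])
    then have "D \<omega> \<le> ennreal 0" by (rule LIMSEQ_le_const) (use elim in auto)
    then show ?case by simp
  qed
qed

lemma AE_tendsto_imp_tends_0_in_prob:
  fixes D :: "nat \<Rightarrow> 'a \<Rightarrow> real"
  assumes [measurable]: "\<And>n. D n \<in> borel_measurable M"
    and lim: "AE \<omega> in M. (\<lambda>n. D n \<omega>) \<longlonglongrightarrow> 0"
  shows "tends_0_in_prob M (\<lambda>n \<omega>. ennreal (D n \<omega>))"
  unfolding tends_0_in_prob_def
proof (intro allI impI)
  fix \<epsilon> \<delta> :: real assume *: "0 < \<epsilon>" "0 < \<delta>"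
  define B where "B n = {\<omega> \<in> space M. \<epsilon> < D n \<omega>}" for n
  have B [measurable]: "B n \<in> sets M" for n unfolding B_def by measurable
  have "(\<lambda>n. integral\<^sup>L M (indicator (B n) :: 'a \<Rightarrow> real)) \<longlonglongrightarrow> integral\<^sup>L M (\<lambda>_. 0)"
  proof (rule integral_dominated_convergence[where w = "\<lambda>_. 1"])
    show "AE \<omega> in M. (\<lambda>n. indicator (B n) \<omega> :: real) \<longlonglongrightarrow> 0"
      using lim
    proof eventually_elim
      case (elim \<omega>)
      then have "eventually (\<lambda>n. D n \<omega> < \<epsilon>) sequentially" using * by (auto dest: order_tendstoD)
      then show ?case
        by (intro tendsto_eventually) (auto elim!: eventually_mono simp: B_def indicator_def)
    qed
  qed (auto simp: indicator_def)
  then have "(\<lambda>n. measure M (B n)) \<longlonglongrightarrow> 0" using B by simp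
  then have "eventually (\<lambda>n. measure M (B n) < \<delta>) sequentially" using * by (auto dest: order_tendstoD)
  then show "\<forall>\<^sub>F n in sequentially. \<exists>B\<in>sets M. measure M B \<le> \<delta> \<and> (\<forall>\<omega>\<in>space M - B. ennreal (D n \<omega>) \<le> ennreal \<epsilon>)"
  proof eventually_elim
    case (elim n)
    then show ?case
      by (intro bexI[of _ "B n"] conjI ballI ennreal_leI B) (auto simp: B_def)
  qed
qed

end


section \<open>Processes at stopping times\<close>

context usual_conditions
begin

lemma null_subset_in_F: "N \<in> null_sets M \<Longrightarrow> B \<subseteq> N \<Longrightarrow> 0 \<le> t \<Longrightarrow> B \<in> sets (F t)"
  using complete sets_F_mono by blast

lemma sets_pre_sigma_subset:
  assumes "stopping_time F \<tau>"
  shows "sets (pre_sigma \<tau>) \<subseteq> sets M"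
proof
  fix A assume A: "A \<in> sets (pre_sigma \<tau>)"
  then have "{\<omega> \<in> A. \<tau> \<omega> \<le> real n} \<in> sets M" for n
    using sets_pre_sigmaD[OF assms A] sets_F_subset by blast
  then have "(\<Union>n. {\<omega> \<in> A. \<tau> \<omega> \<le> real n}) \<in> sets M" by blast
  moreover have "(\<Union>n. {\<omega> \<in> A. \<tau> \<omega> \<le> real n}) = A"
    using real_arch_simple by blast
  ultimately show "A \<in> sets M" by simp
qed

lemma measurable_pre_sigma_mono:
  assumes "stopping_time F \<sigma>" "stopping_time F \<tau>" "\<And>\<omega>. \<omega> \<in> space M \<Longrightarrow> \<sigma> \<omega> \<le> \<tau> \<omega>"
    and f: "f \<in> pre_sigma \<sigma> \<rightarrow>\<^sub>M N"
  shows "f \<in> pre_sigma \<tau> \<rightarrow>\<^sub>M N"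
  using measurable_mono[OF order_refl refl mono_pre_sigma[OF assms(1-3)], of N] f
  by (auto simp: space_pre_sigma)

lemma measurable_pre_sigma_M:
  assumes "stopping_time F \<tau>" "f \<in> pre_sigma \<tau> \<rightarrow>\<^sub>M N"
  shows "f \<in> M \<rightarrow>\<^sub>M N"
  using measurable_mono[OF order_refl refl sets_pre_sigma_subset[OF assms(1)], of N] assms(2)
  by (auto simp: space_pre_sigma)

text \<open>Rounding up does not look into the future: \<open>\<sigma>\<close> is rounded to a time at most \<open>t\<close> iff \<open>\<sigma>\<close> is at most
the last grid point \<open>c\<close> not after \<open>t\<close>.\<close>

lemma stopping_time_right_dyadic:
  assumes T: "T > 0" and \<sigma>: "stopping_time F \<sigma>"
  shows "stopping_time F (\<lambda>\<omega>. right_dyadic T n (\<sigma> \<omega>))"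
proof
  fix t
  define c where "c = T * (1/2) ^ n * of_int \<lfloor>2 ^ n * t / T\<rfloor>"
  have "of_int \<lfloor>2 ^ n * t / T\<rfloor> \<le> 2 ^ n * t / T" by (rule of_int_floor_le)
  then have "c \<le> T * (1/2) ^ n * (2 ^ n * t / T)"
    unfolding c_def using T by (intro mult_left_mono) auto
  also have "\<dots> = t" using T by (simp add: power_one_over field_simps)
  finally have "c \<le> t" .
  moreover have "right_dyadic T n r \<le> t \<longleftrightarrow> r \<le> c" for r
  proof -
    have "right_dyadic T n r \<le> t \<longleftrightarrow> of_int \<lceil>2 ^ n * r / T\<rceil> \<le> 2 ^ n * t / T"
      unfolding right_dyadic_def using T by (simp add: power_one_over field_simps)
    also have "\<dots> \<longleftrightarrow> 2 ^ n * r / T \<le> of_int \<lfloor>2 ^ n * t / T\<rfloor>"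
      by (simp add: le_floor_iff[symmetric] ceiling_le_iff)
    also have "\<dots> \<longleftrightarrow> r \<le> c"
      unfolding c_def using T by (simp add: power_one_over field_simps)
    finally show ?thesis .
  qed
  ultimately show "Measurable.pred (F t) (\<lambda>\<omega>. right_dyadic T n (\<sigma> \<omega>) \<le> t)"
    using stopping_time_le_const[OF \<sigma>, of c t] by simp
qed

lemma stopping_pair_right_dyadic:
  assumes T: "T > 0" and st: "stopping_pair M F T \<sigma> \<tau>"
  shows "stopping_pair M F T (\<lambda>\<omega>. right_dyadic T n (\<sigma> \<omega>)) (\<lambda>\<omega>. right_dyadic T n (\<tau> \<omega>))"
proof -
  have "0 \<le> right_dyadic T n (\<sigma> \<omega>) \<and> right_dyadic T n (\<sigma> \<omega>) \<le> right_dyadic T n (\<tau> \<omega>)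
      \<and> right_dyadic T n (\<tau> \<omega>) \<le> T" if "\<omega> \<in> space M" for \<omega>
    using st that right_dyadic_ge[OF T, of "\<sigma> \<omega>" n] right_dyadic_mono[OF T, of "\<sigma> \<omega>" "\<tau> \<omega>" n]
      right_dyadic_mono[OF T, of "\<tau> \<omega>" T n] right_dyadic_self[OF T, of n]
    by (auto simp: stopping_pair_def)
  then show ?thesis
    using st by (auto simp: stopping_pair_def intro: stopping_time_right_dyadic[OF T])
qed

text \<open>The process stopped at \<open>t\<close> is a limit of its values at grid times, capped at \<open>t\<close> so that each of
them is \<open>F t\<close>-measurable. Right continuity may fail on a null set, but all subsets of null sets
belong to \<open>F 0\<close>, and the process can be altered there.\<close>

lemma measurable_stopped_value:
  fixes f :: "real \<Rightarrow> 'a \<Rightarrow> 'b::{real_normed_vector, second_countable_topology}"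
  assumes adapted: "\<And>t. 0 \<le> t \<Longrightarrow> f t \<in> borel_measurable (F t)"
    and right_cont: "AE \<omega> in M. \<forall>t\<ge>0. ((\<lambda>s. f s \<omega>) \<longlongrightarrow> f t \<omega>) (at_right t)"
    and \<tau>: "stopping_time F \<tau>" "\<And>\<omega>. \<omega> \<in> space M \<Longrightarrow> 0 \<le> \<tau> \<omega>"
  shows "(\<lambda>\<omega>. f (\<tau> \<omega>) \<omega>) \<in> borel_measurable (pre_sigma \<tau>)"
proof -
  obtain N where N: "N \<in> null_sets M"
    "{\<omega> \<in> space M. \<not> (\<forall>t\<ge>0. ((\<lambda>s. f s \<omega>) \<longlongrightarrow> f t \<omega>) (at_right t))} \<subseteq> N"
    using right_cont by (auto elim!: AE_E3)
  have stopped: "(\<lambda>\<omega>. f (min t (\<tau> \<omega>)) \<omega>) \<in> borel_measurable (F t)" if t: "0 \<le> t" for t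
  proof -
    define \<rho> where "\<rho> \<omega> = min t (\<tau> \<omega>)" for \<omega>
    have \<rho>: "\<rho> \<in> borel_measurable (F t)"
    proof (rule borel_measurableI_le)
      fix a
      show "{\<omega> \<in> space (F t). \<rho> \<omega> \<le> a} \<in> sets (F t)"
      proof (cases "t \<le> a")
        case True
        then have "{\<omega> \<in> space (F t). \<rho> \<omega> \<le> a} = space (F t)" by (auto simp: \<rho>_def)
        then show ?thesis by simp
      next
        case False
        then have "{\<omega> \<in> space (F t). \<rho> \<omega> \<le> a} = {\<omega> \<in> space (F t). \<tau> \<omega> \<le> a}" by (auto simp: \<rho>_def)
        then show ?thesis using stopping_time_le_const[OF \<tau>(1), of a t] False by (simp add: pred_def)
      qed
    qed
    \<comment> \<open>The grid point is a function of \<open>min t \<tau>\<close> and not of \<open>\<tau>\<close>, whose values beyond \<open>t\<close> are not known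
        at time \<open>t\<close>. The outer \<open>max 0\<close> makes the time nonnegative for every integer \<open>k\<close> that replaces the
        ceiling below.\<close>
    define s where "s n \<omega> = max 0 (min t (1 * (1/2) ^ n * of_int \<lceil>2 ^ n * \<rho> \<omega> / 1\<rceil>))" for n :: nat and \<omega>
    have s_meas: "(\<lambda>\<omega>. f (s n \<omega>) \<omega>) \<in> borel_measurable (F t)" for n
      unfolding s_def
    proof (rule measurable_compose_countable[where g = "\<lambda>\<omega>. \<lceil>2 ^ n * \<rho> \<omega> / 1\<rceil>"])
      fix k :: int
      define t' where "t' = max 0 (min t (1 * (1/2) ^ n * of_int k))"
      have "f t' \<in> borel_measurable (F t')" by (rule adapted) (simp add: t'_def)
      moreover have "sets (F t') \<subseteq> sets (F t)" using t by (intro sets_F_mono) (simp add: t'_def)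
      ultimately have "f t' \<in> borel_measurable (F t)"
        using measurable_mono[of borel borel "F t'" "F t"] by (auto simp: space_F)
      then show "f (max 0 (min t (1 * (1/2) ^ n * of_int k))) \<in> borel_measurable (F t)"
        unfolding t'_def .
    qed (use \<rho> in measurable)
    have s_eq: "s n \<omega> = min t (right_dyadic 1 n (\<rho> \<omega>))" if "\<omega> \<in> space M" for n \<omega>
      using right_dyadic_ge[of 1 "\<rho> \<omega>" n] \<tau>(2)[OF that] t
      unfolding s_def right_dyadic_def \<rho>_def by auto
    define c :: 'b where "c = 0"
    have "(\<lambda>\<omega>. if \<omega> \<in> N then c else f (\<rho> \<omega>) \<omega>) \<in> borel_measurable (F t)"
    proof (rule borel_measurable_LIMSEQ_metric)
      have "N \<in> sets (F t)" using null_subset_in_F[OF N(1) order_refl t] .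
      then show "(\<lambda>\<omega>. if \<omega> \<in> N then c else f (s n \<omega>) \<omega>) \<in> borel_measurable (F t)" for n
        by (intro measurable_If_set s_meas measurable_const) (auto simp: sets.Int_space_eq2)
      fix \<omega> assume "\<omega> \<in> space (F t)"
      then have \<omega>: "\<omega> \<in> space M" by (simp add: space_F)
      show "(\<lambda>n. if \<omega> \<in> N then c else f (s n \<omega>) \<omega>) \<longlonglongrightarrow> (if \<omega> \<in> N then c else f (\<rho> \<omega>) \<omega>)"
      proof (cases "\<omega> \<in> N")
        case False
        have "limitin euclidean (\<lambda>s. f s \<omega>) (f (\<rho> \<omega>) \<omega>) (at_right (\<rho> \<omega>))"
        proof -
          have "0 \<le> \<rho> \<omega>" using \<tau>(2)[OF \<omega>] t by (simp add: \<rho>_def)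
          then show ?thesis using False N(2) \<omega> by auto
        qed
        moreover have "(\<lambda>n. s n \<omega>) \<longlonglongrightarrow> \<rho> \<omega>"
        proof -
          have "(\<lambda>n. min t (right_dyadic 1 n (\<rho> \<omega>))) \<longlonglongrightarrow> min t (\<rho> \<omega>)"
            by (intro tendsto_min tendsto_const right_dyadic_tendsto) simp
          then show ?thesis by (simp add: s_eq[OF \<omega>] \<rho>_def)
        qed
        moreover have "\<rho> \<omega> \<le> s n \<omega>" for n
          using right_dyadic_ge[of 1 "\<rho> \<omega>" n] by (simp add: s_eq[OF \<omega>] \<rho>_def)
        ultimately have "limitin euclidean (\<lambda>n. f (s n \<omega>) \<omega>) (f (\<rho> \<omega>) \<omega>) sequentially"
          by (rule limitin_at_right_sequence)
        then show ?thesis using False by simp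
      qed simp
    qed
    then have h: "(\<lambda>\<omega>. if \<omega> \<in> N then c else f (\<rho> \<omega>) \<omega>) -` S \<inter> space (F t) \<in> sets (F t)"
      if "S \<in> sets borel" for S using that by (rule measurable_sets)
    show ?thesis
    proof (rule measurableI)
      fix S :: "'b set" assume S: "S \<in> sets borel"
      let ?G = "(\<lambda>\<omega>. f (min t (\<tau> \<omega>)) \<omega>) -` S \<inter> space (F t)"
      have "?G = (((\<lambda>\<omega>. if \<omega> \<in> N then c else f (\<rho> \<omega>) \<omega>) -` S \<inter> space (F t)) - N) \<union> (?G \<inter> N)"
        by (auto simp: \<rho>_def)
      also have "\<dots> \<in> sets (F t)"
        by (intro sets.Un sets.Diff h S null_subset_in_F[OF N(1)] t) auto
      finally show "?G \<in> sets (F t)" .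
    qed simp
  qed
  show ?thesis
  proof (rule measurableI)
    fix S :: "'b set" assume S: "S \<in> sets borel"
    show "(\<lambda>\<omega>. f (\<tau> \<omega>) \<omega>) -` S \<inter> space (pre_sigma \<tau>) \<in> sets (pre_sigma \<tau>)"
    proof (rule sets_pre_sigmaI[OF \<tau>(1)])
      fix t
      let ?L = "{\<omega> \<in> (\<lambda>\<omega>. f (\<tau> \<omega>) \<omega>) -` S \<inter> space (pre_sigma \<tau>). \<tau> \<omega> \<le> t}"
      show "?L \<in> sets (F t)"
      proof (cases "0 \<le> t")
        case True
        have "?L = ((\<lambda>\<omega>. f (min t (\<tau> \<omega>)) \<omega>) -` S \<inter> space (F t)) \<inter> {\<omega> \<in> space (F t). \<tau> \<omega> \<le> t}"
          by (auto simp: space_pre_sigma space_F min_absorb2)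
        then show ?thesis
          using measurable_sets[OF stopped[OF True] S] stopping_timeD[OF \<tau>(1), of t]
          by (simp add: pred_def)
      next
        case False
        then have "?L = {}" using \<tau>(2) by (force simp: space_pre_sigma)
        then show ?thesis by (rule ssubst) (rule sets.empty_sets)
      qed
    qed
  qed simp
qed

end


section \<open>Uniform convergence on compacts in probability\<close>

context prob_space
begin

text \<open>The witness \<open>r\<close> is allowed to differ from \<open>s\<close> so that processes stopped at a random time can be
compared with the original ones.\<close>

lemma ucp_tendsto_compare:
  assumes Z: "ucp_tendsto M Zn Z"
    and le: "AE \<omega> in M. \<forall>n. \<forall>s>0. \<exists>r. 0 < r \<and> r \<le> s \<and> norm (Wn n s \<omega> - W s \<omega>) \<le> norm (Zn n r \<omega> - Z r \<omega>)
        \<or> Wn n s \<omega> = W s \<omega>"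
  shows "ucp_tendsto M Wn W"
  unfolding ucp_tendsto_def
proof (intro allI impI)
  fix t :: real assume "0 < t"
  then have "tends_0_in_prob M (\<lambda>n \<omega>. SUP s\<in>{0<..t}. ennreal (norm (Zn n s \<omega> - Z s \<omega>)))"
    using Z by (simp add: ucp_tendsto_def)
  then show "tends_0_in_prob M (\<lambda>n \<omega>. SUP s\<in>{0<..t}. ennreal (norm (Wn n s \<omega> - W s \<omega>)))"
  proof (rule tends_0_in_prob_compare)
    show "AE \<omega> in M. \<forall>n. (SUP s\<in>{0<..t}. ennreal (norm (Wn n s \<omega> - W s \<omega>)))
        \<le> (SUP s\<in>{0<..t}. ennreal (norm (Zn n s \<omega> - Z s \<omega>)))"
      using le
    proof eventually_elim
      case (elim \<omega>)
      show ?case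
      proof (intro allI SUP_least)
        fix n s assume s: "s \<in> {0<..t}"
        then obtain r where r: "0 < r \<and> r \<le> s \<and> norm (Wn n s \<omega> - W s \<omega>) \<le> norm (Zn n r \<omega> - Z r \<omega>)
            \<or> Wn n s \<omega> = W s \<omega>" using elim by fastforce
        show "ennreal (norm (Wn n s \<omega> - W s \<omega>)) \<le> (SUP s\<in>{0<..t}. ennreal (norm (Zn n s \<omega> - Z s \<omega>)))"
        proof (cases "Wn n s \<omega> = W s \<omega>")
          case False
          with r s have "r \<in> {0<..t}" "ennreal (norm (Wn n s \<omega> - W s \<omega>)) \<le> ennreal (norm (Zn n r \<omega> - Z r \<omega>))"
            by (auto intro!: ennreal_leI)
          then show ?thesis by (rule SUP_upper2)
        qed simp
      qed
    qed
  qed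
qed

lemma ucp_tendsto_add:
  assumes "ucp_tendsto M Zn Z" "ucp_tendsto M Zn' Z'"
  shows "ucp_tendsto M (\<lambda>n t \<omega>. Zn n t \<omega> + Zn' n t \<omega>) (\<lambda>t \<omega>. Z t \<omega> + Z' t \<omega>)"
  unfolding ucp_tendsto_def
proof (intro allI impI)
  fix t :: real assume "0 < t"
  let ?D = "\<lambda>n \<omega>. SUP s\<in>{0<..t}. ennreal (norm (Zn n s \<omega> - Z s \<omega>))"
  let ?D' = "\<lambda>n \<omega>. SUP s\<in>{0<..t}. ennreal (norm (Zn' n s \<omega> - Z' s \<omega>))"
  have sum: "tends_0_in_prob M (\<lambda>n \<omega>. ?D n \<omega> + ?D' n \<omega>)"
    using assms \<open>0 < t\<close> by (intro tends_0_in_prob_add) (simp_all add: ucp_tendsto_def)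
  have le: "(SUP s\<in>{0<..t}. ennreal (norm (Zn n s \<omega> + Zn' n s \<omega> - (Z s \<omega> + Z' s \<omega>)))) \<le> ?D n \<omega> + ?D' n \<omega>"
    for n \<omega>
  proof (rule SUP_least)
    fix s assume s: "s \<in> {0<..t}"
    have "norm (Zn n s \<omega> + Zn' n s \<omega> - (Z s \<omega> + Z' s \<omega>)) \<le> norm (Zn n s \<omega> - Z s \<omega>) + norm (Zn' n s \<omega> - Z' s \<omega>)"
      using norm_triangle_ineq[of "Zn n s \<omega> - Z s \<omega>" "Zn' n s \<omega> - Z' s \<omega>"] by (simp add: algebra_simps)
    then have "ennreal (norm (Zn n s \<omega> + Zn' n s \<omega> - (Z s \<omega> + Z' s \<omega>)))
        \<le> ennreal (norm (Zn n s \<omega> - Z s \<omega>)) + ennreal (norm (Zn' n s \<omega> - Z' s \<omega>))"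
      by (subst ennreal_plus[symmetric]) (auto intro: ennreal_leI simp del: ennreal_plus)
    also have "\<dots> \<le> ?D n \<omega> + ?D' n \<omega>" using s by (intro add_mono SUP_upper)
    finally show "ennreal (norm (Zn n s \<omega> + Zn' n s \<omega> - (Z s \<omega> + Z' s \<omega>))) \<le> ?D n \<omega> + ?D' n \<omega>" .
  qed
  show "tends_0_in_prob M (\<lambda>n \<omega>. SUP s\<in>{0<..t}. ennreal (norm (Zn n s \<omega> + Zn' n s \<omega> - (Z s \<omega> + Z' s \<omega>))))"
    by (rule tends_0_in_prob_compare[OF sum]) (use le in simp)
qed

lemma ucp_tendsto_uminus:
  assumes "ucp_tendsto M Zn Z"
  shows "ucp_tendsto M (\<lambda>n t \<omega>. - Zn n t \<omega>) (\<lambda>t \<omega>. - Z t \<omega>)"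
proof -
  have "norm (- Zn n t \<omega> - - Z t \<omega>) = norm (Zn n t \<omega> - Z t \<omega>)" for n t \<omega>
    using norm_minus_commute[of "Zn n t \<omega>" "Z t \<omega>"] by simp
  then show ?thesis using assms by (simp add: ucp_tendsto_def)
qed

lemma ucp_tendsto_diff:
  assumes "ucp_tendsto M Zn Z" "ucp_tendsto M Zn' Z'"
  shows "ucp_tendsto M (\<lambda>n t \<omega>. Zn n t \<omega> - Zn' n t \<omega>) (\<lambda>t \<omega>. Z t \<omega> - Z' t \<omega>)"
  using ucp_tendsto_add[OF assms(1) ucp_tendsto_uminus[OF assms(2)]] by simp

lemma ucp_tendsto_const: "ucp_tendsto M (\<lambda>n. Z) Z"
proof -
  have "(SUP s\<in>{0<..t}. ennreal (norm (Z s \<omega> - Z s \<omega>))) = 0" for t \<omega>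
    by (auto simp: SUP_eq_iff bot_ennreal intro!: antisym SUP_least)
  then show ?thesis
    by (auto simp: ucp_tendsto_def tends_0_in_prob_def intro!: always_eventually bexI[of _ "{}"])
qed

lemma ucp_tendsto_cong:
  assumes "ucp_tendsto M Zn Z"
    and "\<And>n t \<omega>. \<omega> \<in> space M \<Longrightarrow> 0 < t \<Longrightarrow> Wn n t \<omega> = Zn n t \<omega>"
    and "\<And>t \<omega>. \<omega> \<in> space M \<Longrightarrow> 0 < t \<Longrightarrow> W t \<omega> = Z t \<omega>"
  shows "ucp_tendsto M Wn W"
  using assms(1) by (rule ucp_tendsto_compare) (auto simp: assms(2,3) intro!: AE_I2)

text \<open>The suprema in \<^const>\<open>ucp_tendsto\<close> exclude time \<open>0\<close>, which a stopped process reaches when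
\<open>\<rho> \<omega> = 0\<close>; this is why agreement at time \<open>0\<close> is assumed.\<close>

lemma ucp_tendsto_stopped:
  assumes Z: "ucp_tendsto M Zn Z" and zero: "AE \<omega> in M. \<forall>n. Zn n 0 \<omega> = Z 0 \<omega>"
    and \<rho>: "\<And>\<omega>. \<omega> \<in> space M \<Longrightarrow> 0 \<le> \<rho> \<omega>"
  shows "ucp_tendsto M (\<lambda>n t \<omega>. Zn n (min t (\<rho> \<omega>)) \<omega>) (\<lambda>t \<omega>. Z (min t (\<rho> \<omega>)) \<omega>)"
  using Z
proof (rule ucp_tendsto_compare)
  show "AE \<omega> in M. \<forall>n. \<forall>s>0. \<exists>r. 0 < r \<and> r \<le> s
      \<and> norm (Zn n (min s (\<rho> \<omega>)) \<omega> - Z (min s (\<rho> \<omega>)) \<omega>) \<le> norm (Zn n r \<omega> - Z r \<omega>)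
      \<or> Zn n (min s (\<rho> \<omega>)) \<omega> = Z (min s (\<rho> \<omega>)) \<omega>"
    using zero AE_space
  proof eventually_elim
    case (elim \<omega>)
    show ?case
    proof (intro allI impI)
      fix n and s :: real assume "0 < s"
      show "\<exists>r. 0 < r \<and> r \<le> s
          \<and> norm (Zn n (min s (\<rho> \<omega>)) \<omega> - Z (min s (\<rho> \<omega>)) \<omega>) \<le> norm (Zn n r \<omega> - Z r \<omega>)
          \<or> Zn n (min s (\<rho> \<omega>)) \<omega> = Z (min s (\<rho> \<omega>)) \<omega>"
        using \<rho>[OF elim(2)] \<open>0 < s\<close> elim(1)
        by (cases "\<rho> \<omega> = 0") (auto intro!: exI[of _ "min s (\<rho> \<omega>)"])
    qed
  qed
qed

lemma ucp_tendsto_unique: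
  assumes "ucp_tendsto M Zn Z" "ucp_tendsto M Zn Z'" "0 < t"
  shows "AE \<omega> in M. Z t \<omega> = Z' t \<omega>"
proof -
  have "ucp_tendsto M (\<lambda>n t \<omega>. Zn n t \<omega> - Zn n t \<omega>) (\<lambda>t \<omega>. Z t \<omega> - Z' t \<omega>)"
    using assms(1,2) by (rule ucp_tendsto_diff)
  then have "tends_0_in_prob M (\<lambda>n \<omega>. SUP s\<in>{0<..t}. ennreal (norm (0 - (Z s \<omega> - Z' s \<omega>))))"
    using assms(3) by (simp add: ucp_tendsto_def)
  from tends_0_in_prob_const[OF this] show ?thesis
  proof eventually_elim
    case (elim \<omega>)
    have "ennreal (norm (0 - (Z t \<omega> - Z' t \<omega>))) \<le> (SUP s\<in>{0<..t}. ennreal (norm (0 - (Z s \<omega> - Z' s \<omega>))))"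
      using assms(3) by (intro SUP_upper) auto
    then show ?case using elim by (simp add: ennreal_eq_0_iff)
  qed
qed

end


section \<open>Restricting an integrand to a stopping interval\<close>

lemma simple_predictable_append:
  "simple_predictable M F (L @ L') \<longleftrightarrow> simple_predictable M F L \<and> simple_predictable M F L'"
  unfolding simple_predictable_def set_append ball_Un ..

lemma simple_val_append: "simple_val (L @ L') r \<omega> = simple_val L r \<omega> + simple_val L' r \<omega>"
  by (simp add: simple_val_def)

lemma simple_integral_append:
  "simple_integral X (L @ L') t \<omega> = simple_integral X L t \<omega> + simple_integral X L' t \<omega>"
  by (simp add: simple_integral_def)

definition negate_simple :: "('a, 'h::real_vector) simple_proc \<Rightarrow> ('a, 'h) simple_proc"
  where "negate_simple L = map (\<lambda>(h, S, U). (\<lambda>\<omega>. - h \<omega>, S, U)) L"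

text \<open>Multiplication of a simple process by the indicator of \<open>(\<sigma>, \<tau>]\<close>. The starting time may only be
increased, because the coefficient is known at time \<open>S\<close> and not before; intervals that miss
\<open>(\<sigma>, \<tau>]\<close> therefore become empty by raising their end point to their starting point.\<close>

definition restrict_simple ::
  "('a \<Rightarrow> real) \<Rightarrow> ('a \<Rightarrow> real) \<Rightarrow> ('a, 'h) simple_proc \<Rightarrow> ('a, 'h) simple_proc"
  where "restrict_simple \<sigma> \<tau> L =
    map (\<lambda>(h, S, U). (h, \<lambda>\<omega>. max (S \<omega>) (\<sigma> \<omega>), \<lambda>\<omega>. max (min (U \<omega>) (\<tau> \<omega>)) (max (S \<omega>) (\<sigma> \<omega>)))) L"

lemma simple_val_negate: "simple_val (negate_simple L) r \<omega> = - simple_val L r \<omega>"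
  by (induction L) (auto simp: negate_simple_def simple_val_def)

lemma simple_integral_negate: "simple_integral X (negate_simple L) t \<omega> = - simple_integral X L t \<omega>"
  by (induction L) (auto simp: negate_simple_def simple_integral_def tensor_op_minus_left)

lemma simple_predictable_negate:
  fixes L :: "('a, 'h::{real_normed_vector, second_countable_topology}) simple_proc"
  shows "simple_predictable M F L \<Longrightarrow> simple_predictable M F (negate_simple L)"
  by (fastforce simp: simple_predictable_def negate_simple_def)

lemma simple_val_restrict:
  "simple_val (restrict_simple \<sigma> \<tau> L) r \<omega> = (if \<sigma> \<omega> < r \<and> r \<le> \<tau> \<omega> then simple_val L r \<omega> else 0)"
  by (induction L) (auto simp: restrict_simple_def simple_val_def)

lemma simple_integral_Cons:
  "simple_integral X ((h, S, U) # L) t \<omega> =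
    h \<omega> \<otimes>\<^sub>o (X (min t (U \<omega>)) \<omega> - X (min t (S \<omega>)) \<omega>) + simple_integral X L t \<omega>"
  by (simp add: simple_integral_def)

lemma restrict_simple_Cons:
  "restrict_simple \<sigma> \<tau> ((h, S, U) # L) =
    (h, \<lambda>\<omega>. max (S \<omega>) (\<sigma> \<omega>), \<lambda>\<omega>. max (min (U \<omega>) (\<tau> \<omega>)) (max (S \<omega>) (\<sigma> \<omega>))) # restrict_simple \<sigma> \<tau> L"
  by (simp add: restrict_simple_def)

lemma simple_integral_restrict:
  assumes "\<And>h S U. (h, S, U) \<in> set L \<Longrightarrow> S \<omega> \<le> U \<omega>" "\<sigma> \<omega> \<le> \<tau> \<omega>"
  shows "simple_integral X (restrict_simple \<sigma> \<tau> L) t \<omega> =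
    simple_integral X L (min t (\<tau> \<omega>)) \<omega> - simple_integral X L (min t (\<sigma> \<omega>)) \<omega>"
  using assms(1)
proof (induction L)
  case (Cons p L)
  obtain h S U where p: "p = (h, S, U)" by (rule prod_cases3)
  have SU: "S \<omega> \<le> U \<omega>" using Cons.prems p by auto
  let ?x = "\<lambda>s. X s \<omega>"
  have eq: "?x (min t (max (min (U \<omega>) (\<tau> \<omega>)) (max (S \<omega>) (\<sigma> \<omega>)))) - ?x (min t (max (S \<omega>) (\<sigma> \<omega>)))
      = (?x (min (min t (\<tau> \<omega>)) (U \<omega>)) - ?x (min (min t (\<tau> \<omega>)) (S \<omega>)))
        - (?x (min (min t (\<sigma> \<omega>)) (U \<omega>)) - ?x (min (min t (\<sigma> \<omega>)) (S \<omega>)))"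
    using SU assms(2) by (smt (verit) min_def max_def diff_self cancel_comm_monoid_add_class.diff_cancel diff_zero diff_diff_eq2 diff_add_cancel)
  have IH: "simple_integral X (restrict_simple \<sigma> \<tau> L) t \<omega> =
      simple_integral X L (min t (\<tau> \<omega>)) \<omega> - simple_integral X L (min t (\<sigma> \<omega>)) \<omega>"
    using Cons.prems by (intro Cons.IH) auto
  show ?case
    unfolding p restrict_simple_Cons simple_integral_Cons eq
    unfolding IH tensor_op_diff_right by simp
qed (simp add: restrict_simple_def simple_integral_def)

lemma simple_integral_0:
  assumes "\<And>h S U. (h, S, U) \<in> set L \<Longrightarrow> 0 \<le> S \<omega> \<and> S \<omega> \<le> U \<omega>"
  shows "simple_integral X L 0 \<omega> = 0"
  using assms by (induction L) (fastforce simp: simple_integral_def min_def)+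

context usual_conditions
begin

lemma simple_predictable_restrict:
  assumes L: "simple_predictable M F L"
    and st: "stopping_time F \<sigma>" "stopping_time F \<tau>"
  shows "simple_predictable M F (restrict_simple \<sigma> \<tau> L)"
proof -
  have "stopping_time F (\<lambda>\<omega>. max (S \<omega>) (\<sigma> \<omega>)) \<and>
      stopping_time F (\<lambda>\<omega>. max (min (U \<omega>) (\<tau> \<omega>)) (max (S \<omega>) (\<sigma> \<omega>))) \<and>
      h \<in> pre_sigma (\<lambda>\<omega>. max (S \<omega>) (\<sigma> \<omega>)) \<rightarrow>\<^sub>M borel"
    if "(h, S, U) \<in> set L" for h S U
  proof -
    have SU: "stopping_time F S" "stopping_time F U" "h \<in> pre_sigma S \<rightarrow>\<^sub>M borel"
      using L that by (auto simp: simple_predictable_def)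
    then show ?thesis
      using st measurable_pre_sigma_mono[OF SU(1) stopping_time_max[OF SU(1) st(1)] _ SU(3)]
      by (auto intro: stopping_time_max stopping_time_min)
  qed
  then show ?thesis
    using L by (fastforce simp: simple_predictable_def restrict_simple_def le_max_iff_disj)
qed

text \<open>The elementary integrals are additive in the integrand. Let \<open>L n\<close> be simple
processes that approximate \<open>Y\<close>, and \<open>R n\<close> the corresponding approximations of the restricted
integrand, whose elementary integrals can be computed from those of \<open>L n\<close>. If \<open>L' n\<close> is any other
approximation of the restricted integrand, then \<open>L n + L' n - R n\<close> again approximates \<open>Y\<close>. Hence
the integrals of \<open>L' n - R n\<close> tend to \<open>I - I = 0\<close>, so \<open>L' n\<close> and \<open>R n\<close> have the same limit.\<close>

theorem stoch_integral_restrict: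
  fixes X :: "real \<Rightarrow> 'a \<Rightarrow> 'h::{real_inner, second_countable_topology}"
  assumes I: "is_stoch_integral M F X Y I"
    and st: "stopping_time F \<sigma>" "stopping_time F \<tau>" "\<And>\<omega>. \<omega> \<in> space M \<Longrightarrow> 0 \<le> \<sigma> \<omega> \<and> \<sigma> \<omega> \<le> \<tau> \<omega>"
    and G: "G \<in> pre_sigma \<sigma> \<rightarrow>\<^sub>M borel"
  shows "is_stoch_integral M F X
    (\<lambda>r \<omega>. if \<sigma> \<omega> < r \<and> r \<le> \<tau> \<omega> then Y r \<omega> - G \<omega> else 0)
    (\<lambda>t \<omega>. I (min t (\<tau> \<omega>)) \<omega> - I (min t (\<sigma> \<omega>)) \<omega> - G \<omega> \<otimes>\<^sub>o (X (min t (\<tau> \<omega>)) \<omega> - X (min t (\<sigma> \<omega>)) \<omega>))"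
    (is "is_stoch_integral M F X ?Y ?J")
proof -
  obtain L where L: "\<And>n. simple_predictable M F (L n)" "ucp_tendsto M (\<lambda>n. simple_val (L n)) Y"
    using I by (auto simp: is_stoch_integral_def)
  have ext: "\<And>L. (\<And>n. simple_predictable M F (L n)) \<Longrightarrow> ucp_tendsto M (\<lambda>n. simple_val (L n)) Y \<Longrightarrow>
      ucp_tendsto M (\<lambda>n. simple_integral X (L n)) I"
    and I0: "AE \<omega> in M. I 0 \<omega> = 0"
    using I by (auto simp: is_stoch_integral_def)
  have st': "0 \<le> \<tau> \<omega>" if "\<omega> \<in> space M" for \<omega> using st(3)[OF that] by linarith
  have times: "0 \<le> S \<omega> \<and> S \<omega> \<le> U \<omega>" if "(h, S, U) \<in> set (L n)" "\<omega> \<in> space M" for h S U n \<omega>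
    using L(1)[of n] that by (auto simp: simple_predictable_def)
  define R where "R n = restrict_simple \<sigma> \<tau> (L n) @ [(\<lambda>\<omega>. - G \<omega>, \<sigma>, \<tau>)]" for n
  have R: "simple_predictable M F (R n)" for n
    unfolding R_def simple_predictable_append
    using simple_predictable_restrict[OF L(1) st(1,2)] st G by (simp add: simple_predictable_def)
  have R_val: "simple_val (R n) r \<omega> = (if \<sigma> \<omega> < r \<and> r \<le> \<tau> \<omega> then simple_val (L n) r \<omega> - G \<omega> else 0)" for n r \<omega>
    unfolding R_def simple_val_append simple_val_restrict by (simp add: simple_val_def)
  have R_ucp: "ucp_tendsto M (\<lambda>n. simple_val (R n)) ?Y"
    using L(2) by (rule ucp_tendsto_compare) (auto simp: R_val)
  have L_int: "ucp_tendsto M (\<lambda>n. simple_integral X (L n)) I" using L by (rule ext)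
  have zero: "AE \<omega> in M. \<forall>n. simple_integral X (L n) 0 \<omega> = I 0 \<omega>"
    using I0 AE_space by eventually_elim (auto intro!: simple_integral_0 dest: times)
  have R_int: "ucp_tendsto M (\<lambda>n. simple_integral X (R n)) ?J"
  proof (rule ucp_tendsto_cong)
    show "ucp_tendsto M
      (\<lambda>n t \<omega>. simple_integral X (L n) (min t (\<tau> \<omega>)) \<omega> - simple_integral X (L n) (min t (\<sigma> \<omega>)) \<omega>
        - G \<omega> \<otimes>\<^sub>o (X (min t (\<tau> \<omega>)) \<omega> - X (min t (\<sigma> \<omega>)) \<omega>)) ?J"
      using st(3) st' by (intro ucp_tendsto_diff ucp_tendsto_stopped[OF L_int zero] ucp_tendsto_const) auto
    fix n t \<omega> assume "\<omega> \<in> space M"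
    then have "simple_integral X (restrict_simple \<sigma> \<tau> (L n)) t \<omega> =
        simple_integral X (L n) (min t (\<tau> \<omega>)) \<omega> - simple_integral X (L n) (min t (\<sigma> \<omega>)) \<omega>"
      using times st(3) by (intro simple_integral_restrict) auto
    then show "simple_integral X (R n) t \<omega> =
        simple_integral X (L n) (min t (\<tau> \<omega>)) \<omega> - simple_integral X (L n) (min t (\<sigma> \<omega>)) \<omega>
        - G \<omega> \<otimes>\<^sub>o (X (min t (\<tau> \<omega>)) \<omega> - X (min t (\<sigma> \<omega>)) \<omega>)"
      unfolding R_def simple_integral_append by (simp add: simple_integral_def tensor_op_minus_left)
  qed simp
  have "ucp_tendsto M (\<lambda>n. simple_integral X (L' n)) ?J"
    if L': "\<And>n. simple_predictable M F (L' n)" "ucp_tendsto M (\<lambda>n. simple_val (L' n)) ?Y" for L'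
  proof -
    define K where "K n = L n @ L' n @ negate_simple (R n)" for n
    have "ucp_tendsto M (\<lambda>n. simple_val (K n)) Y"
    proof (rule ucp_tendsto_cong)
      show "ucp_tendsto M (\<lambda>n r \<omega>. simple_val (L n) r \<omega> + (simple_val (L' n) r \<omega> - simple_val (R n) r \<omega>))
          (\<lambda>r \<omega>. Y r \<omega> + (?Y r \<omega> - ?Y r \<omega>))"
        using L(2) L'(2) R_ucp by (intro ucp_tendsto_add ucp_tendsto_diff)
    qed (simp_all add: K_def simple_val_append simple_val_negate)
    moreover have "simple_predictable M F (K n)" for n
      unfolding K_def simple_predictable_append using L(1) L'(1) R by (simp add: simple_predictable_negate)
    ultimately have "ucp_tendsto M (\<lambda>n. simple_integral X (K n)) I" by (intro ext)
    then have "ucp_tendsto M (\<lambda>n t \<omega>. simple_integral X (K n) t \<omega> - simple_integral X (L n) t \<omega> + simple_integral X (R n) t \<omega>)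
        (\<lambda>t \<omega>. I t \<omega> - I t \<omega> + ?J t \<omega>)"
      using L_int R_int by (intro ucp_tendsto_add ucp_tendsto_diff)
    then show ?thesis
      by (rule ucp_tendsto_cong) (simp_all add: K_def simple_integral_append simple_integral_negate)
  qed
  moreover have "AE \<omega> in M. ?J 0 \<omega> = 0"
    using I0 AE_space
  proof eventually_elim
    case (elim \<omega>)
    then show ?case using st(3)[OF elim(2)] st'[OF elim(2)] by (simp add: min_absorb1)
  qed
  ultimately show ?thesis
    unfolding is_stoch_integral_def using R R_ucp by blast
qed

lemma stoch_integral_unique:
  assumes "is_stoch_integral M F X Y I" "is_stoch_integral M F X Y J" "0 < t"
  shows "AE \<omega> in M. I t \<omega> = J t \<omega>"
proof -
  obtain L where "\<And>n. simple_predictable M F (L n)" "ucp_tendsto M (\<lambda>n. simple_val (L n)) Y"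
    using assms(1) by (auto simp: is_stoch_integral_def)
  then have "ucp_tendsto M (\<lambda>n. simple_integral X (L n)) I" "ucp_tendsto M (\<lambda>n. simple_integral X (L n)) J"
    using assms(1,2) by (auto simp: is_stoch_integral_def)
  then show ?thesis using assms(3) by (rule ucp_tendsto_unique)
qed

end


section \<open>The stopped character\<close>

locale crit_process = usual_conditions M F
  for M :: "'a measure" and F :: "real \<Rightarrow> 'a measure" +
  fixes Z :: "real \<Rightarrow> 'a \<Rightarrow> 'h::{real_inner, banach, second_countable_topology} crit"
  assumes adapted: "adapted F crit_borel Z"
    and cadlag: "AE \<omega> in M. cadlag_path crit_topology (\<lambda>t. Z t \<omega>)"
begin

lemma Z_mem: "0 \<le> t \<Longrightarrow> \<omega> \<in> space M \<Longrightarrow> Z t \<omega> \<in> topspace crit_topology"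
  using adapted measurable_space[of "Z t" "F t" crit_borel \<omega>]
  by (simp add: adapted_def space_F space_crit_borel)

lemma right_continuous_path:
  "AE \<omega> in M. \<forall>t\<ge>0. limitin crit_topology (\<lambda>s. Z s \<omega>) (Z t \<omega>) (at_right t)"
  using cadlag by eventually_elim (simp add: cadlag_path_def)

text \<open>Applied to the vector component and to all matrix coefficients, which are continuous on the group
and hence inherit right continuity.\<close>

lemma measurable_Z_stopped:
  assumes \<tau>: "stopping_time F \<tau>" "\<And>\<omega>. \<omega> \<in> space M \<Longrightarrow> 0 \<le> \<tau> \<omega>"
  shows "(\<lambda>\<omega>. fst (Z (\<tau> \<omega>) \<omega>)) \<in> pre_sigma \<tau> \<rightarrow>\<^sub>M borel"
    and "(\<lambda>\<omega>. fst (snd (Z (\<tau> \<omega>) \<omega>))) \<in> pre_sigma \<tau> \<rightarrow>\<^sub>M op_sigma"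
    and "(\<lambda>\<omega>. snd (snd (Z (\<tau> \<omega>) \<omega>))) \<in> pre_sigma \<tau> \<rightarrow>\<^sub>M op_sigma"
proof -
  have stopped: "(\<lambda>\<omega>. c (Z (\<tau> \<omega>) \<omega>)) \<in> pre_sigma \<tau> \<rightarrow>\<^sub>M borel"
    if c: "continuous_map crit_topology euclidean c"
    for c :: "'h crit \<Rightarrow> 'b::{real_normed_vector, second_countable_topology}"
  proof (rule measurable_stopped_value[OF _ _ \<tau>])
    show "(\<lambda>\<omega>. c (Z t \<omega>)) \<in> borel_measurable (F t)" if "0 \<le> t" for t
      using adapted that measurable_crit_borel_continuous[OF c]
      by (auto simp: adapted_def intro: measurable_compose)
    show "AE \<omega> in M. \<forall>t\<ge>0. ((\<lambda>s. c (Z s \<omega>)) \<longlongrightarrow> c (Z t \<omega>)) (at_right t)"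
      using right_continuous_path
    proof eventually_elim
      case (elim \<omega>)
      then show ?case using continuous_map_limit[OF c] by (fastforce simp: o_def)
    qed
  qed
  show "(\<lambda>\<omega>. fst (Z (\<tau> \<omega>) \<omega>)) \<in> pre_sigma \<tau> \<rightarrow>\<^sub>M borel"
    by (rule stopped) (simp add: crit_topology_def continuous_map_fst)
  show "(\<lambda>\<omega>. fst (snd (Z (\<tau> \<omega>) \<omega>))) \<in> pre_sigma \<tau> \<rightarrow>\<^sub>M op_sigma"
    "(\<lambda>\<omega>. snd (snd (Z (\<tau> \<omega>) \<omega>))) \<in> pre_sigma \<tau> \<rightarrow>\<^sub>M op_sigma"
    unfolding measurable_op_sigma_iff by (intro allI stopped continuous_map_crit_coefficients)+
qed

lemma measurable_stopped_character:
  assumes st: "stopping_pair M F T \<sigma> \<tau>"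
  shows "stopped_character Z \<sigma> \<tau> \<in> pre_sigma \<tau> \<rightarrow>\<^sub>M crit_borel"
proof -
  have \<sigma>: "stopping_time F \<sigma>" "\<And>\<omega>. \<omega> \<in> space M \<Longrightarrow> 0 \<le> \<sigma> \<omega>"
    and \<tau>: "stopping_time F \<tau>" "\<And>\<omega>. \<omega> \<in> space M \<Longrightarrow> 0 \<le> \<tau> \<omega>"
    and le: "\<And>\<omega>. \<omega> \<in> space M \<Longrightarrow> \<sigma> \<omega> \<le> \<tau> \<omega>"
    using st by (auto simp: stopping_pair_def intro: order_trans)
  have "(\<lambda>\<omega>. crit_inv (Z (\<sigma> \<omega>) \<omega>) \<circ>\<^sub>G Z (\<tau> \<omega>) \<omega>) \<in> pre_sigma \<tau> \<rightarrow>\<^sub>M crit_borel"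
    by (intro measurable_crit_increment measurable_Z_stopped[OF \<tau>]
        measurable_pre_sigma_mono[OF \<sigma>(1) \<tau>(1) le] measurable_Z_stopped[OF \<sigma>])
      (auto simp: space_pre_sigma intro: Z_mem \<sigma> \<tau>)
  then show ?thesis unfolding stopped_character_def[abs_def] .
qed

lemma stopped_character_dyadic_tendsto:
  assumes T: "T > 0" and st: "stopping_pair M F T \<sigma> \<tau>"
  shows "tends_0_in_prob M (\<lambda>n \<omega>. ennreal (crit_dist
    (stopped_character Z (\<lambda>\<omega>. right_dyadic T n (\<sigma> \<omega>)) (\<lambda>\<omega>. right_dyadic T n (\<tau> \<omega>)) \<omega>)
    (stopped_character Z \<sigma> \<tau> \<omega>)))"
proof (rule AE_tendsto_imp_tends_0_in_prob)
  have meas: "stopped_character Z \<sigma>' \<tau>' \<in> M \<rightarrow>\<^sub>M crit_borel" if "stopping_pair M F T \<sigma>' \<tau>'" for \<sigma>' \<tau>'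
    using that measurable_stopped_character[OF that]
    by (intro measurable_pre_sigma_M[of \<tau>']) (auto simp: stopping_pair_def)
  show "(\<lambda>\<omega>. crit_dist
      (stopped_character Z (\<lambda>\<omega>. right_dyadic T n (\<sigma> \<omega>)) (\<lambda>\<omega>. right_dyadic T n (\<tau> \<omega>)) \<omega>)
      (stopped_character Z \<sigma> \<tau> \<omega>)) \<in> borel_measurable M" for n
    by (intro measurable_crit_dist meas stopping_pair_right_dyadic T st)
  show "AE \<omega> in M. (\<lambda>n. crit_dist
      (stopped_character Z (\<lambda>\<omega>. right_dyadic T n (\<sigma> \<omega>)) (\<lambda>\<omega>. right_dyadic T n (\<tau> \<omega>)) \<omega>)
      (stopped_character Z \<sigma> \<tau> \<omega>)) \<longlonglongrightarrow> 0"
    using right_continuous_path AE_space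
  proof eventually_elim
    case (elim \<omega>)
    have pos: "0 \<le> \<sigma> \<omega>" "0 \<le> \<tau> \<omega>"
      using st elim(2) by (auto simp: stopping_pair_def intro: order_trans)
    have lim: "limitin crit_topology (\<lambda>n. Z (right_dyadic T n r) \<omega>) (Z r \<omega>) sequentially" if "0 \<le> r" for r
      using elim(1) that right_dyadic_tendsto[OF T] right_dyadic_ge[OF T]
      by (intro limitin_at_right_sequence[where f = "\<lambda>t. Z t \<omega>"]) auto
    have mem: "Z (right_dyadic T n r) \<omega> \<in> topspace crit_topology" if "0 \<le> r" for n r
      using that right_dyadic_ge[OF T, of r n] elim(2) by (intro Z_mem) auto
    show ?case
      unfolding stopped_character_def by (intro crit_dist_increment_tendsto lim mem pos)
  qed
qed

lemma dyadic_extension_stopped_character: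
  assumes T: "T > 0"
  shows "dyadic_extension M F T Z (stopped_character Z)"
proof -
  have "stopped_character Z \<sigma> \<tau> \<in> M \<rightarrow>\<^sub>M crit_borel" if "stopping_pair M F T \<sigma> \<tau>" for \<sigma> \<tau>
    using that measurable_stopped_character[OF that]
    by (intro measurable_pre_sigma_M[of \<tau>]) (auto simp: stopping_pair_def)
  then show ?thesis
    unfolding dyadic_extension_def
    using stopped_character_dyadic_tendsto[OF T]
    by (simp add: stopped_character_def det_character_def)
qed

text \<open>On finite-valued stopping pairs any two extensions agree, and both sides converge along the dyadic
approximation. Comparing the limits through norms instead of \<^const>\<open>crit_dist\<close> makes the genuine
triangle inequality available.\<close>

lemma dyadic_extension_unique:
  assumes T: "T > 0" and Y: "dyadic_extension M F T Z Y" and st: "stopping_pair M F T \<sigma> \<tau>"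
  shows "AE \<omega> in M. Y \<sigma> \<tau> \<omega> = stopped_character Z \<sigma> \<tau> \<omega>"
proof -
  let ?s = "\<lambda>n \<omega>. right_dyadic T n (\<sigma> \<omega>)" and ?t = "\<lambda>n \<omega>. right_dyadic T n (\<tau> \<omega>)"
  let ?\<Phi> = "stopped_character Z"
  let ?gap = "\<lambda>p p'. norm (fst p - fst p') + norm (fst (snd p) - fst (snd p'))
     + norm (snd (snd p) - snd (snd p'))"
  note \<Phi> = dyadic_extension_stopped_character[OF T]
  have st_n: "stopping_pair M F T (?s n) (?t n)" for n
    by (rule stopping_pair_right_dyadic[OF T st])
  have fin: "finite (?s n ` space M)" "finite (?t n ` space M)" for n
    using st by (auto simp: stopping_pair_def intro!: finite_right_dyadic_image[OF T] intro: order_trans)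
  have mem: "Y' \<sigma>' \<tau>' \<omega> \<in> topspace crit_topology"
    if "dyadic_extension M F T Z Y'" "stopping_pair M F T \<sigma>' \<tau>'" "\<omega> \<in> space M" for Y' \<sigma>' \<tau>' \<omega>
    using that measurable_space[of "Y' \<sigma>' \<tau>'" M crit_borel \<omega>]
    by (simp add: dyadic_extension_def space_crit_borel)
  have "AE \<omega> in M. Y (?s n) (?t n) \<omega> = ?\<Phi> (?s n) (?t n) \<omega>" for n
    using Y st_n fin by (auto simp: dyadic_extension_def stopped_character_def det_character_def)
  then have eq: "AE \<omega> in M. \<forall>n. Y (?s n) (?t n) \<omega> = ?\<Phi> (?s n) (?t n) \<omega>"
    by (simp add: AE_all_countable)
  have "tends_0_in_prob M (\<lambda>n \<omega>. ennreal (crit_dist (Y (?s n) (?t n) \<omega>) (Y \<sigma> \<tau> \<omega>))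
      + ennreal (crit_dist (?\<Phi> (?s n) (?t n) \<omega>) (?\<Phi> \<sigma> \<tau> \<omega>)))"
    using Y \<Phi> st by (intro tends_0_in_prob_add) (auto simp: dyadic_extension_def)
  then have "tends_0_in_prob M (\<lambda>n \<omega>. ennreal (?gap (Y \<sigma> \<tau> \<omega>) (?\<Phi> \<sigma> \<tau> \<omega>)))"
  proof (rule tends_0_in_prob_compare)
    show "AE \<omega> in M. \<forall>n. ennreal (?gap (Y \<sigma> \<tau> \<omega>) (?\<Phi> \<sigma> \<tau> \<omega>))
        \<le> ennreal (crit_dist (Y (?s n) (?t n) \<omega>) (Y \<sigma> \<tau> \<omega>))
          + ennreal (crit_dist (?\<Phi> (?s n) (?t n) \<omega>) (?\<Phi> \<sigma> \<tau> \<omega>))"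
      using eq AE_space
    proof eventually_elim
      case (elim \<omega>)
      show ?case
      proof
        fix n
        let ?p = "?\<Phi> (?s n) (?t n) \<omega>" and ?y = "Y \<sigma> \<tau> \<omega>" and ?\<phi> = "?\<Phi> \<sigma> \<tau> \<omega>"
        have triangle: "norm (a - c) \<le> norm (b - a) + norm (b - c)" for a b c :: "'z::real_normed_vector"
          using norm_triangle_ineq4[of "b - c" "b - a"] by (simp add: add.commute)
        have "?gap ?y ?\<phi> \<le> ?gap ?p ?y + ?gap ?p ?\<phi>"
          using triangle[of "fst ?y" "fst ?\<phi>" "fst ?p"]
            triangle[of "fst (snd ?y)" "fst (snd ?\<phi>)" "fst (snd ?p)"]
            triangle[of "snd (snd ?y)" "snd (snd ?\<phi>)" "snd (snd ?p)"] by linarith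
        also have "\<dots> \<le> crit_dist ?p ?y + crit_dist ?p ?\<phi>"
          using elim(2) Y \<Phi> st st_n by (intro add_mono norms_le_crit_dist mem[of _ _ _ \<omega>])
        finally have gap: "?gap ?y ?\<phi> \<le> crit_dist ?p ?y + crit_dist ?p ?\<phi>" .
        have "0 \<le> crit_dist ?p ?y" "0 \<le> crit_dist ?p ?\<phi>"
          using norms_le_crit_dist[OF mem[OF \<Phi> st_n elim(2)] mem[OF Y st elim(2)]]
            norms_le_crit_dist[OF mem[OF \<Phi> st_n elim(2)] mem[OF \<Phi> st elim(2)]]
          by (meson add_nonneg_nonneg norm_ge_zero order_trans)+
        with gap show "ennreal (?gap ?y ?\<phi>) \<le> ennreal (crit_dist (Y (?s n) (?t n) \<omega>) ?y) + ennreal (crit_dist ?p ?\<phi>)"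
          using elim(1) by (simp add: ennreal_plus[symmetric] ennreal_leI del: ennreal_plus)
      qed
    qed
  qed
  from tends_0_in_prob_const[OF this] show ?thesis
  proof eventually_elim
    case (elim \<omega>)
    then have "?gap (Y \<sigma> \<tau> \<omega>) (?\<Phi> \<sigma> \<tau> \<omega>) \<le> 0" by (simp add: ennreal_eq_0_iff)
    then have "fst (Y \<sigma> \<tau> \<omega>) = fst (?\<Phi> \<sigma> \<tau> \<omega>)" "fst (snd (Y \<sigma> \<tau> \<omega>)) = fst (snd (?\<Phi> \<sigma> \<tau> \<omega>))"
      "snd (snd (Y \<sigma> \<tau> \<omega>)) = snd (snd (?\<Phi> \<sigma> \<tau> \<omega>))"
      by (smt (verit) norm_ge_zero norm_eq_zero eq_iff_diff_eq_0)+
    then show ?case by (simp add: prod_eq_iff)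
  qed
qed

text \<open>On \<open>(\<sigma>, \<tau>]\<close> the integrand \<open>X\<^sub>r\<^sub>- - X\<^sub>\<sigma>\<close> has the integral
\<open>I\<^sub>\<tau> - I\<^sub>\<sigma> - X\<^sub>\<sigma> \<otimes> (X\<^sub>\<tau> - X\<^sub>\<sigma>)\<close>. Antisymmetrising kills \<open>X\<^sub>\<sigma> \<otimes> X\<^sub>\<sigma>\<close>, and what remains of the last
term is \<open>X\<^sub>\<sigma> \<and> X\<^sub>\<tau> / 2\<close>, exactly the correction in the group product.\<close>

lemma stopped_area_is_stoch_integral:
  assumes I: "is_stoch_integral M F (\<lambda>t \<omega>. fst (Z t \<omega>)) (left_lim (\<lambda>t \<omega>. fst (Z t \<omega>))) I"
    and A: "AE \<omega> in M. \<forall>t\<ge>0. fst (snd (Z t \<omega>)) = Alt2 (I t \<omega>)"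
    and st: "stopping_pair M F T \<sigma> \<tau>" and T: "T > 0"
  defines "Y \<equiv> \<lambda>r \<omega>. if \<sigma> \<omega> < r \<and> r \<le> \<tau> \<omega>
      then left_lim (\<lambda>t \<omega>. fst (Z t \<omega>)) r \<omega> - fst (Z (\<sigma> \<omega>) \<omega>) else 0"
  shows "\<exists>J. is_stoch_integral M F (\<lambda>t \<omega>. fst (Z t \<omega>)) Y J"
    and "is_stoch_integral M F (\<lambda>t \<omega>. fst (Z t \<omega>)) Y J \<Longrightarrow>
      AE \<omega> in M. fst (snd (stopped_character Z \<sigma> \<tau> \<omega>)) = Alt2 (J T \<omega>)"
proof -
  define X where "X t \<omega> = fst (Z t \<omega>)" for t \<omega>
  define J0 where "J0 t \<omega> = I (min t (\<tau> \<omega>)) \<omega> - I (min t (\<sigma> \<omega>)) \<omega>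
    - X (\<sigma> \<omega>) \<omega> \<otimes>\<^sub>o (X (min t (\<tau> \<omega>)) \<omega> - X (min t (\<sigma> \<omega>)) \<omega>)" for t \<omega>
  have bounds: "0 \<le> \<sigma> \<omega> \<and> \<sigma> \<omega> \<le> \<tau> \<omega>" "\<tau> \<omega> \<le> T" if "\<omega> \<in> space M" for \<omega>
    using st that by (auto simp: stopping_pair_def)
  have st_\<sigma>: "stopping_time F \<sigma>" and st_\<tau>: "stopping_time F \<tau>"
    using st by (auto simp: stopping_pair_def)
  have "(\<lambda>\<omega>. X (\<sigma> \<omega>) \<omega>) \<in> pre_sigma \<sigma> \<rightarrow>\<^sub>M borel"
    unfolding X_def by (rule measurable_Z_stopped) (use st_\<sigma> bounds in auto)
  from stoch_integral_restrict[OF I st_\<sigma> st_\<tau> bounds(1) this]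
  have J0: "is_stoch_integral M F X Y J0"
    unfolding Y_def J0_def X_def .
  then show "\<exists>J. is_stoch_integral M F (\<lambda>t \<omega>. fst (Z t \<omega>)) Y J" unfolding X_def by blast
  assume "is_stoch_integral M F (\<lambda>t \<omega>. fst (Z t \<omega>)) Y J"
  then have "AE \<omega> in M. J T \<omega> = J0 T \<omega>"
    using J0 T unfolding X_def by (rule stoch_integral_unique)
  then show "AE \<omega> in M. fst (snd (stopped_character Z \<sigma> \<tau> \<omega>)) = Alt2 (J T \<omega>)"
    using A AE_space
  proof eventually_elim
    case (elim \<omega>)
    have b: "0 \<le> \<sigma> \<omega>" "\<sigma> \<omega> \<le> \<tau> \<omega>" "\<tau> \<omega> \<le> T" using bounds[OF elim(3)] by auto
    have "J T \<omega> = I (\<tau> \<omega>) \<omega> - I (\<sigma> \<omega>) \<omega> - X (\<sigma> \<omega>) \<omega> \<otimes>\<^sub>o (X (\<tau> \<omega>) \<omega> - X (\<sigma> \<omega>) \<omega>)"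
      using elim(1) b by (simp add: J0_def min_absorb2)
    then have "Alt2 (J T \<omega>) = fst (snd (Z (\<tau> \<omega>) \<omega>)) - fst (snd (Z (\<sigma> \<omega>) \<omega>))
        - Alt2 (X (\<sigma> \<omega>) \<omega> \<otimes>\<^sub>o (X (\<tau> \<omega>) \<omega> - X (\<sigma> \<omega>) \<omega>))"
      using elim(2) b by (simp add: Alt2_diff)
    also have "Alt2 (X (\<sigma> \<omega>) \<omega> \<otimes>\<^sub>o (X (\<tau> \<omega>) \<omega> - X (\<sigma> \<omega>) \<omega>)) = ((1/2) *\<^sub>R X (\<sigma> \<omega>) \<omega>) \<and>\<^sub>o X (\<tau> \<omega>) \<omega>"
      by (simp add: Alt2_tensor wedge_op_simps) (simp add: wedge_op_def tensor_op_diff_left tensor_op_diff_right)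
    finally show ?case by (simp add: stopped_character_def crit_increment_eq X_def)
  qed
qed

end

theorem theorem6p20:
  fixes M :: "'a measure" and F :: "real \<Rightarrow> 'a measure"
    and X :: "real \<Rightarrow> 'a \<Rightarrow> 'h::{real_inner, banach, second_countable_topology}"
    and A Q :: "real \<Rightarrow> 'a \<Rightarrow> ('h \<Rightarrow>\<^sub>L 'h)"
    and Z :: "real \<Rightarrow> 'a \<Rightarrow> 'h crit"
    and T :: real
  assumes usual: "usual_conditions M F"
    and Z: "Z = (\<lambda>t \<omega>. (X t \<omega>, A t \<omega>, Q t \<omega>))"
    and adapted: "adapted F crit_borel Z"
    and cadlag: "AE \<omega> in M. cadlag_path crit_topology (\<lambda>t. Z t \<omega>)"
    and start: "AE \<omega> in M. Z 0 \<omega> = (0, 0, 0)"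
    and T: "T > 0"
  shows
    "(\<forall>\<sigma> \<tau>. stopping_pair M F T \<sigma> \<tau> \<longrightarrow>
       (\<forall>\<omega>\<in>space M. stopped_character Z \<sigma> \<tau> \<omega> =
          (X (\<tau> \<omega>) \<omega> - X (\<sigma> \<omega>) \<omega>,
           A (\<tau> \<omega>) \<omega> - A (\<sigma> \<omega>) \<omega> - (1/2) *\<^sub>R (X (\<sigma> \<omega>) \<omega> \<and>\<^sub>o X (\<tau> \<omega>) \<omega>),
           Q (\<tau> \<omega>) \<omega> - Q (\<sigma> \<omega>) \<omega>)) \<and>
       stopped_character Z \<sigma> \<tau> \<in> stopped_sigma M F \<tau> \<rightarrow>\<^sub>M crit_borel) \<and>
     (\<exists>E\<in>sets M. measure M E = 1 \<and>
       (\<forall>\<omega>\<in>E. \<forall>\<sigma> \<rho> \<tau>. (\<exists>T'. stopping_pair M F T' \<sigma> \<rho> \<and> stopping_pair M F T' \<rho> \<tau>) \<longrightarrow>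
          stopped_character Z \<sigma> \<tau> \<omega> =
            stopped_character Z \<sigma> \<rho> \<omega> \<circ>\<^sub>G stopped_character Z \<rho> \<tau> \<omega>)) \<and>
     dyadic_extension M F T Z (stopped_character Z) \<and>
     (\<forall>Y. dyadic_extension M F T Z Y \<longrightarrow>
       (\<forall>\<sigma> \<tau>. stopping_pair M F T \<sigma> \<tau> \<longrightarrow>
          (AE \<omega> in M. Y \<sigma> \<tau> \<omega> = stopped_character Z \<sigma> \<tau> \<omega>))) \<and>
     (\<forall>I V.
       semimartingale M F X \<longrightarrow>
       is_stoch_integral M F X (left_lim X) I \<longrightarrow>
       (AE \<omega> in M. \<forall>t\<ge>0. A t \<omega> = Alt2 (I t \<omega>)) \<longrightarrow>
       is_quad_variation M F X V \<longrightarrow>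
       (AE \<omega> in M. \<forall>t\<ge>0. Q t \<omega> = V t \<omega>) \<longrightarrow>
       (\<forall>\<sigma> \<tau>. stopping_pair M F T \<sigma> \<tau> \<longrightarrow>
         (AE \<omega> in M. fst (stopped_character Z \<sigma> \<tau> \<omega>) = X (\<tau> \<omega>) \<omega> - X (\<sigma> \<omega>) \<omega>) \<and>
         (AE \<omega> in M. snd (snd (stopped_character Z \<sigma> \<tau> \<omega>)) = V (\<tau> \<omega>) \<omega> - V (\<sigma> \<omega>) \<omega>) \<and>
         (let Y = (\<lambda>r \<omega>. if \<sigma> \<omega> < r \<and> r \<le> \<tau> \<omega> then left_lim X r \<omega> - X (\<sigma> \<omega>) \<omega> else 0) in
            (\<exists>J. is_stoch_integral M F X Y J) \<and>
            (\<forall>J. is_stoch_integral M F X Y J \<longrightarrow>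
               (AE \<omega> in M. fst (snd (stopped_character Z \<sigma> \<tau> \<omega>)) = Alt2 (J T \<omega>))))))"
    (is "?measurable \<and> ?multiplicative \<and> ?extension \<and> ?unique \<and> ?semimartingale")
proof (intro conjI)
  interpret usual_conditions M F by (rule usual)
  interpret crit_process M F Z by unfold_locales (fact adapted cadlag)+
  have formula: "stopped_character Z \<sigma> \<tau> \<omega> =
      (X (\<tau> \<omega>) \<omega> - X (\<sigma> \<omega>) \<omega>,
       A (\<tau> \<omega>) \<omega> - A (\<sigma> \<omega>) \<omega> - (1/2) *\<^sub>R (X (\<sigma> \<omega>) \<omega> \<and>\<^sub>o X (\<tau> \<omega>) \<omega>),
       Q (\<tau> \<omega>) \<omega> - Q (\<sigma> \<omega>) \<omega>)" for \<sigma> \<tau> \<omega>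
    by (simp add: stopped_character_def Z wedge_op_simps)
  show ?measurable using formula measurable_stopped_character by blast
  show ?multiplicative
    by (intro bexI[of _ "space M"] conjI ballI allI impI)
      (simp_all add: prob_space stopped_character_def crit_increment_mult)
  show ?extension by (rule dyadic_extension_stopped_character[OF T])
  show ?unique using dyadic_extension_unique[OF T] by blast
  show ?semimartingale
  proof (intro allI impI)
    fix I V \<sigma> \<tau>
    assume I: "is_stoch_integral M F X (left_lim X) I"
      and A: "AE \<omega> in M. \<forall>t\<ge>0. A t \<omega> = Alt2 (I t \<omega>)"
      and V: "AE \<omega> in M. \<forall>t\<ge>0. Q t \<omega> = V t \<omega>"
      and st: "stopping_pair M F T \<sigma> \<tau>"
    have fst_Z: "fst (Z t \<omega>) = X t \<omega>" for t \<omega> by (simp add: Z)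
    have A': "AE \<omega> in M. \<forall>t\<ge>0. fst (snd (Z t \<omega>)) = Alt2 (I t \<omega>)"
      using A by (simp add: Z)
    have "AE \<omega> in M. snd (snd (stopped_character Z \<sigma> \<tau> \<omega>)) = V (\<tau> \<omega>) \<omega> - V (\<sigma> \<omega>) \<omega>"
      using V AE_space
    proof eventually_elim
      case (elim \<omega>)
      have "0 \<le> \<sigma> \<omega>" "0 \<le> \<tau> \<omega>"
        using st elim(2) by (auto simp: stopping_pair_def intro: order_trans)
      then show ?case using elim(1) by (simp add: formula)
    qed
    moreover note stopped_area_is_stoch_integral[OF _ A' st T, unfolded fst_Z, OF I]
    ultimately show "(AE \<omega> in M. fst (stopped_character Z \<sigma> \<tau> \<omega>) = X (\<tau> \<omega>) \<omega> - X (\<sigma> \<omega>) \<omega>) \<and>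
         (AE \<omega> in M. snd (snd (stopped_character Z \<sigma> \<tau> \<omega>)) = V (\<tau> \<omega>) \<omega> - V (\<sigma> \<omega>) \<omega>) \<and>
         (let Y = (\<lambda>r \<omega>. if \<sigma> \<omega> < r \<and> r \<le> \<tau> \<omega> then left_lim X r \<omega> - X (\<sigma> \<omega>) \<omega> else 0) in
            (\<exists>J. is_stoch_integral M F X Y J) \<and>
            (\<forall>J. is_stoch_integral M F X Y J \<longrightarrow>
               (AE \<omega> in M. fst (snd (stopped_character Z \<sigma> \<tau> \<omega>)) = Alt2 (J T \<omega>))))"
      by (simp add: formula Let_def)
  qed
qed

end
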